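(* Let $\beta\in(-1,1)$, $\mu_+>0$ and $\mu_-<0$, and let $X$ be the refracted skew Brownian motion with parameters $(\beta,\mu_+,\mu_-)$, skew level $a=0$ and starting point $X_0=x\in\mathbb{R}$ (law $\mathbb{P}_x$). Then $$\mathbb{P}_x\Big(\lim_{t\to\infty}X_t=\infty\Big)=\begin{cases}\dfrac{(1+\beta)\mu_+e^{-2\mu_-x}}{(1+\beta)\mu_+-(1-\beta)\mu_-}, & x<0,\\[3mm] 1+\dfrac{(1-\beta)\mu_-e^{-2\mu_+x}}{(1+\beta)\mu_+-(1-\beta)\mu_-}, & x>0,\end{cases}$$ and $$\mathbb{P}_x\Big(\lim_{t\to\infty}X_t=-\infty\Big)=\begin{cases}1-\dfrac{(1+\beta)\mu_+e^{-2\mu_-x}}{(1+\beta)\mu_+-(1-\beta)\mu_-}, & x<0,\\[3mm] \dfrac{-(1-\beta)\mu_-e^{-2\mu_+x}}{(1+\beta)\mu_+-(1-\beta)\mu_-}, & x>0.\end{cases}$$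
   Context: The refracted skew Brownian motion with parameters $\beta\in(-1,1)$, $\mu_+,\mu_-\in\mathbb{R}$ and skew level $a\in\mathbb{R}$ is the pathwise unique (strong) solution $X$ of $$X_t=X_0+B_t+\beta L^X(t,a)+\mu_+\int_0^t \mathbf{1}_{\{X_s>a\}}\,\mathrm{d}s+\mu_-\int_0^t\mathbf{1}_{\{X_s<a\}}\,\mathrm{d}s,\qquad t\ge 0,$$ where $B$ is a standard Brownian motion and $L^X(t,a)=\lim_{\epsilon\to0^+}\frac{1}{2\epsilon}\mathrm{Leb}(\{s\le t:|X_s-a|\le\epsilon\})$ is the symmetric local time of $X$ at level $a$. *)

theory Defs
  imports "HOL-Probability.Probability"
begin

text \<open>
  Processes are indexed by \<^typ>\<open>real\<close>; only their values at times \<open>t \<ge> 0\<close> matter.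
  A continuous process has continuous paths for every \<open>\<omega>\<close>, so that the events
  \<open>{\<omega>. X t \<omega> tends to \<plusminus>\<infinity>}\<close> are measurable without completeness of the underlying space.
\<close>

definition continuous_process :: "'a measure \<Rightarrow> (real \<Rightarrow> 'a \<Rightarrow> real) \<Rightarrow> bool" where
  "continuous_process M X \<longleftrightarrow>
     (\<forall>t\<ge>0. X t \<in> borel_measurable M) \<and>
     (\<forall>\<omega>\<in>space M. continuous_on {0..} (\<lambda>t. X t \<omega>))"

definition standard_brownian_motion :: "'a measure \<Rightarrow> (real \<Rightarrow> 'a \<Rightarrow> real) \<Rightarrow> bool" where
  "standard_brownian_motion M B \<longleftrightarrow>
     prob_space M \<and>
     continuous_process M B \<and>
     (AE \<omega> in M. B 0 \<omega> = 0) \<and>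
     (\<forall>s t. 0 \<le> s \<longrightarrow> s < t \<longrightarrow>
        distributed M lborel (\<lambda>\<omega>. B t \<omega> - B s \<omega>) (normal_density 0 (sqrt (t - s)))) \<and>
     (\<forall>(n::nat) \<tau>. 0 \<le> \<tau> 0 \<longrightarrow> mono_on {..n} \<tau> \<longrightarrow>
        prob_space.indep_vars M (\<lambda>_. borel) (\<lambda>i \<omega>. B (\<tau> (Suc i)) \<omega> - B (\<tau> i) \<omega>) {..<n})"

text \<open>
  The natural filtration of \<open>B\<close> augmented by the null sets of \<open>M\<close>. The usual augmentation,
  by all subsets of null sets, is the case where \<open>M\<close> is complete.
\<close>

definition augmented_filtration :: "'a measure \<Rightarrow> (real \<Rightarrow> 'a \<Rightarrow> real) \<Rightarrow> real \<Rightarrow> 'a measure" where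
  "augmented_filtration M B t =
     sigma (space M)
       ({B u -` A \<inter> space M | u A. 0 \<le> u \<and> u \<le> t \<and> A \<in> sets borel} \<union> null_sets M)"

text \<open>
  The symmetric local time of a path \<open>f\<close> at level \<open>a\<close> is a relation rather than a function, since
  it presupposes that the limit exists.
\<close>

definition has_symmetric_local_time :: "(real \<Rightarrow> real) \<Rightarrow> real \<Rightarrow> real \<Rightarrow> real \<Rightarrow> bool" where
  "has_symmetric_local_time f t a l \<longleftrightarrow>
     ((\<lambda>\<epsilon>. 1 / (2 * \<epsilon>) * measure lborel {s \<in> {0..t}. \<bar>f s - a\<bar> \<le> \<epsilon>}) \<longlongrightarrow> l) (at_right 0)"

text \<open>
  \<open>X\<close> is a strong solution, driven by \<open>B\<close> and started at \<open>x\<close>, of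
  \<open>X\<^sub>t = X\<^sub>0 + B\<^sub>t + \<beta> L(t,a) + \<mu>p \<integral>\<^sub>0\<^sup>t 1{X\<^sub>s > a} ds + \<mu>m \<integral>\<^sub>0\<^sup>t 1{X\<^sub>s < a} ds\<close>.
  Strong means that \<open>X\<close> is adapted to the augmented filtration of \<open>B\<close>; as the starting point is
  deterministic, \<open>X\<^sub>0\<close> contributes nothing to it. Pathwise uniqueness is a property of the
  equation and not part of the definition.
\<close>

definition refracted_skew_brownian_motion ::
    "'a measure \<Rightarrow> (real \<Rightarrow> 'a \<Rightarrow> real) \<Rightarrow> real \<Rightarrow> real \<Rightarrow> real \<Rightarrow> real \<Rightarrow> real \<Rightarrow>
     (real \<Rightarrow> 'a \<Rightarrow> real) \<Rightarrow> bool" where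
  "refracted_skew_brownian_motion M B \<beta> \<mu>p \<mu>m a x X \<longleftrightarrow>
     standard_brownian_motion M B \<and>
     continuous_process M X \<and>
     (\<forall>t\<ge>0. X t \<in> borel_measurable (augmented_filtration M B t)) \<and>
     (AE \<omega> in M. X 0 \<omega> = x) \<and>
     (AE \<omega> in M. \<forall>t\<ge>0. \<exists>l. has_symmetric_local_time (\<lambda>s. X s \<omega>) t a l \<and>
        X t \<omega> = X 0 \<omega> + B t \<omega> + \<beta> * l
          + \<mu>p * (LBINT s:{0..t}. indicator {a<..} (X s \<omega>))
          + \<mu>m * (LBINT s:{0..t}. indicator {..<a} (X s \<omega>)))"

end

theory Submission
  imports Defs
begin

text \<open>
  The scale function \<open>s\<close> of the diffusion solves \<open>s''/2 + \<mu>p s' = 0\<close> on the right half-line and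
  \<open>s''/2 + \<mu>m s' = 0\<close> on the left one, and its one-sided slopes at \<open>0\<close> are \<open>s'(0+) = 1 - \<beta>\<close> and
  \<open>s'(0-) = 1 + \<beta>\<close>. The differential equations cancel the drift of \<open>s(X)\<close>. The slopes cancel its
  local time: the jump of the derivative contributes \<open>(s'(0+) - s'(0-))/2 = -\<beta>\<close> times the
  symmetric local time, and the skew term of the equation contributes \<open>\<beta>\<close> times the mean slope,
  which is \<open>1\<close>. Hence \<open>s(X)\<close> is a martingale. It is bounded because \<open>\<mu>p > 0 > \<mu>m\<close> makes \<open>s(\<infinity>)\<close> and
  \<open>s(-\<infinity>)\<close> finite, so it converges almost surely. A limit strictly between the two end values would
  confine \<open>X\<close> to a bounded set from some time on, which is impossible because \<open>X\<close> spends only a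
  finite time in every bounded set. So \<open>X\<close> tends to \<open>\<infinity>\<close> or to \<open>-\<infinity>\<close>, and letting \<open>n\<close> tend to
  infinity in \<open>E s(X\<^sub>n) = s(x)\<close> gives a linear equation that determines the two probabilities.

  No stochastic integral is constructed; what is needed of Ito calculus is obtained from sums over
  dyadic grids. For a function \<open>f\<close> of class \<open>C\<^sup>2\<close> the Taylor expansion along a single path shows that
  the sums of \<open>f'(X) \<Delta>B\<close> converge to the increment of \<open>f(X)\<close> minus its finite variation part
  (\<open>ito_pathwise\<close>); the only probabilistic input is that the sums of \<open>(\<Delta>B)\<^sup>2 - \<Delta>t\<close>, with bounded
  adapted weights, tend to \<open>0\<close> almost surely. Because increments of \<open>B\<close> are independent of the
  augmented past (\<open>bm_increment_indep\<close>), the sums of \<open>f'(X) \<Delta>B\<close> are orthogonal to the past and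
  bounded in \<open>L\<^sup>2\<close> (\<open>martingale_transform\<close>). Both properties survive almost sure limits
  (\<open>L2_bounded_AE_limit\<close>), since an \<open>L\<^sup>2\<close> bound forces uniform integrability. This takes the place
  of localisation, for which there would be no a priori integrability of the local time.

  The scale function has a kink at \<open>0\<close>. It is approximated by \<open>C\<^sup>2\<close> functions whose derivative passes
  from the left branch to the right branch along a smooth step, the derivative of which is a
  trapezoidal bump. The local time is given as a limit of normalised occupation times of intervals,
  and the trapezoid lies between two such indicators, so that the integral of the bump along the
  path converges to the local time (\<open>integral_trapezoid_tendsto_local_time\<close>) and cancels the skew
  term in the limit (\<open>smooth_ito_limit\<close>). As the approximating derivatives are uniformly bounded, the
  \<open>L\<^sup>2\<close> bounds are uniform, and the martingale property passes to \<open>s(X)\<close>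
  (\<open>scale_martingale_increment\<close>).

  Finite occupation of bounded sets comes from the same formula applied to a bounded smooth function
  with a critical point at \<open>0\<close>, so that no local time appears, and with a positive generator
  (\<open>AE_occupation_bounded\<close>). Almost sure convergence of \<open>s(X)\<close> follows from a maximal inequality on
  dyadic grids and the fact that \<open>E s(X\<^sub>t)\<^sup>2\<close> is bounded and increasing (\<open>AE_scale_converges\<close>).
\<close>

section \<open>Brownian increments and the augmented filtration\<close>

text \<open>
  Sort the times at which the past is observed and add \<open>0\<close>, \<open>s\<close> and \<open>t\<close>. Up to the null event
  \<open>B 0 \<noteq> 0\<close> the past values are partial sums of the increments over this partition, and the last
  increment is \<open>B t - B s\<close>; so independence of the past from the last increment is independence of two
  disjoint blocks of increments.
\<close>

lemma bm_increment_indep_marginals: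
  fixes A :: "real \<Rightarrow> real set"
  assumes bm: "standard_brownian_motion M B"
    and I: "finite I" "I \<subseteq> {0..s}" and st: "0 \<le> s" "s < t"
    and A: "\<And>u. A u \<in> sets borel" and D: "D \<in> sets borel"
  shows "measure M {\<omega> \<in> space M. (\<forall>u\<in>I. B u \<omega> \<in> A u) \<and> B t \<omega> - B s \<omega> \<in> D}
    = measure M {\<omega> \<in> space M. \<forall>u\<in>I. B u \<omega> \<in> A u} * measure M {\<omega> \<in> space M. B t \<omega> - B s \<omega> \<in> D}"
proof -
  interpret prob_space M using bm by (simp add: standard_brownian_motion_def)
  have meas [measurable]: "B u \<in> borel_measurable M" if "0 \<le> u" for u
    using bm that by (simp add: standard_brownian_motion_def continuous_process_def)
  have ms [measurable]: "B s \<in> borel_measurable M" "B t \<in> borel_measurable M"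
    using st by (auto intro!: meas)
  have mI: "B u \<in> borel_measurable M" if "u \<in> I" for u
    using that I by (intro meas) auto
  have B0: "AE \<omega> in M. B 0 \<omega> = 0" using bm by (simp add: standard_brownian_motion_def)
  define l where "l = sorted_list_of_set (insert 0 (insert s I))"
  have fin: "finite (insert 0 (insert s I))" using I(1) by simp
  have setl: "set l = insert 0 (insert s I)"
    unfolding l_def by (rule set_sorted_list_of_set[OF fin])
  have sl: "sorted l" unfolding l_def by (rule sorted_sorted_list_of_set)
  define \<tau> where "\<tau> i = (l @ [t]) ! i" for i
  define n where "n = length l"
  have npos: "n > 0" using setl by (cases l) (auto simp: n_def)
  have bounds: "0 \<le> x \<and> x \<le> s" if "x \<in> set l" for x using that I st setl by auto
  have slt: "sorted (l @ [t])" using sl bounds st by (fastforce simp: sorted_append)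
  have mono: "mono_on {..n} \<tau>"
  proof (rule mono_onI)
    fix i j assume "i \<in> {..n}" "j \<in> {..n}" "i \<le> j"
    then show "\<tau> i \<le> \<tau> j" unfolding \<tau>_def using slt by (intro sorted_nth_mono) (auto simp: n_def)
  qed
  have \<tau>n: "\<tau> n = t" by (simp add: \<tau>_def n_def)
  have \<tau>l: "\<tau> i \<in> set l" if "i < n" for i using that by (simp add: \<tau>_def n_def nth_append)
  have idx: "\<exists>i<n. \<tau> i = u" if "u \<in> set l" for u
    using that by (auto simp: in_set_conv_nth \<tau>_def n_def nth_append)
  have \<tau>0: "\<tau> 0 = 0"
  proof -
    obtain i where i: "i < n" "\<tau> i = 0" using idx[of 0] setl by auto
    have "\<tau> 0 \<le> \<tau> i" by (rule mono_onD[OF mono]) (use i in auto)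
    then show ?thesis using i bounds[OF \<tau>l[OF npos]] by simp
  qed
  have \<tau>s: "\<tau> (n - 1) = s"
  proof -
    obtain i where i: "i < n" "\<tau> i = s" using idx[of s] setl by auto
    have "\<tau> i \<le> \<tau> (n - 1)" by (rule mono_onD[OF mono]) (use i in auto)
    then show ?thesis using i bounds[OF \<tau>l[of "n - 1"]] npos by simp
  qed
  define \<xi> where "\<xi> i \<omega> = B (\<tau> (Suc i)) \<omega> - B (\<tau> i) \<omega>" for i \<omega>
  have ind: "indep_vars (\<lambda>_. borel) \<xi> {..<n}"
    using bm mono \<tau>0 unfolding standard_brownian_motion_def \<xi>_def by auto
  obtain k where k: "\<And>u. u \<in> set l \<Longrightarrow> k u < n \<and> \<tau> (k u) = u" using idx by metis
  \<comment> \<open>Telescoping turns the values of \<open>B\<close> into functions of the increments.\<close>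
  have tel: "(\<Sum>i<j. \<xi> i \<omega>) = B (\<tau> j) \<omega> - B 0 \<omega>" for j \<omega>
    unfolding \<xi>_def by (subst sum_lessThan_telescope) (simp add: \<tau>0)
  have iv: "indep_var (PiM {..<n-1} (\<lambda>_. borel)) (\<lambda>\<omega>. restrict (\<lambda>i. \<xi> i \<omega>) {..<n-1})
            (PiM {n-1} (\<lambda>_. borel)) (\<lambda>\<omega>. restrict (\<lambda>i. \<xi> i \<omega>) {n-1})"
    by (rule indep_var_restrict[OF ind]) (use npos in auto)
  define E where "E = {w \<in> space (PiM {..<n-1} (\<lambda>_. borel)). \<forall>u\<in>I. (\<Sum>i<k u. w i) \<in> A u}"
  define F where "F = {w \<in> space (PiM {n-1} (\<lambda>_. borel)). w (n-1) \<in> D}"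
  have comp: "(\<lambda>w. w i) \<in> borel_measurable (PiM {..<n-1} (\<lambda>_. borel :: real measure))"
    if "i < n - 1" for i using that by (intro measurable_component_singleton) auto
  have kI: "k u \<le> n - 1" if "u \<in> I" for u using k[of u] that setl by force
  have E: "E \<in> sets (PiM {..<n-1} (\<lambda>_. borel))" unfolding E_def
  proof (intro sets.sets_Collect_finite_All I(1))
    fix u assume u: "u \<in> I"
    have "(\<lambda>w. \<Sum>i<k u. w i) \<in> borel_measurable (PiM {..<n-1} (\<lambda>_. borel :: real measure))"
      by (intro borel_measurable_sum comp) (use kI[OF u] in auto)
    then show "{w \<in> space (PiM {..<n-1} (\<lambda>_. borel)). (\<Sum>i<k u. w i) \<in> A u} \<in> sets (PiM {..<n-1} (\<lambda>_. borel))"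
      using A[of u] by measurable
  qed
  have F: "F \<in> sets (PiM {n-1} (\<lambda>_. borel))" unfolding F_def
    using D by measurable
  have Eiff: "(\<lambda>i\<in>{..<n-1}. \<xi> i \<omega>) \<in> E \<longleftrightarrow> (\<forall>u\<in>I. B u \<omega> - B 0 \<omega> \<in> A u)" for \<omega>
  proof -
    have "(\<Sum>i<k u. (\<lambda>i\<in>{..<n-1}. \<xi> i \<omega>) i) = B u \<omega> - B 0 \<omega>" if "u \<in> I" for u
    proof -
      have "(\<Sum>i<k u. (\<lambda>i\<in>{..<n-1}. \<xi> i \<omega>) i) = (\<Sum>i<k u. \<xi> i \<omega>)"
        using kI[OF that] by (intro sum.cong) auto
      then show ?thesis using tel k[of u] that setl by simp
    qed
    then show ?thesis unfolding E_def by (simp add: space_PiM)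
  qed
  have Fiff: "(\<lambda>i\<in>{n-1}. \<xi> i \<omega>) \<in> F \<longleftrightarrow> B t \<omega> - B s \<omega> \<in> D" for \<omega>
    unfolding F_def using npos \<tau>n \<tau>s by (simp add: space_PiM \<xi>_def)
  have m1: "{\<omega> \<in> space M. \<forall>u\<in>I. B u \<omega> - B 0 \<omega> \<in> A u} \<in> events"
    and m2: "{\<omega> \<in> space M. \<forall>u\<in>I. B u \<omega> \<in> A u} \<in> events"
    and mD: "{\<omega> \<in> space M. B t \<omega> - B s \<omega> \<in> D} \<in> events"
  proof -
    show "{\<omega> \<in> space M. \<forall>u\<in>I. B u \<omega> - B 0 \<omega> \<in> A u} \<in> events"
    proof (rule sets.sets_Collect_finite_All[OF _ I(1)])
      fix u assume "u \<in> I"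
      have [measurable]: "B u \<in> borel_measurable M" "B 0 \<in> borel_measurable M" "A u \<in> sets borel"
        using mI[OF \<open>u \<in> I\<close>] meas[of 0] A by auto
      show "{\<omega> \<in> space M. B u \<omega> - B 0 \<omega> \<in> A u} \<in> events" by measurable
    qed
    show "{\<omega> \<in> space M. \<forall>u\<in>I. B u \<omega> \<in> A u} \<in> events"
    proof (rule sets.sets_Collect_finite_All[OF _ I(1)])
      fix u assume "u \<in> I"
      have [measurable]: "B u \<in> borel_measurable M" "A u \<in> sets borel"
        using mI[OF \<open>u \<in> I\<close>] A by auto
      show "{\<omega> \<in> space M. B u \<omega> \<in> A u} \<in> events" by measurable
    qed
    show "{\<omega> \<in> space M. B t \<omega> - B s \<omega> \<in> D} \<in> events" using D by measurable
  qed
  have "prob {\<omega> \<in> space M. (\<forall>u\<in>I. B u \<omega> - B 0 \<omega> \<in> A u) \<and> B t \<omega> - B s \<omega> \<in> D}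
    = prob {\<omega> \<in> space M. \<forall>u\<in>I. B u \<omega> - B 0 \<omega> \<in> A u} * prob {\<omega> \<in> space M. B t \<omega> - B s \<omega> \<in> D}"
  proof -
    let ?U = "\<lambda>\<omega>. \<lambda>i\<in>{..<n-1}. \<xi> i \<omega>" and ?V = "\<lambda>\<omega>. \<lambda>i\<in>{n-1}. \<xi> i \<omega>"
    have "(\<lambda>\<omega>. (?U \<omega>, ?V \<omega>)) -` (E \<times> F) \<inter> space M
      = {\<omega> \<in> space M. (\<forall>u\<in>I. B u \<omega> - B 0 \<omega> \<in> A u) \<and> B t \<omega> - B s \<omega> \<in> D}"
      unfolding vimage_def mem_Times_iff fst_conv snd_conv Eiff Fiff by blast
    moreover have "?U -` E \<inter> space M = {\<omega> \<in> space M. \<forall>u\<in>I. B u \<omega> - B 0 \<omega> \<in> A u}"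
      unfolding vimage_def Eiff by blast
    moreover have "?V -` F \<inter> space M = {\<omega> \<in> space M. B t \<omega> - B s \<omega> \<in> D}"
      unfolding vimage_def Fiff by blast
    ultimately show ?thesis using indep_varD[OF iv E F] by (simp only:)
  qed
  moreover have "prob {\<omega> \<in> space M. (\<forall>u\<in>I. B u \<omega> - B 0 \<omega> \<in> A u) \<and> B t \<omega> - B s \<omega> \<in> D}
     = prob {\<omega> \<in> space M. (\<forall>u\<in>I. B u \<omega> \<in> A u) \<and> B t \<omega> - B s \<omega> \<in> D}"
    by (rule prob_eq_AE[OF _ sets.sets_Collect_conj[OF mD m1] sets.sets_Collect_conj[OF mD m2]])
       (use B0 in eventually_elim, simp)
  moreover have "prob {\<omega> \<in> space M. \<forall>u\<in>I. B u \<omega> - B 0 \<omega> \<in> A u} = prob {\<omega> \<in> space M. \<forall>u\<in>I. B u \<omega> \<in> A u}"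
    by (rule prob_eq_AE[OF _ m1 m2]) (use B0 in eventually_elim, simp)
  ultimately show ?thesis by simp
qed

lemma space_augmented_filtration [simp]: "space (augmented_filtration M B t) = space M"
  unfolding augmented_filtration_def
  by (rule space_measure_of) (auto dest: sets.sets_into_space)

lemma sets_augmented_filtration:
  "sets (augmented_filtration M B t) = sigma_sets (space M)
     ({B u -` A \<inter> space M | u A. 0 \<le> u \<and> u \<le> t \<and> A \<in> sets borel} \<union> null_sets M)"
  unfolding augmented_filtration_def
  by (rule sets_measure_of) (auto dest: sets.sets_into_space)

lemma sets_augmented_filtration_mono:
  assumes "s \<le> t"
  shows "sets (augmented_filtration M B s) \<subseteq> sets (augmented_filtration M B t)"
  unfolding sets_augmented_filtration
proof (rule sigma_sets_mono', safe)
  fix u :: real and A :: "real set" assume "0 \<le> u" "u \<le> s" "A \<in> sets (borel :: real measure)" "B u -` A \<inter> space M \<notin> null_sets M"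
  then show "\<exists>u' A'. B u -` A \<inter> space M = B u' -` A' \<inter> space M \<and> 0 \<le> u' \<and> u' \<le> t \<and> A' \<in> sets borel"
    using assms by (intro exI[of _ u] exI[of _ A]) auto
qed

lemma measurable_augmented_filtration_mono:
  assumes "f \<in> borel_measurable (augmented_filtration M B s)" "s \<le> t"
  shows "f \<in> borel_measurable (augmented_filtration M B t)"
  using assms sets_augmented_filtration_mono[of s t M B] by (auto simp: measurable_def)

lemma bm_measurable_augmented_filtration:
  assumes "0 \<le> u" "u \<le> t"
  shows "B u \<in> borel_measurable (augmented_filtration M B t)"
proof (rule measurableI)
  fix A :: "real set" assume "A \<in> sets borel"
  then show "B u -` A \<inter> space (augmented_filtration M B t) \<in> sets (augmented_filtration M B t)"
    unfolding sets_augmented_filtration using assms by (auto intro!: sigma_sets.Basic)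
qed simp

lemma sets_augmented_filtration_subset:
  assumes "standard_brownian_motion M B"
  shows "sets (augmented_filtration M B t) \<subseteq> sets M"
  unfolding sets_augmented_filtration
proof (rule sets.sigma_sets_subset, safe)
  fix u :: real and A :: "real set" assume "0 \<le> u" and [measurable]: "A \<in> sets borel"
  then have [measurable]: "B u \<in> borel_measurable M"
    using assms by (simp add: standard_brownian_motion_def continuous_process_def)
  show "B u -` A \<inter> space M \<in> sets M" by measurable
qed (rule null_setsD2)

lemma measurable_augmented_filtration_imp:
  assumes "standard_brownian_motion M B" "f \<in> borel_measurable (augmented_filtration M B s)"
  shows "f \<in> borel_measurable M"
  using assms(2) sets_augmented_filtration_subset[OF assms(1), of s] by (auto simp: measurable_def)

text \<open>
  The generators of the augmented filtration are not closed under intersection. The sets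
  \<open>C \<inter> K\<close>, with \<open>C\<close> a finite-dimensional cylinder and \<open>K\<close> either the whole space or a null set, are,
  and they contain all generators; null sets satisfy the product formula trivially.
\<close>

lemma bm_increment_indep:
  assumes bm: "standard_brownian_motion M B" and st: "0 \<le> s" "s < t"
    and Z: "Z \<in> borel_measurable (augmented_filtration M B s)"
  shows "prob_space.indep_var M borel Z borel (\<lambda>\<omega>. B t \<omega> - B s \<omega>)"
proof -
  interpret prob_space M using bm by (simp add: standard_brownian_motion_def)
  let ?F = "augmented_filtration M B s"
  have [measurable]: "B u \<in> borel_measurable M" if "0 \<le> u" for u
    using bm that by (simp add: standard_brownian_motion_def continuous_process_def)
  have [measurable]: "B s \<in> borel_measurable M" "B t \<in> borel_measurable M"
    using st by auto
  define cyl where "cyl I A = {\<omega> \<in> space M. \<forall>u\<in>I. B u \<omega> \<in> A u}" for I :: "real set" and A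
  define P where "P I A \<longleftrightarrow> finite I \<and> I \<subseteq> {0..s} \<and> (\<forall>u. A u \<in> sets borel)" for I and A :: "real \<Rightarrow> real set"
  define G where "G = {cyl I A \<inter> K | I A K. P I A \<and> (K = space M \<or> K \<in> null_sets M)}"
  define H where "H = {(\<lambda>\<omega>. B t \<omega> - B s \<omega>) -` D \<inter> space M | D. D \<in> sets borel}"
  have cylM: "cyl I A \<in> events" if "P I A" for I A
    unfolding cyl_def
  proof (rule sets.sets_Collect_finite_All)
    fix u assume "u \<in> I"
    then have [measurable]: "B u \<in> borel_measurable M" "A u \<in> sets borel" using that by (auto simp: P_def)
    show "{\<omega> \<in> space M. B u \<omega> \<in> A u} \<in> events" by measurable
  qed (use that P_def in auto)
  have GM: "G \<subseteq> events" unfolding G_def using cylM by auto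
  have HM: "H \<subseteq> events" unfolding H_def by auto
  have indep: "indep_set G H"
  proof (rule indep_setI[OF GM HM])
    fix a b assume "a \<in> G" "b \<in> H"
    then obtain I A K D where a: "a = cyl I A \<inter> K" and P: "P I A" and K: "K = space M \<or> K \<in> null_sets M"
      and b: "b = (\<lambda>\<omega>. B t \<omega> - B s \<omega>) -` D \<inter> space M" and D[measurable]: "D \<in> sets borel"
      unfolding G_def H_def by auto
    show "prob (a \<inter> b) = prob a * prob b"
      using K
    proof
      assume "K = space M"
      then have "a \<inter> b = {\<omega> \<in> space M. (\<forall>u\<in>I. B u \<omega> \<in> A u) \<and> B t \<omega> - B s \<omega> \<in> D}"
        "a = {\<omega> \<in> space M. \<forall>u\<in>I. B u \<omega> \<in> A u}" "b = {\<omega> \<in> space M. B t \<omega> - B s \<omega> \<in> D}"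
        by (auto simp: a b cyl_def)
      then show ?thesis
        using bm_increment_indep_marginals[OF bm _ _ st, of I A D] P D by (simp add: P_def)
    next
      assume "K \<in> null_sets M"
      then have "a \<in> null_sets M" unfolding a using cylM[OF P] by (simp add: null_set_Int1)
      moreover from this have "a \<inter> b \<in> null_sets M"
        unfolding b by (rule null_set_Int2) measurable
      ultimately show ?thesis by (simp add: null_sets_def measure_def)
    qed
  qed
  have stG: "Int_stable G"
  proof (rule Int_stableI)
    fix a b assume "a \<in> G" "b \<in> G"
    then obtain I A K J A' K' where a: "a = cyl I A \<inter> K" "P I A" "K = space M \<or> K \<in> null_sets M"
      and b: "b = cyl J A' \<inter> K'" "P J A'" "K' = space M \<or> K' \<in> null_sets M"
      unfolding G_def by blast
    define A2 where "A2 u = (if u \<in> I then A u else UNIV) \<inter> (if u \<in> J then A' u else UNIV)" for u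
    have "a \<inter> b = cyl (I \<union> J) A2 \<inter> (K \<inter> K')"
      unfolding a(1) b(1) cyl_def A2_def by auto
    moreover have "P (I \<union> J) A2" using a(2) b(2) unfolding P_def A2_def by auto
    moreover have "K \<inter> K' = space M \<or> K \<inter> K' \<in> null_sets M"
      using a(3) b(3) by (auto intro: null_set_Int1 null_set_Int2 dest: null_setsD2)
    ultimately show "a \<inter> b \<in> G" unfolding G_def by blast
  qed
  have stH: "Int_stable H"
  proof (rule Int_stableI)
    fix a b assume "a \<in> H" "b \<in> H"
    then obtain D E where "a = (\<lambda>\<omega>. B t \<omega> - B s \<omega>) -` D \<inter> space M" "D \<in> sets borel"
      "b = (\<lambda>\<omega>. B t \<omega> - B s \<omega>) -` E \<inter> space M" "E \<in> sets borel" unfolding H_def by auto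
    then have "a \<inter> b = (\<lambda>\<omega>. B t \<omega> - B s \<omega>) -` (D \<inter> E) \<inter> space M" "D \<inter> E \<in> sets borel" by auto
    then show "a \<inter> b \<in> H" unfolding H_def by blast
  qed
  have ind: "indep_set (sigma_sets (space M) G) (sigma_sets (space M) H)"
    by (rule indep_set_sigma_sets[OF indep stG stH])
  have FG: "sets ?F \<subseteq> sigma_sets (space M) G"
    unfolding sets_augmented_filtration
  proof (rule sigma_sets_mono, safe)
    fix u :: real and A :: "real set" assume u: "0 \<le> u" "u \<le> s" "A \<in> sets (borel :: real measure)"
    have "B u -` A \<inter> space M = cyl {u} (\<lambda>_. A) \<inter> space M" by (auto simp: cyl_def)
    moreover have "P {u} (\<lambda>_. A)" using u by (auto simp: P_def)
    ultimately have "B u -` A \<inter> space M \<in> G" unfolding G_def by blast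
    then show "B u -` A \<inter> space M \<in> sigma_sets (space M) G" by (rule sigma_sets.Basic)
  next
    fix N assume N: "N \<in> null_sets M"
    then have "N = cyl {} (\<lambda>_. UNIV) \<inter> N" using sets.sets_into_space[of N M] by (auto simp: cyl_def)
    moreover have "P {} (\<lambda>_. UNIV)" by (auto simp: P_def)
    ultimately have "N \<in> G" unfolding G_def using N by blast
    then show "N \<in> sigma_sets (space M) G" by (rule sigma_sets.Basic)
  qed
  have ZF: "sigma_sets (space M) {Z -` A \<inter> space M | A. A \<in> sets borel} \<subseteq> sigma_sets (space M) G"
  proof (rule order_trans[OF _ FG])
    show "sigma_sets (space M) {Z -` A \<inter> space M | A. A \<in> sets borel} \<subseteq> sets ?F"
      using sets.sigma_sets_subset[of "{Z -` A \<inter> space M | A. A \<in> sets borel}" ?F]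
        measurable_sets[OF Z] by auto
  qed
  have "indep_set (sigma_sets (space M) {Z -` A \<inter> space M | A. A \<in> sets borel}) (sigma_sets (space M) H)"
    using ind unfolding indep_set_def
    by (rule indep_sets_mono_sets) (use ZF in \<open>auto split: bool.splits\<close>)
  moreover have "Z \<in> borel_measurable M" by (rule measurable_augmented_filtration_imp[OF bm Z])
  ultimately show ?thesis unfolding indep_var_eq H_def by simp
qed

section \<open>Square-integrable martingale sums\<close>

lemma measurable_subalgebra:
  assumes "f \<in> borel_measurable F" "space F = space M" "sets F \<subseteq> sets M"
  shows "f \<in> borel_measurable M"
  using assms by (auto simp: measurable_def)

lemma sets_mono_Suc:
  assumes "\<And>i::nat. sets (F i) \<subseteq> sets (F (Suc i))" "i \<le> j"
  shows "sets (F i) \<subseteq> sets (F j)"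
  using lift_Suc_mono_le[of "\<lambda>i. sets (F i)", OF assms] .

text \<open>
  The sums are discrete stochastic integrals of the bounded adapted \<open>Z\<close> against centred innovations
  \<open>\<xi>\<close>. A factor that is measurable with respect to \<open>F i\<close> can be pulled out of the expectation with
  \<open>\<xi> i\<close> by independence, so all cross terms of the square vanish and so does the pairing with anything
  known at time \<open>0\<close>.
\<close>

lemma (in prob_space) martingale_transform:
  fixes F :: "nat \<Rightarrow> 'a measure" and Z \<xi> :: "nat \<Rightarrow> 'a \<Rightarrow> real"
  assumes sp: "\<And>i. space (F i) = space M" and sub: "\<And>i. sets (F i) \<subseteq> sets M"
    and inc: "\<And>i. sets (F i) \<subseteq> sets (F (Suc i))"
    and \<xi>m: "\<And>i. \<xi> i \<in> borel_measurable (F (Suc i))"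
    and ind: "\<And>i Y. Y \<in> borel_measurable (F i) \<Longrightarrow> indep_var borel Y borel (\<xi> i)"
    and sq: "\<And>i. integrable M (\<lambda>\<omega>. (\<xi> i \<omega>)\<^sup>2)"
    and mean: "\<And>i. expectation (\<xi> i) = 0"
    and var: "\<And>i. expectation (\<lambda>\<omega>. (\<xi> i \<omega>)\<^sup>2) \<le> v"
    and Zm: "\<And>i. Z i \<in> borel_measurable (F i)" and Zb: "\<And>i \<omega>. \<bar>Z i \<omega>\<bar> \<le> C"
  shows "(\<lambda>\<omega>. \<Sum>i<n. Z i \<omega> * \<xi> i \<omega>) \<in> borel_measurable (F n)" (is ?meas)
    and "integrable M (\<lambda>\<omega>. (\<Sum>i<n. Z i \<omega> * \<xi> i \<omega>)\<^sup>2)" (is ?int)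
    and "expectation (\<lambda>\<omega>. (\<Sum>i<n. Z i \<omega> * \<xi> i \<omega>)\<^sup>2) \<le> real n * (C\<^sup>2 * v)" (is ?bd)
    and "\<And>W c. W \<in> borel_measurable (F 0) \<Longrightarrow> (\<And>\<omega>. \<bar>W \<omega>\<bar> \<le> c)
           \<Longrightarrow> expectation (\<lambda>\<omega>. W \<omega> * (\<Sum>i<n. Z i \<omega> * \<xi> i \<omega>)) = 0"
proof -
  have toM: "f \<in> borel_measurable M" if "f \<in> borel_measurable (F i)" for f :: "'a \<Rightarrow> real" and i
    by (rule measurable_subalgebra[OF that sp sub])
  have up: "f \<in> borel_measurable (F j)" if "f \<in> borel_measurable (F i)" "i \<le> j" for f :: "'a \<Rightarrow> real" and i j
    by (rule measurable_subalgebra[OF that(1)]) (use sp sets_mono_Suc[of F, OF inc that(2)] in auto)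
  have \<xi>M [measurable]: "\<xi> i \<in> borel_measurable M" for i by (rule toM[OF \<xi>m])
  have ZM [measurable]: "Z i \<in> borel_measurable M" for i by (rule toM[OF Zm])
  have \<xi>int: "integrable M (\<xi> i)" for i
    by (rule square_integrable_imp_integrable[OF \<xi>M sq])
  have orth: "integrable M (\<lambda>\<omega>. Y \<omega> * \<xi> i \<omega>) \<and> expectation (\<lambda>\<omega>. Y \<omega> * \<xi> i \<omega>) = 0"
    if "Y \<in> borel_measurable (F i)" "integrable M Y" for Y i
    using indep_var_integrable[OF ind[OF that(1)] that(2) \<xi>int]
      indep_var_lebesgue_integral[OF ind[OF that(1)] that(2) \<xi>int] mean by simp
  have C0: "0 \<le> C" using Zb[of 0 undefined] by (rule order_trans[OF abs_ge_zero])
  have all: "?meas \<and> ?int \<and> ?bd"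
  proof (induction n)
    case 0
    then show ?case by simp
  next
    case (Suc n)
    let ?S = "\<lambda>\<omega>. \<Sum>i<n. Z i \<omega> * \<xi> i \<omega>"
    have Sm: "?S \<in> borel_measurable (F n)" and Si: "integrable M (\<lambda>\<omega>. (?S \<omega>)\<^sup>2)" using Suc by auto
    have SM: "?S \<in> borel_measurable M" by (rule toM[OF Sm])
    have Sint: "integrable M ?S" by (rule square_integrable_imp_integrable[OF SM Si])
    have SZm: "(\<lambda>\<omega>. ?S \<omega> * Z n \<omega>) \<in> borel_measurable (F n)" using Sm Zm by simp
    have SZi: "integrable M (\<lambda>\<omega>. ?S \<omega> * Z n \<omega>)"
    proof (rule Bochner_Integration.integrable_bound[of M "\<lambda>\<omega>. C * \<bar>?S \<omega>\<bar>"])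
      show "integrable M (\<lambda>\<omega>. C * \<bar>?S \<omega>\<bar>)" using Sint by simp
      show "AE \<omega> in M. norm (?S \<omega> * Z n \<omega>) \<le> norm (C * \<bar>?S \<omega>\<bar>)"
        using Zb C0 by (intro AE_I2) (simp add: abs_mult mult.commute mult_right_mono)
    qed (rule toM[OF SZm])
    have Z2: "(Z n \<omega>)\<^sup>2 \<le> C\<^sup>2" for \<omega>
      using Zb[of n \<omega>] by (metis abs_ge_zero power2_abs power_mono)
    have ZXi: "integrable M (\<lambda>\<omega>. (Z n \<omega>)\<^sup>2 * (\<xi> n \<omega>)\<^sup>2)"
    proof (rule Bochner_Integration.integrable_bound[of M "\<lambda>\<omega>. C\<^sup>2 * (\<xi> n \<omega>)\<^sup>2"])
      show "AE \<omega> in M. norm ((Z n \<omega>)\<^sup>2 * (\<xi> n \<omega>)\<^sup>2) \<le> norm (C\<^sup>2 * (\<xi> n \<omega>)\<^sup>2)"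
        using Z2 by (intro AE_I2) (simp add: mult_right_mono)
    qed (use sq in auto)
    have ZXb: "expectation (\<lambda>\<omega>. (Z n \<omega>)\<^sup>2 * (\<xi> n \<omega>)\<^sup>2) \<le> C\<^sup>2 * v"
    proof -
      have "expectation (\<lambda>\<omega>. (Z n \<omega>)\<^sup>2 * (\<xi> n \<omega>)\<^sup>2) \<le> expectation (\<lambda>\<omega>. C\<^sup>2 * (\<xi> n \<omega>)\<^sup>2)"
        by (rule integral_mono[OF ZXi]) (use sq Z2 in \<open>auto simp: mult_right_mono\<close>)
      also have "\<dots> \<le> C\<^sup>2 * v" using var[of n] by (simp add: mult_left_mono)
      finally show ?thesis .
    qed
    note o = orth[OF SZm SZi]
    have eq: "(\<Sum>i<Suc n. Z i \<omega> * \<xi> i \<omega>)\<^sup>2 =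
      (?S \<omega>)\<^sup>2 + (2 * (?S \<omega> * Z n \<omega> * \<xi> n \<omega>) + (Z n \<omega>)\<^sup>2 * (\<xi> n \<omega>)\<^sup>2)" for \<omega>
      by (simp add: power2_eq_square algebra_simps)
    have "(\<lambda>\<omega>. Z n \<omega> * \<xi> n \<omega>) \<in> borel_measurable (F (Suc n))"
      using up[OF Zm, of n "Suc n"] \<xi>m by simp
    then have 1: "(\<lambda>\<omega>. \<Sum>i<Suc n. Z i \<omega> * \<xi> i \<omega>) \<in> borel_measurable (F (Suc n))"
      using up[OF Sm, of "Suc n"] by simp
    have 2: "integrable M (\<lambda>\<omega>. (\<Sum>i<Suc n. Z i \<omega> * \<xi> i \<omega>)\<^sup>2)"
      unfolding eq using Si o ZXi by (intro Bochner_Integration.integrable_add integrable_mult_right) auto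
    have "expectation (\<lambda>\<omega>. (\<Sum>i<Suc n. Z i \<omega> * \<xi> i \<omega>)\<^sup>2) =
      expectation (\<lambda>\<omega>. (?S \<omega>)\<^sup>2) + (2 * expectation (\<lambda>\<omega>. ?S \<omega> * Z n \<omega> * \<xi> n \<omega>)
        + expectation (\<lambda>\<omega>. (Z n \<omega>)\<^sup>2 * (\<xi> n \<omega>)\<^sup>2))"
      unfolding eq using Si o ZXi by (simp del: sum.lessThan_Suc)
    also have "\<dots> \<le> real n * (C\<^sup>2 * v) + (2 * 0 + C\<^sup>2 * v)"
      using o ZXb Suc by auto
    also have "\<dots> = real (Suc n) * (C\<^sup>2 * v)" by (simp add: algebra_simps)
    finally show ?case using 1 2 by blast
  qed
  then show ?meas ?int ?bd by auto
  fix W :: "'a \<Rightarrow> real" and c assume W: "W \<in> borel_measurable (F 0)" and Wb: "\<And>\<omega>. \<bar>W \<omega>\<bar> \<le> c"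
  have "integrable M (\<lambda>\<omega>. W \<omega> * Z i \<omega> * \<xi> i \<omega>) \<and> expectation (\<lambda>\<omega>. W \<omega> * Z i \<omega> * \<xi> i \<omega>) = 0" for i
  proof (rule orth)
    show *: "(\<lambda>\<omega>. W \<omega> * Z i \<omega>) \<in> borel_measurable (F i)" using up[OF W, of i] Zm by simp
    show "integrable M (\<lambda>\<omega>. W \<omega> * Z i \<omega>)"
      by (rule integrable_const_bound[of _ "c * C"])
         (use Wb Zb toM[OF *] in \<open>auto simp: abs_mult intro!: mult_mono order_trans[OF abs_ge_zero]\<close>)
  qed
  then have "expectation (\<lambda>\<omega>. \<Sum>i<n. W \<omega> * Z i \<omega> * \<xi> i \<omega>) = 0"
    by (subst Bochner_Integration.integral_sum) auto
  then show "expectation (\<lambda>\<omega>. W \<omega> * (\<Sum>i<n. Z i \<omega> * \<xi> i \<omega>)) = 0"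
    by (simp add: sum_distrib_left mult.assoc)
qed

text \<open>
  The \<open>L\<^sup>2\<close> bound passes to the limit by Fatou. Orthogonality is not preserved by almost sure
  convergence alone: truncating at level \<open>K\<close> costs at most \<open>c C / K\<close>, uniformly in the sequence, by
  \<open>\<bar>y - T K y\<bar> \<le> y\<^sup>2 / K\<close>, and the truncated variables converge by dominated convergence.
\<close>

lemma (in prob_space) L2_bounded_AE_limit:
  fixes Y :: "nat \<Rightarrow> 'a \<Rightarrow> real"
  assumes Ym: "\<And>n. Y n \<in> borel_measurable M" and Lm: "L \<in> borel_measurable M"
    and lim: "AE \<omega> in M. (\<lambda>n. Y n \<omega>) \<longlonglongrightarrow> L \<omega>"
    and sq: "\<And>n. integrable M (\<lambda>\<omega>. (Y n \<omega>)\<^sup>2)"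
    and bd: "\<And>n. expectation (\<lambda>\<omega>. (Y n \<omega>)\<^sup>2) \<le> C"
  shows "integrable M (\<lambda>\<omega>. (L \<omega>)\<^sup>2)" and "expectation (\<lambda>\<omega>. (L \<omega>)\<^sup>2) \<le> C"
    and "\<And>W c. W \<in> borel_measurable M \<Longrightarrow> (\<And>\<omega>. \<bar>W \<omega>\<bar> \<le> c) \<Longrightarrow>
      (\<And>n. expectation (\<lambda>\<omega>. W \<omega> * Y n \<omega>) = 0) \<Longrightarrow> expectation (\<lambda>\<omega>. W \<omega> * L \<omega>) = 0"
proof -
  note [measurable] = Ym Lm
  have C0: "0 \<le> C" using bd[of 0] by (rule order_trans[rotated]) simp
  have "(\<integral>\<^sup>+\<omega>. ennreal ((L \<omega>)\<^sup>2) \<partial>M) = (\<integral>\<^sup>+\<omega>. liminf (\<lambda>n. ennreal ((Y n \<omega>)\<^sup>2)) \<partial>M)"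
  proof (rule nn_integral_cong_AE, use lim in eventually_elim)
    fix \<omega> assume "(\<lambda>n. Y n \<omega>) \<longlonglongrightarrow> L \<omega>"
    then have "(\<lambda>n. ennreal ((Y n \<omega>)\<^sup>2)) \<longlonglongrightarrow> ennreal ((L \<omega>)\<^sup>2)"
      by (intro tendsto_ennrealI tendsto_power)
    from lim_imp_Liminf[OF sequentially_bot this]
    show "ennreal ((L \<omega>)\<^sup>2) = liminf (\<lambda>n. ennreal ((Y n \<omega>)\<^sup>2))" by simp
  qed
  also have "\<dots> \<le> liminf (\<lambda>n. \<integral>\<^sup>+\<omega>. ennreal ((Y n \<omega>)\<^sup>2) \<partial>M)"
    by (rule nn_integral_liminf) measurable
  also have "\<dots> = liminf (\<lambda>n. ennreal (expectation (\<lambda>\<omega>. (Y n \<omega>)\<^sup>2)))"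
    by (subst nn_integral_eq_integral[OF sq]) auto
  also have "\<dots> \<le> liminf (\<lambda>n. ennreal C)"
    by (rule Liminf_mono, rule always_eventually) (use bd ennreal_leI in blast)
  also have "\<dots> = ennreal C" by (simp add: Liminf_const)
  finally have nn: "(\<integral>\<^sup>+\<omega>. ennreal ((L \<omega>)\<^sup>2) \<partial>M) \<le> ennreal C" .
  show L2: "integrable M (\<lambda>\<omega>. (L \<omega>)\<^sup>2)"
    by (rule integrableI_nonneg) (use nn in \<open>auto simp: less_top[symmetric] top_unique\<close>)
  show LC: "expectation (\<lambda>\<omega>. (L \<omega>)\<^sup>2) \<le> C"
    using nn C0 by (subst (asm) nn_integral_eq_integral[OF L2]) auto
  have Li: "integrable M L" by (rule square_integrable_imp_integrable[OF Lm L2])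
  have Yi: "integrable M (Y n)" for n by (rule square_integrable_imp_integrable[OF Ym sq])
  fix W :: "'a \<Rightarrow> real" and c assume W[measurable]: "W \<in> borel_measurable M" and Wb: "\<And>\<omega>. \<bar>W \<omega>\<bar> \<le> c"
    and zero: "\<And>n. expectation (\<lambda>\<omega>. W \<omega> * Y n \<omega>) = 0"
  have c0: "0 \<le> c" using Wb[of undefined] by (rule order_trans[OF abs_ge_zero])
  define T where "T K y = max (-K) (min K y)" for K y :: real
  have Tb: "\<bar>T K y\<bar> \<le> K" if "0 < K" for K y using that by (auto simp: T_def)
  have Tm [measurable]: "T K \<in> borel_measurable borel" for K unfolding T_def by measurable
  have Td: "\<bar>y - T K y\<bar> \<le> y\<^sup>2 / K" if K: "0 < K" for K y
  proof (cases "\<bar>y\<bar> \<le> K")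
    case True then show ?thesis using K by (auto simp: T_def)
  next
    case False
    then have "\<bar>y - T K y\<bar> \<le> \<bar>y\<bar>" using K by (auto simp: T_def)
    also have "\<dots> \<le> \<bar>y\<bar> * (\<bar>y\<bar> / K)"
      using mult_left_mono[of 1 "\<bar>y\<bar> / K" "\<bar>y\<bar>"] False K by simp
    also have "\<dots> = y\<^sup>2 / K" by (simp add: power2_eq_square abs_mult_self_eq flip: abs_mult)
    finally show ?thesis .
  qed
  have WT: "integrable M (\<lambda>\<omega>. W \<omega> * T K (V \<omega>))" if "0 < K" "V \<in> borel_measurable M" for K V
    by (rule integrable_const_bound[of _ "c * K"])
       (use Wb Tb that c0 in \<open>auto simp: abs_mult intro!: mult_mono\<close>)
  have WV: "integrable M (\<lambda>\<omega>. W \<omega> * V \<omega>)" if V: "integrable M V" for V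
    by (rule Bochner_Integration.integrable_bound[of M "\<lambda>\<omega>. c * \<bar>V \<omega>\<bar>"])
       (use V Wb c0 in \<open>auto simp: abs_mult intro!: mult_right_mono\<close>)
  have trunc: "\<bar>expectation (\<lambda>\<omega>. W \<omega> * V \<omega>) - expectation (\<lambda>\<omega>. W \<omega> * T K (V \<omega>))\<bar> \<le> c * C / K"
    if K: "0 < K" and V: "integrable M V" "integrable M (\<lambda>\<omega>. (V \<omega>)\<^sup>2)" "expectation (\<lambda>\<omega>. (V \<omega>)\<^sup>2) \<le> C" for K V
  proof -
    have Vm: "V \<in> borel_measurable M" using V(1) by auto
    have "expectation (\<lambda>\<omega>. W \<omega> * V \<omega>) - expectation (\<lambda>\<omega>. W \<omega> * T K (V \<omega>))
      = expectation (\<lambda>\<omega>. W \<omega> * (V \<omega> - T K (V \<omega>)))"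
      using WV[OF V(1)] WT[OF K Vm] by (simp add: right_diff_distrib)
    also have "\<bar>\<dots>\<bar> \<le> expectation (\<lambda>\<omega>. c / K * (V \<omega>)\<^sup>2)"
    proof (rule order_trans[OF integral_abs_bound integral_mono])
      show "integrable M (\<lambda>\<omega>. \<bar>W \<omega> * (V \<omega> - T K (V \<omega>))\<bar>)"
        using WV[OF V(1)] WT[OF K Vm] by (simp add: right_diff_distrib)
      show "integrable M (\<lambda>\<omega>. c / K * (V \<omega>)\<^sup>2)" using V(2) by simp
      show "\<bar>W \<omega> * (V \<omega> - T K (V \<omega>))\<bar> \<le> c / K * (V \<omega>)\<^sup>2" for \<omega>
        using mult_mono[OF Wb[of \<omega>] Td[OF K, of "V \<omega>"] c0] by (simp add: abs_mult)
    qed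
    also have "\<dots> = c / K * expectation (\<lambda>\<omega>. (V \<omega>)\<^sup>2)" by simp
    also have "\<dots> \<le> c / K * C" using V(3) c0 K by (intro mult_left_mono) auto
    finally show ?thesis by simp
  qed
  have "\<bar>expectation (\<lambda>\<omega>. W \<omega> * L \<omega>)\<bar> \<le> 2 * (c * C) / K" if K: "0 < K" for K
  proof -
    have "(\<lambda>n. expectation (\<lambda>\<omega>. W \<omega> * T K (Y n \<omega>))) \<longlonglongrightarrow> expectation (\<lambda>\<omega>. W \<omega> * T K (L \<omega>))"
    proof (rule integral_dominated_convergence[where w="\<lambda>_. c * K"])
      show "AE \<omega> in M. (\<lambda>n. W \<omega> * T K (Y n \<omega>)) \<longlonglongrightarrow> W \<omega> * T K (L \<omega>)"
        using lim by eventually_elim (auto simp: T_def intro!: tendsto_intros)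
      show "AE \<omega> in M. norm (W \<omega> * T K (Y n \<omega>)) \<le> c * K" for n
        using Wb Tb[OF K] c0 by (intro AE_I2) (auto simp: abs_mult intro!: mult_mono)
    qed auto
    moreover have "\<bar>expectation (\<lambda>\<omega>. W \<omega> * T K (Y n \<omega>))\<bar> \<le> c * C / K" for n
      using trunc[OF K Yi sq bd, of n] zero[of n] by simp
    ultimately have "\<bar>expectation (\<lambda>\<omega>. W \<omega> * T K (L \<omega>))\<bar> \<le> c * C / K"
      by (intro LIMSEQ_le_const2[OF tendsto_rabs]) auto
    then show ?thesis using trunc[OF K Li L2 LC] by (simp add: abs_le_iff) argo
  qed
  note b = this
  have "(\<lambda>n. 2 * (c * C) / real (Suc n)) \<longlonglongrightarrow> 0"
    by (rule LIMSEQ_Suc[OF lim_const_over_n])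
  then have "\<bar>expectation (\<lambda>\<omega>. W \<omega> * L \<omega>)\<bar> \<le> 0"
    by (rule LIMSEQ_le_const) (use b in auto)
  then show "expectation (\<lambda>\<omega>. W \<omega> * L \<omega>) = 0" by simp
qed

text \<open>
  The sum of all squares has finite expectation, so it is almost surely a convergent series.
\<close>

lemma (in prob_space) summable_second_moments_AE_tendsto_zero:
  fixes Y :: "nat \<Rightarrow> 'a \<Rightarrow> real"
  assumes [measurable]: "\<And>n. Y n \<in> borel_measurable M"
    and sq: "\<And>n. integrable M (\<lambda>\<omega>. (Y n \<omega>)\<^sup>2)"
    and bd: "\<And>n. expectation (\<lambda>\<omega>. (Y n \<omega>)\<^sup>2) \<le> c n" and c: "summable c"
  shows "AE \<omega> in M. (\<lambda>n. Y n \<omega>) \<longlonglongrightarrow> 0"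
proof -
  have c0: "0 \<le> c n" for n using bd[of n] by (rule order_trans[rotated]) simp
  have "(\<integral>\<^sup>+\<omega>. (\<Sum>n. ennreal ((Y n \<omega>)\<^sup>2)) \<partial>M) = (\<Sum>n. \<integral>\<^sup>+\<omega>. ennreal ((Y n \<omega>)\<^sup>2) \<partial>M)"
    by (rule nn_integral_suminf) measurable
  also have "\<dots> = (\<Sum>n. ennreal (expectation (\<lambda>\<omega>. (Y n \<omega>)\<^sup>2)))"
    by (subst nn_integral_eq_integral[OF sq]) auto
  also have "\<dots> \<le> (\<Sum>n. ennreal (c n))"
    by (rule suminf_le) (use bd in \<open>auto intro!: ennreal_leI\<close>)
  also have "\<dots> = ennreal (\<Sum>n. c n)" by (rule suminf_ennreal2[OF c0 c])
  finally have "(\<integral>\<^sup>+\<omega>. (\<Sum>n. ennreal ((Y n \<omega>)\<^sup>2)) \<partial>M) \<noteq> \<infinity>" by (auto simp: top_unique)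
  then have "AE \<omega> in M. (\<Sum>n. ennreal ((Y n \<omega>)\<^sup>2)) \<noteq> \<infinity>"
    by (intro nn_integral_PInf_AE) measurable
  then show ?thesis
  proof eventually_elim
    fix \<omega> assume "(\<Sum>n. ennreal ((Y n \<omega>)\<^sup>2)) \<noteq> \<infinity>"
    then have "summable (\<lambda>n. (Y n \<omega>)\<^sup>2)"
      by (intro summable_suminf_not_top) auto
    then have "(\<lambda>n. sqrt ((Y n \<omega>)\<^sup>2)) \<longlonglongrightarrow> sqrt 0"
      by (intro tendsto_real_sqrt summable_LIMSEQ_zero)
    then show "(\<lambda>n. Y n \<omega>) \<longlonglongrightarrow> 0" by (simp add: tendsto_rabs_zero_iff)
  qed
qed

text \<open>
  Kolmogorov's argument: split the event according to the first index \<open>k\<close> at which the level is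
  reached. On that part \<open>N n ^ 2 \<ge> N k ^ 2 + 2 N k (N n - N k)\<close>, and the last term has mean zero since
  \<open>N k\<close> times the indicator of the part is known at time \<open>k\<close>.
\<close>

lemma (in prob_space) L2_maximal_inequality:
  fixes F :: "nat \<Rightarrow> 'a measure" and N :: "nat \<Rightarrow> 'a \<Rightarrow> real"
  assumes sp: "\<And>i. space (F i) = space M" and sub: "\<And>i. sets (F i) \<subseteq> sets M"
    and inc: "\<And>i. sets (F i) \<subseteq> sets (F (Suc i))"
    and Nm: "\<And>i. N i \<in> borel_measurable (F i)" and Nb: "\<And>i \<omega>. \<bar>N i \<omega>\<bar> \<le> K"
    and mart: "\<And>i W c. i \<le> n \<Longrightarrow> W \<in> borel_measurable (F i) \<Longrightarrow> (\<And>\<omega>. \<bar>W \<omega>\<bar> \<le> c) \<Longrightarrow>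
      expectation (\<lambda>\<omega>. W \<omega> * (N n \<omega> - N i \<omega>)) = 0"
    and l: "0 < lam"
  shows "prob {\<omega> \<in> space M. \<exists>i\<le>n. lam \<le> \<bar>N i \<omega>\<bar>} \<le> expectation (\<lambda>\<omega>. (N n \<omega>)\<^sup>2) / lam\<^sup>2"
proof -
  have K0: "0 \<le> K" using Nb[of 0 undefined] by (rule order_trans[OF abs_ge_zero])
  have up: "N i \<in> borel_measurable (F j)" if "i \<le> j" for i j
    by (rule measurable_subalgebra[OF Nm]) (use sp sets_mono_Suc[of F, OF inc that] in auto)
  have NM [measurable]: "N i \<in> borel_measurable M" for i by (rule measurable_subalgebra[OF Nm sp sub])
  \<comment> \<open>The indicator of the event that the level is first reached at index \<open>k\<close>.\<close>
  define I where "I k \<omega> = (if lam \<le> \<bar>N k \<omega>\<bar> \<and> (\<forall>j<k. \<bar>N j \<omega>\<bar> < lam) then 1 else 0 :: real)" for k \<omega>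
  have Im: "I k \<in> borel_measurable (F k)" for k
  proof -
    have [measurable]: "N k \<in> borel_measurable (F k)" by (rule Nm)
    have m: "Measurable.pred (F k) (\<lambda>\<omega>. \<bar>N j \<omega>\<bar> < lam)" if "j < k" for j
    proof -
      have [measurable]: "N j \<in> borel_measurable (F k)" by (rule up) (use that in simp)
      show ?thesis by measurable
    qed
    have "Measurable.pred (F k) (\<lambda>\<omega>. \<forall>j<k. \<bar>N j \<omega>\<bar> < lam)"
      using sets.sets_Collect_finite_All[of "{..<k}" "F k" "\<lambda>j \<omega>. \<bar>N j \<omega>\<bar> < lam"] m
      by (simp add: pred_def)
    moreover have "Measurable.pred (F k) (\<lambda>\<omega>. lam \<le> \<bar>N k \<omega>\<bar>)" by measurable
    ultimately have "{\<omega> \<in> space (F k). lam \<le> \<bar>N k \<omega>\<bar> \<and> (\<forall>j<k. \<bar>N j \<omega>\<bar> < lam)} \<in> sets (F k)"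
      unfolding pred_def by (intro sets.sets_Collect_conj)
    then show ?thesis unfolding I_def[abs_def] by (intro measurable_If borel_measurable_const)
  qed
  have IM [measurable]: "I k \<in> borel_measurable M" for k by (rule measurable_subalgebra[OF Im sp sub])
  have I01: "I k \<omega> = 0 \<or> I k \<omega> = 1" for k \<omega> by (auto simp: I_def)
  have Ib: "\<bar>I k \<omega>\<bar> \<le> 1" for k \<omega> using I01[of k \<omega>] by auto
  let ?E = "{\<omega> \<in> space M. \<exists>i\<le>n. lam \<le> \<bar>N i \<omega>\<bar>}"
  have Isum: "(\<Sum>k\<le>n. I k \<omega>) = indicator ?E \<omega>" if "\<omega> \<in> space M" for \<omega>
  proof (cases "\<omega> \<in> ?E")
    case True
    then obtain k where k: "lam \<le> \<bar>N k \<omega>\<bar>" "k \<le> n" "\<forall>j<k. \<not> lam \<le> \<bar>N j \<omega>\<bar>"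
      using exists_least_iff[of "\<lambda>i. i \<le> n \<and> lam \<le> \<bar>N i \<omega>\<bar>"] by fastforce
    have "I j \<omega> = (if j = k then 1 else 0)" for j
      using k by (cases j k rule: linorder_cases) (auto simp: I_def not_le)
    then show ?thesis using True k by simp
  next
    case False
    then have "I j \<omega> = 0" if "j \<le> n" for j using that \<open>\<omega> \<in> space M\<close> by (auto simp: I_def)
    then show ?thesis using False by simp
  qed
  have Wm: "(\<lambda>\<omega>. I k \<omega> * N k \<omega>) \<in> borel_measurable (F k)" for k using Im Nm by simp
  have Wb: "\<bar>I k \<omega> * N k \<omega>\<bar> \<le> K" for k \<omega>
    using I01[of k \<omega>] Nb[of k \<omega>] K0 by auto
  have pt: "lam\<^sup>2 * indicator ?E \<omega> \<le> (N n \<omega>)\<^sup>2 - (\<Sum>k\<le>n. 2 * (I k \<omega> * N k \<omega> * (N n \<omega> - N k \<omega>)))"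
    if "\<omega> \<in> space M" for \<omega>
  proof -
    have "lam\<^sup>2 * indicator ?E \<omega> = (\<Sum>k\<le>n. lam\<^sup>2 * I k \<omega>)"
      unfolding Isum[OF that, symmetric] by (rule sum_distrib_left)
    also have "\<dots> \<le> (\<Sum>k\<le>n. I k \<omega> * (N n \<omega>)\<^sup>2 - 2 * (I k \<omega> * N k \<omega> * (N n \<omega> - N k \<omega>)))"
    proof (rule sum_mono)
      fix k
      show "lam\<^sup>2 * I k \<omega> \<le> I k \<omega> * (N n \<omega>)\<^sup>2 - 2 * (I k \<omega> * N k \<omega> * (N n \<omega> - N k \<omega>))"
      proof (cases "I k \<omega> = 0")
        case False
        then have 1: "I k \<omega> = 1" and "lam \<le> \<bar>N k \<omega>\<bar>" by (auto simp: I_def split: if_splits)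
        then have "lam\<^sup>2 \<le> (N k \<omega>)\<^sup>2" using l by (metis abs_ge_self abs_le_square_iff abs_of_pos order_trans power2_abs)
        moreover have "0 \<le> (N n \<omega> - N k \<omega>)\<^sup>2" by simp
        ultimately show ?thesis unfolding 1 by (simp add: power2_eq_square algebra_simps)
      qed simp
    qed
    also have "\<dots> = (\<Sum>k\<le>n. I k \<omega>) * (N n \<omega>)\<^sup>2 - (\<Sum>k\<le>n. 2 * (I k \<omega> * N k \<omega> * (N n \<omega> - N k \<omega>)))"
      by (simp add: sum_subtractf sum_distrib_right)
    also have "\<dots> \<le> (N n \<omega>)\<^sup>2 - (\<Sum>k\<le>n. 2 * (I k \<omega> * N k \<omega> * (N n \<omega> - N k \<omega>)))"
      unfolding Isum[OF that] by (auto simp: indicator_def)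
    finally show ?thesis .
  qed
  have E [measurable]: "?E \<in> events"
  proof -
    have "{\<omega> \<in> space M. \<exists>i\<in>{..n}. lam \<le> \<bar>N i \<omega>\<bar>} \<in> events"
      by (rule sets.sets_Collect_finite_Ex) auto
    then show ?thesis by (simp add: Bex_def)
  qed
  have sqi: "integrable M (\<lambda>\<omega>. (N n \<omega>)\<^sup>2)"
    by (rule integrable_const_bound[of _ "K\<^sup>2"]) (use Nb K0 in \<open>auto simp: abs_le_square_iff[symmetric]\<close>)
  have ti: "integrable M (\<lambda>\<omega>. I k \<omega> * N k \<omega> * (N n \<omega> - N k \<omega>))" for k
  proof (rule integrable_const_bound[of _ "K * (2 * K)"])
    show "AE \<omega> in M. norm (I k \<omega> * N k \<omega> * (N n \<omega> - N k \<omega>)) \<le> K * (2 * K)"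
    proof (rule AE_I2)
      fix \<omega>
      have "\<bar>N n \<omega> - N k \<omega>\<bar> \<le> 2 * K" using Nb[of n \<omega>] Nb[of k \<omega>] by linarith
      then show "norm (I k \<omega> * N k \<omega> * (N n \<omega> - N k \<omega>)) \<le> K * (2 * K)"
        using Wb[of k \<omega>] K0 by (simp only: real_norm_def abs_mult[of "I k \<omega> * N k \<omega>"]) (intro mult_mono, auto)
    qed
  qed measurable
  have "lam\<^sup>2 * prob ?E = expectation (\<lambda>\<omega>. lam\<^sup>2 * indicator ?E \<omega>)" by simp
  also have "\<dots> \<le> expectation (\<lambda>\<omega>. (N n \<omega>)\<^sup>2 - (\<Sum>k\<le>n. 2 * (I k \<omega> * N k \<omega> * (N n \<omega> - N k \<omega>))))"
    by (rule integral_mono) (use sqi ti pt in \<open>auto intro!: integrable_real_indicator simp: emeasure_eq_measure\<close>)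
  also have "\<dots> = expectation (\<lambda>\<omega>. (N n \<omega>)\<^sup>2) - (\<Sum>k\<le>n. 2 * expectation (\<lambda>\<omega>. I k \<omega> * N k \<omega> * (N n \<omega> - N k \<omega>)))"
    using sqi ti by (simp add: Bochner_Integration.integral_diff Bochner_Integration.integral_sum)
  also have "\<dots> = expectation (\<lambda>\<omega>. (N n \<omega>)\<^sup>2)"
    using mart[OF _ Wm Wb] by simp
  finally show ?thesis using l by (simp add: field_simps)
qed

section \<open>Ito's formula along a path\<close>

text \<open>
  The value \<open>0\<close> at the origin agrees with the two indicators of the equation, both of which exclude
  the skew level.
\<close>

definition refracted_drift :: "real \<Rightarrow> real \<Rightarrow> real \<Rightarrow> real" where
  "refracted_drift \<mu>p \<mu>m y = (if y > 0 then \<mu>p else if y < 0 then \<mu>m else 0)"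

lemma refracted_drift_measurable [measurable]: "refracted_drift \<mu>p \<mu>m \<in> borel_measurable borel"
  unfolding refracted_drift_def by measurable

lemma abs_refracted_drift_le: "\<bar>refracted_drift \<mu>p \<mu>m y\<bar> \<le> \<bar>\<mu>p\<bar> + \<bar>\<mu>m\<bar>"
  by (auto simp: refracted_drift_def)

text \<open>
  The path is continuous on the interval only; composing with the projection onto the interval makes
  it continuous, hence measurable, on the whole line.
\<close>

lemma bounded_compose_integrable_on:
  fixes G y :: "real \<Rightarrow> real"
  assumes G [measurable]: "G \<in> borel_measurable borel" and b: "\<And>x. \<bar>G x\<bar> \<le> C"
    and y: "continuous_on {u..v} y"
  shows "(\<lambda>r. G (y r)) integrable_on {u..v}"
    and "set_integrable lborel {u..v} (\<lambda>r. G (y r))"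
proof -
  define c where "c r = max u (min v r)" for r
  have si: "set_integrable lborel {u..v} (\<lambda>r. G (y r))"
  proof (cases "u \<le> v")
    case True
    have "continuous_on UNIV (\<lambda>r. y (c r))"
      by (rule continuous_on_compose2[OF y]) (use True in \<open>auto simp: c_def intro!: continuous_intros\<close>)
    then have [measurable]: "(\<lambda>r. y (c r)) \<in> borel_measurable borel"
      by (rule borel_measurable_continuous_onI)
    have "set_integrable lborel {u..v} (\<lambda>r. G (y (c r)))" unfolding set_integrable_def
      by (rule integrableI_bounded_set_indicator[where B=C]) (use b True in auto)
    then show ?thesis
      by (rule set_integrable_cong[THEN iffD1, rotated -1]) (auto simp: c_def)
  next
    case False
    then show ?thesis by (simp add: set_integrable_def)
  qed
  then show "set_integrable lborel {u..v} (\<lambda>r. G (y r))" .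
  show "(\<lambda>r. G (y r)) integrable_on {u..v}" by (rule set_borel_integral_eq_integral(1)[OF si])
qed

lemma taylor_second_order:
  fixes f :: "real \<Rightarrow> real"
  assumes d1: "\<And>x. (f has_real_derivative f' x) (at x)" and d2: "\<And>x. (f' has_real_derivative f'' x) (at x)"
  shows "\<exists>\<xi>. min a b \<le> \<xi> \<and> \<xi> \<le> max a b \<and> f b = f a + f' a * (b - a) + f'' \<xi> / 2 * (b - a)\<^sup>2"
proof (cases "a = b")
  case True
  then show ?thesis by auto
next
  case False
  define D where "D m = (if m = 0 then f else if m = 1 then f' else f'')" for m :: nat
  have "\<forall>m t. m < 2 \<and> min a b \<le> t \<and> t \<le> max a b \<longrightarrow> DERIV (D m) t :> D (Suc m) t"
  proof (intro allI impI)
    fix m :: nat and t assume "m < 2 \<and> min a b \<le> t \<and> t \<le> max a b"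
    then have "m = 0 \<or> m = 1" by auto
    then show "DERIV (D m) t :> D (Suc m) t" using d1 d2 by (auto simp: D_def)
  qed
  from Taylor[of 2 D f "min a b" "max a b" a b, OF _ _ this]
  obtain t where t: "if b < a then b < t \<and> t < a else a < t \<and> t < b"
    and eq: "f b = (\<Sum>m<2. D m a / fact m * (b - a) ^ m) + D 2 t / fact 2 * (b - a)\<^sup>2"
    using False by (auto simp: D_def)
  show ?thesis
    by (rule exI[of _ t]) (use t eq in \<open>auto simp: D_def numeral_2_eq_2 split: if_splits\<close>)
qed

text \<open>
  One grid interval of Ito's formula, with an error that is small relative to
  \<open>\<Delta>t + \<Delta>L + (\<Delta>B)\<^sup>2\<close>, a quantity whose sum over the grid stays bounded. The local time only
  increases on intervals in which the path visits \<open>0\<close>, which is why \<open>f' (y u)\<close> may be replaced by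
  \<open>f' 0\<close> in front of \<open>dL\<close>. In the squared increment everything except \<open>dW\<^sup>2\<close> contains a factor of the
  finite variation increment \<open>dA\<close>, which is bounded both by \<open>2 \<eta>\<close> and by a multiple of
  \<open>\<Delta>t + \<Delta>L\<close>. The subtracted
  \<open>f''/2 (dW\<^sup>2 - (v - u))\<close> is the fluctuation of the quadratic variation.
\<close>

lemma ito_step:
  fixes f f' f'' y :: "real \<Rightarrow> real" and \<mu>p \<mu>m :: real
  defines "b \<equiv> refracted_drift \<mu>p \<mu>m"
  assumes d1: "\<And>x. (f has_real_derivative f' x) (at x)" and d2: "\<And>x. (f' has_real_derivative f'' x) (at x)"
    and f2m [measurable]: "f'' \<in> borel_measurable borel"
    and K: "\<And>x. \<bar>f' x\<bar> \<le> K" "\<And>x. \<bar>f'' x\<bar> \<le> K"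
    and uv: "u \<le> v" and y: "continuous_on {u..v} y"
    and eq: "y v - y u = dW + \<beta> * dL + integral {u..v} (\<lambda>r. b (y r))"
    and dL: "0 \<le> dL" "(\<And>r. r \<in> {u..v} \<Longrightarrow> y r \<noteq> 0) \<Longrightarrow> dL = 0" and \<beta>: "\<bar>\<beta>\<bar> \<le> 1"
    and osc1: "\<And>r. r \<in> {u..v} \<Longrightarrow> \<bar>f' (y r) - f' (y u)\<bar> \<le> \<eta>"
    and osc2: "\<And>r. r \<in> {u..v} \<Longrightarrow> \<bar>f'' (y r) - f'' (y u)\<bar> \<le> \<eta>"
    and dW: "\<bar>dW\<bar> \<le> \<eta>" and dy: "\<bar>y v - y u\<bar> \<le> \<eta>" and \<eta>: "\<eta> \<le> 1"
    and C: "C = \<bar>\<mu>p\<bar> + \<bar>\<mu>m\<bar>"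
  shows "\<bar>f (y v) - f (y u) - integral {u..v} (\<lambda>r. f' (y r) * b (y r) + f'' (y r) / 2) - \<beta> * f' 0 * dL
     - (f' (y u) * dW + f'' (y u) / 2 * (dW\<^sup>2 - (v - u)))\<bar>
     \<le> \<eta> * ((3 + 2 * K) * (C + 1)) * ((v - u) + dL + dW\<^sup>2)"
proof -
  have K0: "0 \<le> K" using K(1)[of 0] by simp
  have C0: "0 \<le> C" using C by simp
  have \<eta>0: "0 \<le> \<eta>" using dW by simp
  have bC: "\<bar>b x\<bar> \<le> C" for x unfolding b_def C by (rule abs_refracted_drift_le)
  have bm [measurable]: "b \<in> borel_measurable borel" unfolding b_def by measurable
  have "continuous_on UNIV f'" using d2 by (meson DERIV_continuous_on has_field_derivative_at_within)
  then have f1m [measurable]: "f' \<in> borel_measurable borel" by (rule borel_measurable_continuous_onI)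
  have f1b: "\<bar>f' x * b x\<bar> \<le> K * C" for x using K(1)[of x] bC[of x] K0 by (auto simp: abs_mult intro!: mult_mono)
  have ib: "(\<lambda>r. b (y r)) integrable_on {u..v}"
    by (rule bounded_compose_integrable_on(1)[OF _ bC y]) measurable
  have Gb: "\<bar>f' x * b x + f'' x / 2\<bar> \<le> K * C + K" for x using f1b[of x] K(2)[of x] by linarith
  have iG: "(\<lambda>r. f' (y r) * b (y r) + f'' (y r) / 2) integrable_on {u..v}"
    by (rule bounded_compose_integrable_on(1)[OF _ Gb y]) measurable
  define Ib where "Ib = integral {u..v} (\<lambda>r. b (y r))"
  define IG where "IG = integral {u..v} (\<lambda>r. f' (y r) * b (y r) + f'' (y r) / 2)"
  have ic: "(\<lambda>r. f' (y u) * b (y r) + f'' (y u) / 2) integrable_on {u..v}"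
    by (intro integrable_add integrable_on_mult_right ib integrable_const_ivl)
  have "f' (y u) * Ib + f'' (y u) / 2 * (v - u) - IG
    = integral {u..v} (\<lambda>r. f' (y u) * b (y r) + f'' (y u) / 2) - IG"
    unfolding Ib_def using uv
    by (subst integral_add[OF integrable_on_mult_right[OF ib] integrable_const_ivl]) simp
  also have "\<dots> = integral {u..v} (\<lambda>r. f' (y u) * b (y r) + f'' (y u) / 2 - (f' (y r) * b (y r) + f'' (y r) / 2))"
    unfolding IG_def by (rule integral_diff[OF ic iG, symmetric])
  also have "\<bar>\<dots>\<bar> \<le> integral {u..v} (\<lambda>r. \<eta> * C + \<eta> / 2)"
  proof -
    have "norm (integral {u..v} (\<lambda>r. f' (y u) * b (y r) + f'' (y u) / 2 - (f' (y r) * b (y r) + f'' (y r) / 2)))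
      \<le> integral {u..v} (\<lambda>r. \<eta> * C + \<eta> / 2)"
    proof (rule integral_norm_bound_integral[OF integrable_diff[OF ic iG]])
      fix r assume r: "r \<in> {u..v}"
      have "\<bar>(f' (y r) - f' (y u)) * b (y r)\<bar> \<le> \<eta> * C"
        unfolding abs_mult using osc1[OF r] bC[of "y r"] \<eta>0 by (intro mult_mono) auto
      moreover have eq: "f' (y u) * b (y r) + f'' (y u) / 2 - (f' (y r) * b (y r) + f'' (y r) / 2)
         = - ((f' (y r) - f' (y u)) * b (y r)) - (f'' (y r) - f'' (y u)) / 2" by (simp add: algebra_simps diff_divide_distrib)
      have "\<bar>- P - Q / 2\<bar> \<le> c + \<eta> / 2" if "\<bar>P\<bar> \<le> c" "\<bar>Q\<bar> \<le> \<eta>" for P Q c :: real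
        using that by linarith
      ultimately show "norm (f' (y u) * b (y r) + f'' (y u) / 2 - (f' (y r) * b (y r) + f'' (y r) / 2)) \<le> \<eta> * C + \<eta> / 2"
        using osc2[OF r] unfolding real_norm_def eq by blast
    qed (rule integrable_const_ivl)
    then show ?thesis by simp
  qed
  also have "\<dots> = (\<eta> * C + \<eta> / 2) * (v - u)" using uv by simp
  finally have T1: "\<bar>f' (y u) * Ib + f'' (y u) / 2 * (v - u) - IG\<bar> \<le> (\<eta> * C + \<eta> / 2) * (v - u)" .
  have Ibb: "\<bar>Ib\<bar> \<le> C * (v - u)"
  proof -
    have "norm Ib \<le> integral {u..v} (\<lambda>r. C)"
      unfolding Ib_def by (rule integral_norm_bound_integral[OF ib]) (use bC in auto)
    then show ?thesis using uv by (simp add: mult.commute)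
  qed
  have T2: "\<bar>\<beta> * dL * (f' (y u) - f' 0)\<bar> \<le> \<eta> * dL"
  proof (cases "\<forall>r\<in>{u..v}. y r \<noteq> 0")
    case True
    then show ?thesis using dL by simp
  next
    case False
    then obtain r where "r \<in> {u..v}" "y r = 0" by auto
    then have "\<bar>f' (y u) - f' 0\<bar> \<le> \<eta>" using osc1[of r] by simp
    moreover have "\<bar>\<beta> * dL\<bar> \<le> dL" using \<beta> dL(1) by (simp add: abs_mult mult_left_le_one_le)
    ultimately show ?thesis unfolding abs_mult[of "\<beta> * dL"]
      by (subst mult.commute) (rule mult_mono, use \<eta>0 in auto)
  qed
  define dA where "dA = \<beta> * dL + Ib"
  have dX: "y v - y u = dW + dA" using eq by (simp add: dA_def Ib_def)
  have dA1: "\<bar>dA\<bar> \<le> dL + C * (v - u)"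
  proof -
    have "\<bar>\<beta> * dL\<bar> \<le> dL" using \<beta> dL(1) by (simp add: abs_mult mult_left_le_one_le)
    then show ?thesis using Ibb unfolding dA_def by linarith
  qed
  have dA2: "\<bar>dA\<bar> \<le> 2 * \<eta>" using dX dy dW by linarith
  have dAsq: "dA\<^sup>2 \<le> 2 * \<eta> * \<bar>dA\<bar>"
    using mult_right_mono[OF dA2, of "\<bar>dA\<bar>"] by (simp add: power2_eq_square)
  obtain \<xi> where \<xi>: "min (y u) (y v) \<le> \<xi>" "\<xi> \<le> max (y u) (y v)"
    and tay: "f (y v) = f (y u) + f' (y u) * (y v - y u) + f'' \<xi> / 2 * (y v - y u)\<^sup>2"
    using taylor_second_order[OF d1 d2, of "y u" "y v"] by auto
  have "\<exists>r. u \<le> r \<and> r \<le> v \<and> y r = \<xi>"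
  proof (cases "y u \<le> y v")
    case True then show ?thesis using IVT'[of y u \<xi> v] \<xi> uv y by auto
  next
    case False then show ?thesis using IVT2'[of y v \<xi> u] \<xi> uv y by auto
  qed
  then obtain r where "r \<in> {u..v}" "y r = \<xi>" by auto
  then have o2: "\<bar>f'' \<xi> - f'' (y u)\<bar> \<le> \<eta>" using osc2 by blast
  have T3: "\<bar>(f'' \<xi> - f'' (y u)) / 2 * (dW + dA)\<^sup>2\<bar> \<le> \<eta> * (dW\<^sup>2 + 2 * \<bar>dA\<bar>)"
  proof -
    have "(dW + dA)\<^sup>2 \<le> 2 * dW\<^sup>2 + 2 * dA\<^sup>2"
      using zero_le_power2[of "dW - dA"] by (simp add: power2_eq_square algebra_simps)
    also have "dA\<^sup>2 \<le> 2 * \<bar>dA\<bar>"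
      using dAsq mult_right_mono[of "2 * \<eta>" 2 "\<bar>dA\<bar>"] \<eta> by linarith
    finally have "(dW + dA)\<^sup>2 / 2 \<le> dW\<^sup>2 + 2 * \<bar>dA\<bar>" by simp
    then have "\<bar>f'' \<xi> - f'' (y u)\<bar> * ((dW + dA)\<^sup>2 / 2) \<le> \<eta> * (dW\<^sup>2 + 2 * \<bar>dA\<bar>)"
      using o2 \<eta>0 by (intro mult_mono) auto
    then show ?thesis by (simp add: abs_mult)
  qed
  have T4: "\<bar>f'' (y u) / 2 * (2 * dW * dA + dA\<^sup>2)\<bar> \<le> 2 * K * \<eta> * \<bar>dA\<bar>"
  proof -
    have "\<bar>dW * dA\<bar> \<le> \<eta> * \<bar>dA\<bar>" unfolding abs_mult using dW by (intro mult_right_mono) auto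
    moreover have "\<bar>2 * x + q\<bar> \<le> 4 * c" if "\<bar>x\<bar> \<le> c" "0 \<le> q" "q \<le> 2 * c" for x q c :: real
      using that by linarith
    ultimately have "\<bar>2 * dW * dA + dA\<^sup>2\<bar> \<le> 4 * (\<eta> * \<bar>dA\<bar>)"
      using dAsq by (simp add: mult.assoc)
    then have "\<bar>f'' (y u)\<bar> / 2 * \<bar>2 * dW * dA + dA\<^sup>2\<bar> \<le> K / 2 * (4 * (\<eta> * \<bar>dA\<bar>))"
      using K(2)[of "y u"] K0 by (intro mult_mono) auto
    then show ?thesis by (simp add: abs_mult)
  qed
  have "f (y v) - f (y u) - IG - \<beta> * f' 0 * dL - (f' (y u) * dW + f'' (y u) / 2 * (dW\<^sup>2 - (v - u)))
    = (f' (y u) * Ib + f'' (y u) / 2 * (v - u) - IG) + \<beta> * dL * (f' (y u) - f' 0)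
      + (f'' \<xi> - f'' (y u)) / 2 * (dW + dA)\<^sup>2 + f'' (y u) / 2 * (2 * dW * dA + dA\<^sup>2)"
    unfolding tay dX unfolding dA_def by (simp add: power2_eq_square algebra_simps add_divide_distrib diff_divide_distrib)
  also have "\<bar>\<dots>\<bar> \<le> (\<eta> * C + \<eta> / 2) * (v - u) + \<eta> * dL + \<eta> * (dW\<^sup>2 + 2 * \<bar>dA\<bar>) + 2 * K * \<eta> * \<bar>dA\<bar>"
    using T1 T2 T3 T4 by linarith
  also have "\<dots> = \<eta> * ((C + 1/2) * (v - u) + dL + dW\<^sup>2 + (2 + 2 * K) * \<bar>dA\<bar>)"
    by (simp add: algebra_simps)
  also have "\<dots> \<le> \<eta> * (((3 + 2 * K) * (C + 1)) * ((v - u) + dL + dW\<^sup>2))"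
  proof (rule mult_left_mono[OF _ \<eta>0])
    have "(2 + 2 * K) * \<bar>dA\<bar> \<le> (2 + 2 * K) * (dL + C * (v - u))"
      using dA1 K0 by (intro mult_left_mono) auto
    moreover have "((3 + 2 * K) * (C + 1)) * ((v - u) + dL + dW\<^sup>2) -
       ((C + 1/2) * (v - u) + dL + dW\<^sup>2 + (2 + 2 * K) * (dL + C * (v - u)))
       = (2 * K + 5 / 2) * (v - u) + (3 + 2 * K) * (C * dL) + ((3 + 2 * K) * C + 2 * K + 2) * dW\<^sup>2"
      by (simp add: field_simps)
    moreover have "0 \<le> (2 * K + 5 / 2) * (v - u) + (3 + 2 * K) * (C * dL) + ((3 + 2 * K) * C + 2 * K + 2) * dW\<^sup>2"
      using K0 C0 uv dL(1) by (intro add_nonneg_nonneg mult_nonneg_nonneg) auto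
    ultimately show "(C + 1/2) * (v - u) + dL + dW\<^sup>2 + (2 + 2 * K) * \<bar>dA\<bar>
        \<le> ((3 + 2 * K) * (C + 1)) * ((v - u) + dL + dW\<^sup>2)" by linarith
  qed
  finally show ?thesis unfolding IG_def by (simp add: mult.assoc)
qed

text \<open>
  Summing \<open>ito_step\<close> over the grid telescopes. Uniform continuity of the path, of the driving path and
  of \<open>f'\<close> and \<open>f''\<close> along the path provides a common oscillation bound \<open>\<eta>\<close> on fine grids, and the
  bound \<open>Q\<close> on the squared increments keeps the accumulated error below a multiple of \<open>\<eta>\<close>.
\<close>

lemma ito_pathwise:
  fixes f f' f'' y W L :: "real \<Rightarrow> real" and \<mu>p \<mu>m :: real
  defines "b \<equiv> refracted_drift \<mu>p \<mu>m"
  assumes d1: "\<And>x. (f has_real_derivative f' x) (at x)" and d2: "\<And>x. (f' has_real_derivative f'' x) (at x)"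
    and f2c: "continuous_on UNIV f''"
    and K: "\<And>x. \<bar>f' x\<bar> \<le> K" "\<And>x. \<bar>f'' x\<bar> \<le> K"
    and rt: "r \<le> t" and y: "continuous_on {r..t} y" and W: "continuous_on {r..t} W"
    and eq: "\<And>u v. r \<le> u \<Longrightarrow> u \<le> v \<Longrightarrow> v \<le> t \<Longrightarrow>
       y v - y u = (W v - W u) + \<beta> * (L v - L u) + integral {u..v} (\<lambda>s. b (y s))"
    and L: "\<And>u v. r \<le> u \<Longrightarrow> u \<le> v \<Longrightarrow> v \<le> t \<Longrightarrow> L u \<le> L v"
      "\<And>u v. r \<le> u \<Longrightarrow> u \<le> v \<Longrightarrow> v \<le> t \<Longrightarrow> (\<And>s. s \<in> {u..v} \<Longrightarrow> y s \<noteq> 0) \<Longrightarrow> L u = L v"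
    and \<beta>: "\<bar>\<beta>\<bar> \<le> 1"
    and p: "\<And>n i. p n i = r + real i * ((t - r) / 2 ^ n)"
    and Q: "\<And>n. (\<Sum>i<2^n. (W (p n (Suc i)) - W (p n i))\<^sup>2) \<le> Q"
  shows "(\<lambda>n. \<Sum>i<2^n. f' (y (p n i)) * (W (p n (Suc i)) - W (p n i))
      + f'' (y (p n i)) / 2 * ((W (p n (Suc i)) - W (p n i))\<^sup>2 - (t - r) / 2 ^ n))
    \<longlonglongrightarrow> f (y t) - f (y r) - integral {r..t} (\<lambda>s. f' (y s) * b (y s) + f'' (y s) / 2) - \<beta> * f' 0 * (L t - L r)"
    (is "?S \<longlonglongrightarrow> ?J")
proof -
  define C where "C = \<bar>\<mu>p\<bar> + \<bar>\<mu>m\<bar>"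
  define D where "D = (3 + 2 * K) * (C + 1)"
  have K0: "0 \<le> K" using K(1)[of 0] by simp
  have D0: "0 \<le> D" unfolding D_def C_def using K0 by simp
  have bC: "\<bar>b x\<bar> \<le> C" for x unfolding b_def C_def by (rule abs_refracted_drift_le)
  have [measurable]: "b \<in> borel_measurable borel" unfolding b_def by measurable
  have f2m [measurable]: "f'' \<in> borel_measurable borel" by (rule borel_measurable_continuous_onI[OF f2c])
  have f1c: "continuous_on UNIV f'" using d2 by (meson DERIV_continuous_on has_field_derivative_at_within)
  then have f1m [measurable]: "f' \<in> borel_measurable borel" by (rule borel_measurable_continuous_onI)
  let ?G = "\<lambda>x. f' x * b x + f'' x / 2"
  have f1b: "\<bar>f' x * b x\<bar> \<le> K * C" for x using K(1)[of x] bC[of x] K0 by (auto simp: abs_mult intro!: mult_mono)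
  have Gb: "\<bar>?G x\<bar> \<le> K * C + K" for x using f1b[of x] K(2)[of x] by linarith
  have iG: "(\<lambda>s. ?G (y s)) integrable_on {u..v}" if "r \<le> u" "v \<le> t" for u v
    by (rule bounded_compose_integrable_on(1)[OF _ Gb continuous_on_subset[OF y]]) (use that in auto)
  define J where "J u = f (y u) - integral {r..u} (\<lambda>s. ?G (y s)) - \<beta> * f' 0 * L u" for u
  define T where "T = D * ((t - r) + (L t - L r) + Q)"
  have "0 \<le> Q" using order_trans[OF sum_nonneg Q[of 0]] by simp
  then have T0: "0 \<le> T" unfolding T_def using D0 rt L(1)[of r t] by (intro mult_nonneg_nonneg) auto
  have uc: "uniformly_continuous_on {r..t} g" if "continuous_on {r..t} g" for g :: "real \<Rightarrow> real"
    by (rule compact_uniformly_continuous[OF that]) simp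
  have comp: "continuous_on {r..t} (\<lambda>s. g (y s))" if "continuous_on UNIV g" for g :: "real \<Rightarrow> real"
    by (rule continuous_on_compose2[OF that y]) auto
  have pr: "p n 0 = r" "p n (2 ^ n) = t" for n unfolding p by (auto simp: field_simps)
  have pS: "p n (Suc i) - p n i = (t - r) / 2 ^ n" for n i
  proof -
    have "r + real (Suc i) * h - (r + real i * h) = h" for h by (simp add: algebra_simps)
    then show ?thesis unfolding p .
  qed
  have main: "\<exists>N. \<forall>n\<ge>N. \<bar>?J - ?S n\<bar> \<le> \<eta> * T" if \<eta>: "0 < \<eta>" "\<eta> \<le> 1" for \<eta>
  proof -
    have "\<exists>d>0. \<forall>u\<in>{r..t}. \<forall>v\<in>{r..t}. \<bar>v - u\<bar> < d \<longrightarrow> \<bar>g v - g u\<bar> < \<eta>"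
      if "continuous_on {r..t} g" for g :: "real \<Rightarrow> real"
      using uc[OF that] \<eta>(1) unfolding uniformly_continuous_on_def dist_real_def by blast
    note m = this
    obtain e1 where e1: "e1 > 0" "\<And>u v. u \<in> {r..t} \<Longrightarrow> v \<in> {r..t} \<Longrightarrow> \<bar>v - u\<bar> < e1 \<Longrightarrow> \<bar>f' (y v) - f' (y u)\<bar> < \<eta>"
      using m[OF comp[OF f1c]] by blast
    obtain e2 where e2: "e2 > 0" "\<And>u v. u \<in> {r..t} \<Longrightarrow> v \<in> {r..t} \<Longrightarrow> \<bar>v - u\<bar> < e2 \<Longrightarrow> \<bar>f'' (y v) - f'' (y u)\<bar> < \<eta>"
      using m[OF comp[OF f2c]] by blast
    obtain e3 where e3: "e3 > 0" "\<And>u v. u \<in> {r..t} \<Longrightarrow> v \<in> {r..t} \<Longrightarrow> \<bar>v - u\<bar> < e3 \<Longrightarrow> \<bar>W v - W u\<bar> < \<eta>"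
      using m[OF W] by blast
    obtain e4 where e4: "e4 > 0" "\<And>u v. u \<in> {r..t} \<Longrightarrow> v \<in> {r..t} \<Longrightarrow> \<bar>v - u\<bar> < e4 \<Longrightarrow> \<bar>y v - y u\<bar> < \<eta>"
      using m[OF y] by blast
    define e where "e = min (min e1 e2) (min e3 e4)"
    have e: "e > 0" using e1 e2 e3 e4 by (simp add: e_def)
    have "(\<lambda>n. (t - r) * (1 / 2) ^ n) \<longlonglongrightarrow> (t - r) * 0"
      by (intro tendsto_intros LIMSEQ_power_zero) auto
    then have "\<forall>\<^sub>F n in sequentially. (t - r) * (1 / 2) ^ n < e"
      using e by (intro order_tendstoD) auto
    then obtain N where N: "\<And>n. n \<ge> N \<Longrightarrow> (t - r) / 2 ^ n < e"
      by (auto simp: eventually_sequentially power_one_over field_simps)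
    have "\<bar>?J - ?S n\<bar> \<le> \<eta> * T" if n: "n \<ge> N" for n
    proof -
      define h where "h = (t - r) / 2 ^ n"
      have h0: "0 \<le> h" using rt by (simp add: h_def)
      define dW where "dW i = W (p n (Suc i)) - W (p n i)" for i
      define dL where "dL i = L (p n (Suc i)) - L (p n i)" for i
      have ph: "p n (Suc i) - p n i = h" for i using pS by (simp add: h_def)
      have pmono: "p n i \<le> p n j" if "i \<le> j" for i j
        unfolding p using that rt by (intro add_left_mono mult_right_mono) auto
      have step: "\<bar>J (p n (Suc i)) - J (p n i) - (f' (y (p n i)) * dW i + f'' (y (p n i)) / 2 * ((dW i)\<^sup>2 - h))\<bar>
          \<le> \<eta> * D * (h + dL i + (dW i)\<^sup>2)" if i: "i < 2 ^ n" for i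
      proof -
        let ?u = "p n i" and ?v = "p n (Suc i)"
        have uv: "r \<le> ?u" "?u \<le> ?v" "?v \<le> t"
          using pmono[of 0 i] pmono[of i "Suc i"] pmono[of "Suc i" "2 ^ n"] i pr[of n] by auto
        have close: "\<bar>s - ?u\<bar> < e" if "s \<in> {?u..?v}" for s
          using that ph[of i] N[OF n] by (auto simp: h_def)
        have inI: "?u \<in> {r..t}" "?v \<in> {r..t}" "\<And>s. s \<in> {?u..?v} \<Longrightarrow> s \<in> {r..t}" using uv by auto
        have "\<bar>f (y ?v) - f (y ?u) - integral {?u..?v} (\<lambda>s. ?G (y s)) - \<beta> * f' 0 * dL i
          - (f' (y ?u) * dW i + f'' (y ?u) / 2 * ((dW i)\<^sup>2 - (?v - ?u)))\<bar>
          \<le> \<eta> * ((3 + 2 * K) * (C + 1)) * ((?v - ?u) + dL i + (dW i)\<^sup>2)"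
          unfolding b_def
        proof (rule ito_step[OF d1 d2 f2m K])
          show "continuous_on {?u..?v} y" by (rule continuous_on_subset[OF y]) (use uv in auto)
          show "y ?v - y ?u = dW i + \<beta> * dL i + integral {?u..?v} (\<lambda>s. refracted_drift \<mu>p \<mu>m (y s))"
            using eq[OF uv] by (simp add: dW_def dL_def b_def)
          show "0 \<le> dL i" using L(1)[OF uv] by (simp add: dL_def)
          show "dL i = 0" if "\<And>s. s \<in> {?u..?v} \<Longrightarrow> y s \<noteq> 0" using L(2)[OF uv that] by (simp add: dL_def)
          show "\<bar>f' (y s) - f' (y ?u)\<bar> \<le> \<eta>" if "s \<in> {?u..?v}" for s
            using e1(2)[OF inI(1) inI(3)[OF that]] close[OF that] by (simp add: e_def)
          show "\<bar>f'' (y s) - f'' (y ?u)\<bar> \<le> \<eta>" if "s \<in> {?u..?v}" for s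
            using e2(2)[OF inI(1) inI(3)[OF that]] close[OF that] by (simp add: e_def)
          show "\<bar>dW i\<bar> \<le> \<eta>"
            using e3(2)[OF inI(1,2)] close[of ?v] uv by (simp add: e_def dW_def)
          show "\<bar>y ?v - y ?u\<bar> \<le> \<eta>"
            using e4(2)[OF inI(1,2)] close[of ?v] uv by (simp add: e_def)
        qed (use uv \<beta> \<eta> C_def in auto)
        moreover have "integral {r..?u} (\<lambda>s. ?G (y s)) + integral {?u..?v} (\<lambda>s. ?G (y s)) = integral {r..?v} (\<lambda>s. ?G (y s))"
          by (rule Henstock_Kurzweil_Integration.integral_combine) (use uv iG in auto)
        then have "f (y ?v) - f (y ?u) - integral {?u..?v} (\<lambda>s. ?G (y s)) - \<beta> * f' 0 * dL i = J ?v - J ?u"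
          unfolding J_def dL_def by (simp add: algebra_simps)
        ultimately show ?thesis unfolding ph D_def by simp
      qed
      have tel: "J t - J r = (\<Sum>i<2^n. J (p n (Suc i)) - J (p n i))"
        by (subst sum_lessThan_telescope) (simp add: pr)
      have "\<bar>J t - J r - (\<Sum>i<2^n. f' (y (p n i)) * dW i + f'' (y (p n i)) / 2 * ((dW i)\<^sup>2 - h))\<bar>
        \<le> (\<Sum>i<2^n. \<eta> * D * (h + dL i + (dW i)\<^sup>2))"
        unfolding tel sum_subtractf[symmetric]
        by (rule order_trans[OF sum_abs], rule sum_mono, rule step) simp
      also have "\<dots> = \<eta> * D * ((\<Sum>i<(2::nat)^n. h) + (\<Sum>i<2^n. dL i) + (\<Sum>i<2^n. (dW i)\<^sup>2))"
        by (simp add: sum_distrib_left[symmetric] sum.distrib)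
      also have "(\<Sum>i<(2::nat)^n. h) = t - r" by (simp add: h_def)
      also have "(\<Sum>i<2^n. dL i) = L t - L r"
        unfolding dL_def by (subst sum_lessThan_telescope) (simp add: pr)
      also have "\<eta> * D * ((t - r) + (L t - L r) + (\<Sum>i<2^n. (dW i)\<^sup>2)) \<le> \<eta> * D * ((t - r) + (L t - L r) + Q)"
        using Q[of n] \<eta> D0 unfolding dW_def by (intro mult_left_mono add_left_mono) auto
      also have "\<dots> = \<eta> * T" by (simp add: T_def)
      finally show ?thesis unfolding dW_def h_def J_def by (simp add: algebra_simps)
    qed
    then show ?thesis by blast
  qed
  show ?thesis
  proof (rule LIMSEQ_I)
    fix e :: real assume e: "e > 0"
    define \<eta> where "\<eta> = min 1 (e / (2 * (T + 1)))"
    have \<eta>: "0 < \<eta>" "\<eta> \<le> 1" using e T0 by (auto simp: \<eta>_def)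
    have "\<eta> * T \<le> e / (2 * (T + 1)) * (T + 1)"
      using T0 e by (intro mult_mono) (auto simp: \<eta>_def)
    also have "\<dots> < e" using e T0 by (simp add: field_simps add_pos_nonneg)
    finally have "\<eta> * T < e" .
    moreover obtain N where N: "\<forall>n\<ge>N. \<bar>?J - ?S n\<bar> \<le> \<eta> * T" using main[OF \<eta>] by blast
    ultimately have "norm (?S n - ?J) < e" if "n \<ge> N" for n
      using that by (subst norm_minus_commute) (auto simp only: real_norm_def intro: le_less_trans)
    then show "\<exists>N. \<forall>n\<ge>N. norm (?S n - ?J) < e" by blast
  qed
qed

section \<open>The local time of a path\<close>

text \<open>
  A bump of total mass \<open>1\<close> for \<open>0 < a < b\<close>: constant on \<open>[-a, a]\<close>, zero outside \<open>[-b, b]\<close> and linear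
  in between. Written with positive parts, it has the antiderivative \<open>smooth_step\<close> in closed form.
\<close>

definition trapezoid :: "real \<Rightarrow> real \<Rightarrow> real \<Rightarrow> real" where
  "trapezoid a b x =
     (max 0 (x + b) - max 0 (x + a) - max 0 (x - a) + max 0 (x - b)) / ((b - a) * (a + b))"

definition smooth_step :: "real \<Rightarrow> real \<Rightarrow> real \<Rightarrow> real" where
  "smooth_step a b x =
     ((max 0 (x + b))\<^sup>2 - (max 0 (x + a))\<^sup>2 - (max 0 (x - a))\<^sup>2 + (max 0 (x - b))\<^sup>2)
       / (2 * ((b - a) * (a + b)))"

lemma has_real_derivative_max_0_squared:
  "((\<lambda>x. (max 0 x)\<^sup>2) has_real_derivative 2 * max 0 x) (at x)" for x :: real
proof (cases x "0::real" rule: linorder_cases)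
  case less
  have "((\<lambda>x::real. 0) has_real_derivative 0) (at x)" by simp
  then have "((\<lambda>x. (max 0 x)\<^sup>2) has_real_derivative 0) (at x)"
    by (rule has_field_derivative_transform_within_open[where S="{..<0}"]) (use less in auto)
  then show ?thesis using less by (simp add: max_def)
next
  case greater
  have "((\<lambda>x::real. x\<^sup>2) has_real_derivative 2 * x) (at x)" by (auto intro!: derivative_eq_intros)
  then have "((\<lambda>x. (max 0 x)\<^sup>2) has_real_derivative 2 * x) (at x)"
    by (rule has_field_derivative_transform_within_open[where S="{0<..}"]) (use greater in auto)
  then show ?thesis using greater by (simp add: max_def)
next
  case equal
  have "((\<lambda>h::real. (max 0 h)\<^sup>2 / h) \<longlongrightarrow> 0) (at 0)"
  proof (rule tendsto_0_le[where K=1 and f="\<lambda>h::real. h"])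
    show "\<forall>\<^sub>F h::real in at 0. norm ((max 0 h)\<^sup>2 / h) \<le> norm h * 1"
      by (rule always_eventually) (auto simp: max_def power2_eq_square)
  qed (rule tendsto_ident_at)
  then show ?thesis unfolding equal DERIV_def by simp
qed

lemma has_real_derivative_smooth_step:
  assumes "0 < a" "a < b"
  shows "(smooth_step a b has_real_derivative trapezoid a b x) (at x)"
proof -
  have *: "((\<lambda>x. (max 0 (x + c))\<^sup>2) has_real_derivative 2 * max 0 (x + c)) (at x)" for c x :: real
    using DERIV_shift[of "\<lambda>x. (max 0 x)\<^sup>2" "2 * max 0 (x + c)" x c] has_real_derivative_max_0_squared by blast
  have "((\<lambda>x. ((max 0 (x + b))\<^sup>2 - (max 0 (x + a))\<^sup>2 - (max 0 (x + - a))\<^sup>2 + (max 0 (x + - b))\<^sup>2)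
       / (2 * ((b - a) * (a + b)))) has_real_derivative
     (2 * max 0 (x + b) - 2 * max 0 (x + a) - 2 * max 0 (x + - a) + 2 * max 0 (x + - b)) / (2 * ((b - a) * (a + b)))) (at x)"
    by (intro DERIV_cdivide DERIV_add DERIV_diff *)
  moreover have "(2 * max 0 (x + b) - 2 * max 0 (x + a) - 2 * max 0 (x + - a) + 2 * max 0 (x + - b)) / (2 * ((b - a) * (a + b)))
    = (2 * (max 0 (x + b) - max 0 (x + a) - max 0 (x - a) + max 0 (x - b))) / (2 * ((b - a) * (a + b)))"
    by (simp add: algebra_simps)
  ultimately show ?thesis
    unfolding smooth_step_def[abs_def] trapezoid_def by (simp only: mult_divide_mult_cancel_left_if) simp
qed

lemma continuous_trapezoid: "continuous_on S (trapezoid a b)"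
proof (cases "(b - a) * (a + b) = 0")
  case True
  then show ?thesis by (simp only: trapezoid_def[abs_def] div_by_0 continuous_on_const)
next
  case False
  then show ?thesis unfolding trapezoid_def[abs_def] by (intro continuous_intros) simp
qed

lemma trapezoid_bounds:
  assumes "0 < a" "a < b"
  shows "0 \<le> trapezoid a b x" "trapezoid a b x \<le> indicator {-b..b} x / (a + b)"
    "indicator {-a..a} x / (a + b) \<le> trapezoid a b x"
proof -
  let ?N = "max 0 (x + b) - max 0 (x + a) - max 0 (x - a) + max 0 (x - b)"
  have N: "0 \<le> ?N" "?N \<le> (b - a) * indicator {-b..b} x" "(b - a) * indicator {-a..a} x \<le> ?N"
    using assms by (auto simp: max_def indicator_def)
  have pos: "0 < (b - a) * (a + b)" using assms by simp
  show "0 \<le> trapezoid a b x" unfolding trapezoid_def using N(1) pos by simp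
  have e: "c / (a + b) = ((b - a) * c) / ((b - a) * (a + b))" for c using assms by simp
  show "trapezoid a b x \<le> indicator {-b..b} x / (a + b)" unfolding trapezoid_def e
    by (rule divide_right_mono[OF N(2)]) (use pos in simp)
  show "indicator {-a..a} x / (a + b) \<le> trapezoid a b x" unfolding trapezoid_def e
    by (rule divide_right_mono[OF N(3)]) (use pos in simp)
qed

lemma smooth_step_values:
  assumes "0 < a" "a < b"
  shows "x \<le> -b \<Longrightarrow> smooth_step a b x = 0" "b \<le> x \<Longrightarrow> smooth_step a b x = 1"
    "smooth_step a b 0 = 1 / 2" "0 \<le> smooth_step a b x" "smooth_step a b x \<le> 1"
proof -
  have pos: "0 < (b - a) * (a + b)" using assms by simp
  show l: "smooth_step a b x = 0" if "x \<le> -b" for x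
    unfolding smooth_step_def using that assms by (simp add: max_def)
  show r: "smooth_step a b x = 1" if "b \<le> x" for x
  proof -
    have "(x + b)\<^sup>2 - (x + a)\<^sup>2 - (x - a)\<^sup>2 + (x - b)\<^sup>2 = 2 * ((b - a) * (a + b))"
      by (simp add: power2_eq_square algebra_simps)
    moreover have "max 0 (x + b) = x + b" "max 0 (x + a) = x + a" "max 0 (x - a) = x - a" "max 0 (x - b) = x - b"
      using that assms by auto
    ultimately show ?thesis unfolding smooth_step_def using assms by simp
  qed
  have "(b\<^sup>2 - a\<^sup>2) = (b - a) * (a + b)" by (simp add: power2_eq_square algebra_simps)
  then show "smooth_step a b 0 = 1 / 2" unfolding smooth_step_def using assms pos by (simp add: max_def)
  have mono: "smooth_step a b u \<le> smooth_step a b v" if "u \<le> v" for u v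
    by (rule DERIV_nonneg_imp_nondecreasing[OF that])
      (use has_real_derivative_smooth_step[OF assms] trapezoid_bounds(1)[OF assms] in blast)
  show "0 \<le> smooth_step a b x" using mono[of "min x (-b)" x] l[of "min x (-b)"] by simp
  show "smooth_step a b x \<le> 1" using mono[of x "max x b"] r[of "max x b"] by simp
qed

lemma closed_occupation_set:
  fixes y :: "real \<Rightarrow> real"
  assumes "continuous_on {0..} y"
  shows "closed {s \<in> {0..t}. \<bar>y s - a\<bar> \<le> \<epsilon>}"
proof -
  have "closed ({0..t} \<inter> (\<lambda>s. \<bar>y s - a\<bar>) -` {..\<epsilon>})"
    by (rule continuous_closed_preimage) (auto intro!: continuous_intros continuous_on_subset[OF assms])
  then show ?thesis by (simp add: vimage_def Int_def)
qed

lemma occupation_fmeasurable: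
  fixes y :: "real \<Rightarrow> real"
  assumes "continuous_on {0..} y"
  shows "{s \<in> {0..t}. \<bar>y s - a\<bar> \<le> \<epsilon>} \<in> fmeasurable lborel"
proof (rule fmeasurableI2[of "{0..t}"])
  show "{0..t} \<in> fmeasurable lborel" by (rule fmeasurableI) (auto simp: emeasure_lborel_Icc_eq)
qed (use closed_occupation_set[OF assms] in auto)

lemma local_time_mono:
  fixes y :: "real \<Rightarrow> real"
  assumes y: "continuous_on {0..} y" and uv: "u \<le> v"
    and L: "has_symmetric_local_time y u a l" "has_symmetric_local_time y v a l'"
  shows "l \<le> l'"
proof (rule tendsto_le[OF _ L(2)[unfolded has_symmetric_local_time_def] L(1)[unfolded has_symmetric_local_time_def]])
  show "\<forall>\<^sub>F \<epsilon> in at_right 0. 1 / (2 * \<epsilon>) * measure lborel {s \<in> {0..u}. \<bar>y s - a\<bar> \<le> \<epsilon>}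
      \<le> 1 / (2 * \<epsilon>) * measure lborel {s \<in> {0..v}. \<bar>y s - a\<bar> \<le> \<epsilon>}"
    using eventually_at_right_less[of 0]
  proof eventually_elim
    case (elim \<epsilon>)
    have "measure lborel {s \<in> {0..u}. \<bar>y s - a\<bar> \<le> \<epsilon>} \<le> measure lborel {s \<in> {0..v}. \<bar>y s - a\<bar> \<le> \<epsilon>}"
      by (rule measure_mono_fmeasurable[OF _ fmeasurableD[OF occupation_fmeasurable[OF y]] occupation_fmeasurable[OF y]])
         (use uv in auto)
    then show ?case using elim by (intro mult_left_mono) auto
  qed
qed simp

text \<open>
  By compactness the path keeps a positive distance from the level, so small neighbourhoods of the
  level collect no further occupation time.
\<close>

lemma local_time_constant_off_level:
  fixes y :: "real \<Rightarrow> real"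
  assumes y: "continuous_on {0..} y" and uv: "0 \<le> u" "u \<le> v"
    and L: "has_symmetric_local_time y u a l" "has_symmetric_local_time y v a l'"
    and off: "\<And>s. s \<in> {u..v} \<Longrightarrow> y s \<noteq> a"
  shows "l = l'"
proof -
  have "compact ((\<lambda>s. \<bar>y s - a\<bar>) ` {u..v})"
    by (intro compact_continuous_image continuous_intros continuous_on_subset[OF y]) (use uv in auto)
  moreover have "(\<lambda>s. \<bar>y s - a\<bar>) ` {u..v} \<noteq> {}" using uv by auto
  ultimately obtain s where s: "s \<in> {u..v}" "\<And>r. r \<in> {u..v} \<Longrightarrow> \<bar>y s - a\<bar> \<le> \<bar>y r - a\<bar>"
    using compact_attains_inf[of "(\<lambda>s. \<bar>y s - a\<bar>) ` {u..v}"] by auto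
  have pos: "0 < \<bar>y s - a\<bar>" using off[OF s(1)] by simp
  have "\<forall>\<^sub>F \<epsilon> in at_right 0. \<epsilon> < \<bar>y s - a\<bar>"
    using pos by (rule eventually_at_rightI[of 0 "\<bar>y s - a\<bar>", rotated]) auto
  then have "\<forall>\<^sub>F \<epsilon> in at_right 0. 1 / (2 * \<epsilon>) * measure lborel {s \<in> {0..u}. \<bar>y s - a\<bar> \<le> \<epsilon>}
      = 1 / (2 * \<epsilon>) * measure lborel {s \<in> {0..v}. \<bar>y s - a\<bar> \<le> \<epsilon>}"
  proof eventually_elim
    case (elim \<epsilon>)
    have "r \<le> u" if "0 \<le> r" "r \<le> v" "\<bar>y r - a\<bar> \<le> \<epsilon>" for r
      using s(2)[of r] elim that by (cases "r \<le> u") auto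
    then have "{s \<in> {0..u}. \<bar>y s - a\<bar> \<le> \<epsilon>} = {s \<in> {0..v}. \<bar>y s - a\<bar> \<le> \<epsilon>}" using uv by auto
    then show ?case by simp
  qed
  then have "((\<lambda>\<epsilon>. 1 / (2 * \<epsilon>) * measure lborel {s \<in> {0..v}. \<bar>y s - a\<bar> \<le> \<epsilon>}) \<longlongrightarrow> l) (at_right 0)"
    using L(1) unfolding has_symmetric_local_time_def by (rule tendsto_cong[THEN iffD1])
  then show ?thesis
    using L(2) unfolding has_symmetric_local_time_def by (intro tendsto_unique[OF trivial_limit_at_right_real])
qed

lemma integral_indicator_path:
  fixes y :: "real \<Rightarrow> real"
  assumes y: "continuous_on {0..} y"
  shows "integral {0..t} (\<lambda>s. indicator {-\<epsilon>..\<epsilon>} (y s)) = measure lborel {s \<in> {0..t}. \<bar>y s - 0\<bar> \<le> \<epsilon>}"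
proof -
  have si: "set_integrable lborel {0..t} (\<lambda>s. indicator {-\<epsilon>..\<epsilon>} (y s) :: real)"
    by (rule bounded_compose_integrable_on(2)[where C=1])
       (auto simp: indicator_def intro: continuous_on_subset[OF y])
  have "integral {0..t} (\<lambda>s. indicator {-\<epsilon>..\<epsilon>} (y s)) = (LBINT s:{0..t}. indicator {-\<epsilon>..\<epsilon>} (y s) :: real)"
    by (rule set_borel_integral_eq_integral(2)[OF si, symmetric])
  also have "\<dots> = (\<integral>s. indicator {s \<in> {0..t}. \<bar>y s - 0\<bar> \<le> \<epsilon>} s \<partial>lborel)"
    unfolding set_lebesgue_integral_def
    by (rule Bochner_Integration.integral_cong) (auto simp: indicator_def abs_le_iff)
  also have "\<dots> = measure lborel {s \<in> {0..t}. \<bar>y s - 0\<bar> \<le> \<epsilon>}" by simp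
  finally show ?thesis .
qed

text \<open>
  The trapezoids shrink to the origin, and the ratio of outer to inner width tends to \<open>1\<close>, so that the
  two indicators enclosing the trapezoid have the same normalised occupation limit.
\<close>

definition inner_width :: "nat \<Rightarrow> real" where "inner_width n = 1 / real (Suc n)"
definition outer_width :: "nat \<Rightarrow> real" where "outer_width n = inner_width n + (inner_width n)\<^sup>2"

lemma width_bounds: "0 < inner_width n" "inner_width n < outer_width n" "outer_width n \<le> 2"
proof -
  have "inner_width n \<le> 1" "0 < inner_width n" by (auto simp: inner_width_def)
  then show "0 < inner_width n" "inner_width n < outer_width n" "outer_width n \<le> 2"
    by (auto simp: outer_width_def power2_eq_square intro: order_trans[OF add_mono[OF _ mult_mono]])
qed

lemma width_limits:
  "inner_width \<longlonglongrightarrow> 0" "outer_width \<longlonglongrightarrow> 0"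
  "(\<lambda>n. 2 * inner_width n / (inner_width n + outer_width n)) \<longlonglongrightarrow> 1"
  "(\<lambda>n. 2 * outer_width n / (inner_width n + outer_width n)) \<longlonglongrightarrow> 1"
proof -
  show i: "inner_width \<longlonglongrightarrow> 0" unfolding inner_width_def[abs_def] by (rule LIMSEQ_Suc[OF lim_const_over_n])
  have "(\<lambda>n. inner_width n + (inner_width n)\<^sup>2) \<longlonglongrightarrow> 0 + 0\<^sup>2" by (intro tendsto_intros i)
  then show "outer_width \<longlonglongrightarrow> 0" by (simp add: outer_width_def[abs_def])
  have e0: "2 * outer_width n = inner_width n * (2 * (1 + inner_width n))"
    "inner_width n + outer_width n = inner_width n * (2 + inner_width n)" for n
    by (simp_all add: outer_width_def power2_eq_square algebra_simps)
  have e1: "2 * inner_width n / (inner_width n + outer_width n) = 2 / (2 + inner_width n)" for n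
    using width_bounds(1)[of n] unfolding e0(2) mult.commute[of 2 "inner_width n"]
    by (intro mult_divide_mult_cancel_left) simp
  have e2: "2 * outer_width n / (inner_width n + outer_width n) = 2 * (1 + inner_width n) / (2 + inner_width n)" for n
    using width_bounds(1)[of n] unfolding e0 by (intro mult_divide_mult_cancel_left) simp
  have "(\<lambda>n. 2 / (2 + inner_width n)) \<longlonglongrightarrow> 2 / (2 + 0)" by (intro tendsto_intros i) simp
  then show "(\<lambda>n. 2 * inner_width n / (inner_width n + outer_width n)) \<longlonglongrightarrow> 1" by (simp add: e1)
  have "(\<lambda>n. 2 * (1 + inner_width n) / (2 + inner_width n)) \<longlonglongrightarrow> 2 * (1 + 0) / (2 + 0)" by (intro tendsto_intros i) simp
  then show "(\<lambda>n. 2 * outer_width n / (inner_width n + outer_width n)) \<longlonglongrightarrow> 1" by (simp add: e2)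
qed

text \<open>
  The squeeze between the occupation times of \<open>[-a, a]\<close> and \<open>[-b, b]\<close>; the normalisation \<open>1 / (a + b)\<close>
  of the bump differs from \<open>1 / (2 a)\<close> and \<open>1 / (2 b)\<close> by factors tending to \<open>1\<close>. The second limit
  expresses that the path spends no time at the level.
\<close>

lemma integral_trapezoid_tendsto_local_time:
  fixes y :: "real \<Rightarrow> real"
  assumes y: "continuous_on {0..} y" and L: "has_symmetric_local_time y t 0 l"
  shows "(\<lambda>n. integral {0..t} (\<lambda>s. trapezoid (inner_width n) (outer_width n) (y s))) \<longlonglongrightarrow> l"
    and "(\<lambda>n. integral {0..t} (\<lambda>s. indicator {-outer_width n..outer_width n} (y s)) :: real) \<longlonglongrightarrow> 0"
proof -
  let ?a = inner_width and ?b = outer_width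
  define occ where "occ \<epsilon> = measure lborel {s \<in> {0..t}. \<bar>y s - 0\<bar> \<le> \<epsilon>}" for \<epsilon>
  have yt: "continuous_on {0..t} y" by (rule continuous_on_subset[OF y]) auto
  have ind: "integral {0..t} (\<lambda>s. indicator {-\<epsilon>..\<epsilon>} (y s)) = occ \<epsilon>" for \<epsilon>
    unfolding occ_def by (rule integral_indicator_path[OF y])
  have ii: "(\<lambda>s. indicator {-\<epsilon>..\<epsilon>} (y s) :: real) integrable_on {0..t}" for \<epsilon>
    by (rule bounded_compose_integrable_on(1)[where C=1]) (auto simp: indicator_def yt)
  have pos: "0 < ?a n" "?a n < ?b n" "0 < ?b n" "0 < ?a n + ?b n" for n
    using width_bounds[of n] by auto
  have occlim: "(\<lambda>n. 1 / (2 * w n) * occ (w n)) \<longlonglongrightarrow> l" if "w \<longlonglongrightarrow> 0" "\<And>n. 0 < w n" for w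
  proof -
    have "filterlim w (at_right 0) sequentially"
      using that by (intro tendsto_imp_filterlim_at_right) auto
    from filterlim_compose[OF L[unfolded has_symmetric_local_time_def] this] show ?thesis
      by (simp add: occ_def)
  qed
  have tb: "\<bar>trapezoid (?a n) (?b n) x\<bar> \<le> 1 / (?a n + ?b n)" for n x
  proof -
    have "indicator {-?b n..?b n} x / (?a n + ?b n) \<le> 1 / (?a n + ?b n)"
      using pos[of n] by (intro divide_right_mono) (auto simp: indicator_def)
    then show ?thesis using trapezoid_bounds[OF pos(1,2), of n x] by linarith
  qed
  have it: "(\<lambda>s. trapezoid (?a n) (?b n) (y s)) integrable_on {0..t}" for n
    by (rule bounded_compose_integrable_on(1)[OF _ tb yt])
       (rule borel_measurable_continuous_onI[OF continuous_trapezoid])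
  show "(\<lambda>n. integral {0..t} (\<lambda>s. trapezoid (?a n) (?b n) (y s))) \<longlonglongrightarrow> l"
  proof (rule tendsto_sandwich)
    have "(\<lambda>n. 1 / (2 * ?a n) * occ (?a n) * (2 * ?a n / (?a n + ?b n))) \<longlonglongrightarrow> l * 1"
      by (intro tendsto_mult occlim width_limits pos)
    moreover have "1 / (2 * ?a n) * occ (?a n) * (2 * ?a n / (?a n + ?b n)) = occ (?a n) / (?a n + ?b n)" for n
      using pos[of n] by simp
    ultimately show "(\<lambda>n. occ (?a n) / (?a n + ?b n)) \<longlonglongrightarrow> l" by (simp only: mult_1_right)
    have "(\<lambda>n. 1 / (2 * ?b n) * occ (?b n) * (2 * ?b n / (?a n + ?b n))) \<longlonglongrightarrow> l * 1"
      by (intro tendsto_mult occlim width_limits pos)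
    moreover have "1 / (2 * ?b n) * occ (?b n) * (2 * ?b n / (?a n + ?b n)) = occ (?b n) / (?a n + ?b n)" for n
      using pos[of n] by simp
    ultimately show "(\<lambda>n. occ (?b n) / (?a n + ?b n)) \<longlonglongrightarrow> l" by (simp only: mult_1_right)
    have "occ (?a n) / (?a n + ?b n) \<le> integral {0..t} (\<lambda>s. trapezoid (?a n) (?b n) (y s))" for n
      unfolding ind[symmetric] integral_divide[symmetric]
      by (rule integral_le[OF integrable_on_divide[OF ii] it]) (rule trapezoid_bounds(3)[OF pos(1,2)])
    then show "\<forall>\<^sub>F n in sequentially. occ (?a n) / (?a n + ?b n) \<le> integral {0..t} (\<lambda>s. trapezoid (?a n) (?b n) (y s))"
      by simp
    have "integral {0..t} (\<lambda>s. trapezoid (?a n) (?b n) (y s)) \<le> occ (?b n) / (?a n + ?b n)" for n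
      unfolding ind[symmetric] integral_divide[symmetric]
      by (rule integral_le[OF it integrable_on_divide[OF ii]]) (rule trapezoid_bounds(2)[OF pos(1,2)])
    then show "\<forall>\<^sub>F n in sequentially. integral {0..t} (\<lambda>s. trapezoid (?a n) (?b n) (y s)) \<le> occ (?b n) / (?a n + ?b n)"
      by simp
  qed
  have "(\<lambda>n. 1 / (2 * ?b n) * occ (?b n) * (2 * ?b n)) \<longlonglongrightarrow> l * (2 * 0)"
    by (intro tendsto_mult occlim width_limits pos tendsto_const)
  moreover have "1 / (2 * ?b n) * occ (?b n) * (2 * ?b n) = occ (?b n)" for n using pos[of n] by simp
  ultimately show "(\<lambda>n. integral {0..t} (\<lambda>s. indicator {-?b n..?b n} (y s)) :: real) \<longlonglongrightarrow> 0"
    by (simp only: ind mult_zero_right)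
qed

section \<open>The scale function and its smooth approximations\<close>

lemma abs_exp_minus_1_le: "\<bar>exp z - 1\<bar> \<le> \<bar>z\<bar> * exp \<bar>z\<bar>" for z :: real
proof (cases "0 \<le> z")
  case True
  have "(1 - z) * exp z \<le> exp (- z) * exp z"
    using exp_ge_add_one_self[of "- z"] by (intro mult_right_mono) auto
  then have "exp z - 1 \<le> z * exp z" by (simp add: exp_minus algebra_simps)
  then show ?thesis using True by simp
next
  case False
  have "1 - exp z \<le> - z" using exp_ge_add_one_self[of z] by linarith
  also have "\<dots> \<le> - z * exp (- z)" using False mult_left_mono[of 1 "exp (- z)" "- z"] by simp
  finally show ?thesis using False by simp
qed

lemma antiderivative_exists:
  fixes f :: "real \<Rightarrow> real"
  assumes "continuous_on UNIV f"
  shows "\<exists>F. F 0 = 0 \<and> (\<forall>x. (F has_real_derivative f x) (at x))"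
proof -
  have "isCont f x" for x using assms by (simp add: continuous_on_eq_continuous_at)
  then obtain F where F: "\<And>x. (F has_vector_derivative f x) (at x)"
    using einterval_antiderivative[of "-\<infinity>" "\<infinity>" f] by auto
  show ?thesis
    by (rule exI[of _ "\<lambda>x. F x - F 0"])
       (auto intro!: derivative_eq_intros F[unfolded has_real_derivative_iff_has_vector_derivative[symmetric]])
qed

text \<open>
  The mean value theorem on \<open>[0, b]\<close>; beyond \<open>b\<close> the function is constant.
\<close>

lemma abs_antiderivative_le:
  fixes g :: "real \<Rightarrow> real"
  assumes g0: "g 0 = 0" and d: "\<And>x. (g has_real_derivative g' x) (at x)"
    and C: "\<And>x. 0 \<le> x \<Longrightarrow> x \<le> b \<Longrightarrow> \<bar>g' x\<bar> \<le> C" and z: "\<And>x. b \<le> x \<Longrightarrow> g' x = 0" and b: "0 < b" and x: "0 \<le> x"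
  shows "\<bar>g x\<bar> \<le> C * b"
proof -
  have C0: "0 \<le> C" using C[of 0] b by simp
  have near: "\<bar>g v\<bar> \<le> C * b" if v: "0 \<le> v" "v \<le> b" for v
  proof (cases "v = 0")
    case True then show ?thesis using g0 C0 b by simp
  next
    case False
    then obtain w where "0 < w" "w < v" "g v - g 0 = (v - 0) * g' w"
      using MVT2[of 0 v g g'] d v by auto
    then have "\<bar>g v\<bar> = \<bar>g' w\<bar> * v" "\<bar>g' w\<bar> \<le> C" using g0 v C[of w] by (auto simp: abs_mult)
    then show ?thesis using v C0 by (auto intro!: mult_mono)
  qed
  show ?thesis
  proof (cases "x \<le> b")
    case True then show ?thesis using near x by simp
  next
    case False
    then obtain w where "b < w" "w < x" "g x - g b = (x - b) * g' w"
      using MVT2[of b x g g'] d by auto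
    then have "g x = g b" using z[of w] by simp
    then show ?thesis using near[of b] b by simp
  qed
qed

locale refracted_skew =
  fixes \<beta> \<mu>p \<mu>m :: real
  assumes \<beta>: "-1 < \<beta>" "\<beta> < 1" and \<mu>: "\<mu>p > 0" "\<mu>m < 0"
begin

text \<open>
  The two branches are normalised to vanish at \<open>0\<close>. Their slopes there, \<open>1 - \<beta>\<close> and \<open>1 + \<beta>\<close>, are in
  the ratio that the skew reflection demands and have mean \<open>1\<close>.
\<close>

definition scale_right :: "real \<Rightarrow> real" where "scale_right x = (1 - \<beta>) * (1 - exp (-2 * \<mu>p * x)) / (2 * \<mu>p)"
definition scale_left :: "real \<Rightarrow> real" where "scale_left x = (1 + \<beta>) * (1 - exp (-2 * \<mu>m * x)) / (2 * \<mu>m)"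
definition scale_function :: "real \<Rightarrow> real" where "scale_function x = (if x \<ge> 0 then scale_right x else scale_left x)"

definition dscale_right :: "real \<Rightarrow> real" where "dscale_right x = (1 - \<beta>) * exp (-2 * \<mu>p * x)"
definition dscale_left :: "real \<Rightarrow> real" where "dscale_left x = (1 + \<beta>) * exp (-2 * \<mu>m * x)"

lemma has_real_derivative_scale_parts:
  "(scale_right has_real_derivative dscale_right x) (at x)"
  "(scale_left has_real_derivative dscale_left x) (at x)"
  "(dscale_right has_real_derivative -2 * \<mu>p * dscale_right x) (at x)"
  "(dscale_left has_real_derivative -2 * \<mu>m * dscale_left x) (at x)"
  unfolding scale_right_def[abs_def] scale_left_def[abs_def] dscale_right_def[abs_def] dscale_left_def[abs_def]
  using \<mu> by (auto intro!: derivative_eq_intros simp: field_simps)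

abbreviation step :: "nat \<Rightarrow> real \<Rightarrow> real" where "step n \<equiv> smooth_step (inner_width n) (outer_width n)"
abbreviation kernel :: "nat \<Rightarrow> real \<Rightarrow> real" where "kernel n \<equiv> trapezoid (inner_width n) (outer_width n)"

text \<open>
  The slope is blended from the left branch to the right branch; the antiderivative \<open>smooth n\<close> is a
  \<open>C\<^sup>2\<close> approximation of the scale function, whose second derivative contains the bump
  \<open>kernel n\<close> times the jump of the slope.
\<close>

definition dsmooth :: "nat \<Rightarrow> real \<Rightarrow> real" where
  "dsmooth n x = dscale_left x * (1 - step n x) + dscale_right x * step n x"
definition ddsmooth :: "nat \<Rightarrow> real \<Rightarrow> real" where
  "ddsmooth n x = -2 * \<mu>m * dscale_left x * (1 - step n x) + -2 * \<mu>p * dscale_right x * step n x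
     + kernel n x * (dscale_right x - dscale_left x)"
definition smooth :: "nat \<Rightarrow> real \<Rightarrow> real" where
  "smooth n = (SOME F. F 0 = 0 \<and> (\<forall>x. (F has_real_derivative dsmooth n x) (at x)))"

lemma has_real_derivative_dsmooth: "(dsmooth n has_real_derivative ddsmooth n x) (at x)"
proof -
  have "(dsmooth n has_real_derivative
    (dscale_left x * (0 - kernel n x) + (-2 * \<mu>m * dscale_left x) * (1 - step n x))
    + (dscale_right x * kernel n x + (-2 * \<mu>p * dscale_right x) * step n x)) (at x)"
    unfolding dsmooth_def[abs_def]
    by (intro DERIV_add DERIV_mult' DERIV_diff DERIV_const has_real_derivative_scale_parts
        has_real_derivative_smooth_step width_bounds)
  then show ?thesis unfolding ddsmooth_def by (simp add: algebra_simps)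
qed

lemma smooth_0: "smooth n 0 = 0" and has_real_derivative_smooth: "(smooth n has_real_derivative dsmooth n x) (at x)"
proof -
  have "continuous_on UNIV (dsmooth n)"
    using has_real_derivative_dsmooth by (meson DERIV_continuous_on has_field_derivative_at_within)
  from someI_ex[OF antiderivative_exists[OF this]]
  show "smooth n 0 = 0" "(smooth n has_real_derivative dsmooth n x) (at x)" by (auto simp: smooth_def)
qed

lemma continuous_ddsmooth: "continuous_on UNIV (ddsmooth n)"
proof -
  have c: "continuous_on UNIV dscale_left" "continuous_on UNIV dscale_right" "continuous_on UNIV (step n)"
    using has_real_derivative_scale_parts(3,4) has_real_derivative_smooth_step[OF width_bounds(1,2)[of n]]
    by (meson DERIV_continuous_on has_field_derivative_at_within)+
  show ?thesis unfolding ddsmooth_def[abs_def]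
    by (intro continuous_intros c continuous_trapezoid)
qed

text \<open>
  The branches grow exponentially on the wrong side of \<open>0\<close>, but the blend uses them there only up to
  distance \<open>2\<close>, the largest outer width; this gives a bound that does not depend on \<open>n\<close>.
\<close>

definition slope_bound :: real where "slope_bound = (1 - \<beta>) * exp (4 * \<mu>p) + (1 + \<beta>) * exp (-4 * \<mu>m)"

lemma dscale_bounds:
  "0 \<le> dscale_right x" "0 \<le> dscale_left x"
  "-2 \<le> x \<Longrightarrow> dscale_right x \<le> (1 - \<beta>) * exp (4 * \<mu>p)" "x \<le> 2 \<Longrightarrow> dscale_left x \<le> (1 + \<beta>) * exp (-4 * \<mu>m)"
proof -
  show "0 \<le> dscale_right x" "0 \<le> dscale_left x" using \<beta> by (auto simp: dscale_right_def dscale_left_def)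
  show "dscale_right x \<le> (1 - \<beta>) * exp (4 * \<mu>p)" if "-2 \<le> x"
    using mult_left_mono[OF that, of \<mu>p] \<beta> \<mu> by (simp add: dscale_right_def)
  show "dscale_left x \<le> (1 + \<beta>) * exp (-4 * \<mu>m)" if "x \<le> 2"
    using mult_left_mono[OF that, of "-\<mu>m"] \<beta> \<mu> by (simp add: dscale_left_def)
qed

lemma slope_bound_pos: "0 < slope_bound"
proof -
  have "0 < (1 - \<beta>) * exp (4 * \<mu>p)" "0 < (1 + \<beta>) * exp (-4 * \<mu>m)" using \<beta> by simp_all
  then show ?thesis unfolding slope_bound_def by (rule add_pos_pos)
qed

lemma weighted_dscale_bounds:
  "0 \<le> dscale_right x * step n x" "dscale_right x * step n x \<le> (1 - \<beta>) * exp (4 * \<mu>p)"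
  "0 \<le> dscale_left x * (1 - step n x)" "dscale_left x * (1 - step n x) \<le> (1 + \<beta>) * exp (-4 * \<mu>m)"
proof -
  note w = width_bounds[of n]
  note s = smooth_step_values[OF w(1,2)]
  show "0 \<le> dscale_right x * step n x" "0 \<le> dscale_left x * (1 - step n x)"
    using s(4,5)[of x] dscale_bounds(1,2)[of x] by auto
  show "dscale_right x * step n x \<le> (1 - \<beta>) * exp (4 * \<mu>p)"
  proof (cases "-2 \<le> x")
    case True
    have "dscale_right x * step n x \<le> dscale_right x * 1"
      using s(5)[of x] dscale_bounds(1)[of x] by (intro mult_left_mono) auto
    then show ?thesis using dscale_bounds(3)[OF True] by simp
  next
    case False
    then have "step n x = 0" using w(3) by (intro s(1)) simp
    then show ?thesis using \<beta> by simp
  qed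
  show "dscale_left x * (1 - step n x) \<le> (1 + \<beta>) * exp (-4 * \<mu>m)"
  proof (cases "x \<le> 2")
    case True
    have "dscale_left x * (1 - step n x) \<le> dscale_left x * 1"
      using s(4)[of x] dscale_bounds(2)[of x] by (intro mult_left_mono) auto
    then show ?thesis using dscale_bounds(4)[OF True] by simp
  next
    case False
    then have "step n x = 1" using w(3) by (intro s(2)) simp
    then show ?thesis using \<beta> by simp
  qed
qed

lemma abs_dsmooth_le: "\<bar>dsmooth n x\<bar> \<le> slope_bound"
  using weighted_dscale_bounds[where x=x and n=n] unfolding dsmooth_def slope_bound_def by linarith

lemma abs_dscale_diff_le: "-2 \<le> x \<Longrightarrow> x \<le> 2 \<Longrightarrow> \<bar>dscale_right x - dscale_left x\<bar> \<le> slope_bound"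
  using dscale_bounds[of x] unfolding slope_bound_def by linarith

lemma bounded_ddsmooth: "\<exists>K. \<forall>x. \<bar>ddsmooth n x\<bar> \<le> K"
proof (intro exI allI)
  fix x
  note w = width_bounds[of n]
  note k = trapezoid_bounds[OF w(1,2), of x]
  let ?c = "1 / (inner_width n + outer_width n)"
  have c0: "0 \<le> ?c" using w by simp
  have "\<bar>kernel n x * (dscale_right x - dscale_left x)\<bar> \<le> ?c * slope_bound"
  proof (cases "\<bar>x\<bar> \<le> outer_width n")
    case True
    then have "\<bar>dscale_right x - dscale_left x\<bar> \<le> slope_bound" using w by (intro abs_dscale_diff_le) auto
    moreover have "\<bar>kernel n x\<bar> \<le> ?c" using k True by (simp add: indicator_def abs_le_iff)
    ultimately show ?thesis unfolding abs_mult using c0 by (intro mult_mono) auto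
  next
    case False
    then have "indicator {-outer_width n..outer_width n} x = (0 :: real)" by (auto simp: indicator_def)
    then have "kernel n x = 0" using k by simp
    then show ?thesis using c0 slope_bound_pos by simp
  qed
  moreover have "\<bar>-2 * \<mu>m * (dscale_left x * (1 - step n x))\<bar> \<le> -2 * \<mu>m * slope_bound"
  proof -
    have "\<bar>dscale_left x * (1 - step n x)\<bar> \<le> slope_bound"
      using weighted_dscale_bounds[where x=x and n=n] unfolding slope_bound_def by linarith
    from mult_left_mono[OF this, of "-2 * \<mu>m"] show ?thesis using \<mu> by (simp add: abs_mult)
  qed
  moreover have "\<bar>-2 * \<mu>p * (dscale_right x * step n x)\<bar> \<le> 2 * \<mu>p * slope_bound"
  proof -
    have "\<bar>dscale_right x * step n x\<bar> \<le> slope_bound"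
      using weighted_dscale_bounds[where x=x and n=n] unfolding slope_bound_def by linarith
    from mult_left_mono[OF this, of "2 * \<mu>p"] show ?thesis using \<mu> by (simp add: abs_mult)
  qed
  moreover have "ddsmooth n x = -2 * \<mu>m * (dscale_left x * (1 - step n x)) + -2 * \<mu>p * (dscale_right x * step n x)
     + kernel n x * (dscale_right x - dscale_left x)" unfolding ddsmooth_def by (simp add: mult.assoc)
  ultimately show "\<bar>ddsmooth n x\<bar> \<le> -2 * \<mu>m * slope_bound + 2 * \<mu>p * slope_bound + ?c * slope_bound" by linarith
qed

text \<open>
  On the right half-line the slopes of \<open>smooth n\<close> and of the scale function differ by
  \<open>(dscale_left - dscale_right) (1 - step n)\<close>, which is bounded and vanishes beyond the outer width; on
  the left half-line the same holds after reflection.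
\<close>

lemma smooth_tendsto_scale: "(\<lambda>n. smooth n x) \<longlonglongrightarrow> scale_function x"
proof -
  have bound: "\<bar>smooth n x - scale_function x\<bar> \<le> slope_bound * outer_width n" for n
  proof -
    note w = width_bounds[of n]
    note s = smooth_step_values[OF w(1,2)]
    have b0: "0 < outer_width n" using w by simp
    have bd: "\<bar>(dscale_left v - dscale_right v) * c\<bar> \<le> slope_bound"
      if "\<bar>v\<bar> \<le> outer_width n" "0 \<le> c" "c \<le> 1" for v c
    proof -
      have "\<bar>dscale_left v - dscale_right v\<bar> \<le> slope_bound"
        using that w abs_dscale_diff_le[of v] by (simp add: abs_minus_commute abs_le_iff)
      then have "\<bar>dscale_left v - dscale_right v\<bar> * \<bar>c\<bar> \<le> slope_bound * 1"
        using that slope_bound_pos by (intro mult_mono) auto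
      then show ?thesis by (simp add: abs_mult)
    qed
    show ?thesis
    proof (cases "0 \<le> x")
      case True
      have "\<bar>smooth n x - scale_right x\<bar> \<le> slope_bound * outer_width n"
      proof (rule abs_antiderivative_le[where g="\<lambda>x. smooth n x - scale_right x" and g'="\<lambda>v. (dscale_left v - dscale_right v) * (1 - step n v)"])
        show "((\<lambda>x. smooth n x - scale_right x) has_real_derivative (dscale_left v - dscale_right v) * (1 - step n v)) (at v)" for v
          by (rule DERIV_cong[OF DERIV_diff[OF has_real_derivative_smooth has_real_derivative_scale_parts(1)]])
             (simp add: dsmooth_def algebra_simps)
        show "\<bar>(dscale_left v - dscale_right v) * (1 - step n v)\<bar> \<le> slope_bound" if "0 \<le> v" "v \<le> outer_width n" for v
          using s(4,5)[of v] that by (intro bd) auto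
      qed (use True b0 s(2) smooth_0 scale_right_def in auto)
      then show ?thesis using True by (simp add: scale_function_def)
    next
      case False
      have "\<bar>smooth n (- (- x)) - scale_left (- (- x))\<bar> \<le> slope_bound * outer_width n"
      proof (rule abs_antiderivative_le[where g="\<lambda>x. smooth n (- x) - scale_left (- x)" and g'="\<lambda>v. (dscale_left (-v) - dscale_right (-v)) * step n (-v)"])
        show "((\<lambda>x. smooth n (- x) - scale_left (- x)) has_real_derivative (dscale_left (-v) - dscale_right (-v)) * step n (-v)) (at v)" for v
          by (rule DERIV_cong[OF DERIV_diff[OF DERIV_chain2[OF has_real_derivative_smooth] DERIV_chain2[OF has_real_derivative_scale_parts(2)]]])
             (auto intro!: derivative_eq_intros simp: dsmooth_def algebra_simps)
        show "\<bar>(dscale_left (-v) - dscale_right (-v)) * step n (-v)\<bar> \<le> slope_bound" if "0 \<le> v" "v \<le> outer_width n" for v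
          using s(4,5)[of "-v"] that by (intro bd) auto
      qed (use False b0 s(1) smooth_0 scale_left_def in auto)
      then show ?thesis using False by (simp add: scale_function_def)
    qed
  qed
  have "(\<lambda>n. slope_bound * outer_width n) \<longlonglongrightarrow> slope_bound * 0" by (intro tendsto_intros width_limits)
  then have "(\<lambda>n. smooth n x - scale_function x) \<longlonglongrightarrow> 0"
    by (intro Lim_null_comparison[of "\<lambda>n. smooth n x - scale_function x" "\<lambda>n. slope_bound * outer_width n"]) (use bound in auto)
  then show ?thesis by (simp add: LIM_zero_iff)
qed

definition smooth_generator :: "nat \<Rightarrow> real \<Rightarrow> real" where
  "smooth_generator n x = dsmooth n x * refracted_drift \<mu>p \<mu>m x + ddsmooth n x / 2"

text \<open>
  On each half-line the branch that belongs to it is annihilated by the generator. What remains is the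
  other branch, present only within the outer width, and the bump times half the difference of the
  slopes; at \<open>0\<close> that half difference is \<open>-\<beta>\<close>, and within the outer width it deviates from \<open>-\<beta>\<close> by a
  multiple of the width.
\<close>

lemma smooth_generator_bound:
  "\<bar>smooth_generator n x + \<beta> * kernel n x\<bar>
    \<le> (\<mu>p - \<mu>m) * slope_bound * indicator {-outer_width n..outer_width n} x
      + (\<mu>p - \<mu>m) * slope_bound * outer_width n * kernel n x"
proof -
  note w = width_bounds[of n]
  note s = smooth_step_values[OF w(1,2)]
  note k = trapezoid_bounds[OF w(1,2), of x]
  define P where "P = dscale_right x * step n x"
  define Q where "Q = dscale_left x * (1 - step n x)"
  define A where "A = (\<mu>p - \<mu>m) * slope_bound"
  define R where "R = (dscale_right x - dscale_left x) / 2 + \<beta>"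
  have PQ: "0 \<le> P" "0 \<le> Q" "P + Q \<le> slope_bound"
    using weighted_dscale_bounds[where x=x and n=n] unfolding P_def Q_def slope_bound_def by linarith+
  define T where "T = (if x > 0 then (\<mu>p - \<mu>m) * Q else if x < 0 then (\<mu>m - \<mu>p) * P else - \<mu>m * Q - \<mu>p * P)"
  have G: "smooth_generator n x + \<beta> * kernel n x = T + kernel n x * R"
    unfolding smooth_generator_def dsmooth_def ddsmooth_def refracted_drift_def T_def P_def Q_def R_def
    by (simp add: algebra_simps add_divide_distrib diff_divide_distrib)
  have T: "\<bar>T\<bar> \<le> A"
  proof -
    have 1: "(\<mu>p - \<mu>m) * Q \<le> A" "(\<mu>p - \<mu>m) * P \<le> A"
      unfolding A_def using PQ \<mu> by (auto intro!: mult_left_mono)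
    have 2: "0 \<le> (\<mu>p - \<mu>m) * Q" "0 \<le> (\<mu>p - \<mu>m) * P" using PQ \<mu> by auto
    have 3: "\<bar>- \<mu>m * Q - \<mu>p * P\<bar> \<le> A"
    proof -
      have "0 \<le> \<mu>p * P" "0 \<le> - \<mu>m * Q" "0 \<le> \<mu>p * Q" "0 \<le> - \<mu>m * P" using PQ \<mu> by (auto simp: mult_nonpos_nonneg)
      moreover have "(\<mu>p - \<mu>m) * (P + Q) \<le> A" unfolding A_def using PQ \<mu> by (intro mult_left_mono) auto
      ultimately show ?thesis by (simp add: abs_le_iff algebra_simps)
    qed
    have 4: "(\<mu>m - \<mu>p) * P = - ((\<mu>p - \<mu>m) * P)" by (simp add: algebra_simps)
    show ?thesis unfolding T_def 4 using 1 2 3 by auto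
  qed
  show ?thesis
  proof (cases "\<bar>x\<bar> \<le> outer_width n")
    case True
    have x2: "-2 \<le> x" "x \<le> 2" using True w by auto
    have e1: "\<bar>dscale_right x - (1 - \<beta>)\<bar> \<le> 2 * \<mu>p * \<bar>x\<bar> * ((1 - \<beta>) * exp (4 * \<mu>p))"
    proof -
      have "\<bar>exp (-2 * \<mu>p * x) - 1\<bar> \<le> \<bar>-2 * \<mu>p * x\<bar> * exp \<bar>-2 * \<mu>p * x\<bar>" by (rule abs_exp_minus_1_le)
      also have "\<bar>-2 * \<mu>p * x\<bar> = 2 * \<mu>p * \<bar>x\<bar>" using \<mu> by (simp add: abs_mult)
      also have "2 * \<mu>p * \<bar>x\<bar> * exp (2 * \<mu>p * \<bar>x\<bar>) \<le> 2 * \<mu>p * \<bar>x\<bar> * exp (4 * \<mu>p)"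
        using \<mu> x2 by (intro mult_left_mono) auto
      finally have "(1 - \<beta>) * \<bar>exp (-2 * \<mu>p * x) - 1\<bar> \<le> (1 - \<beta>) * (2 * \<mu>p * \<bar>x\<bar> * exp (4 * \<mu>p))"
        using \<beta> by (intro mult_left_mono) auto
      moreover have "\<bar>dscale_right x - (1 - \<beta>)\<bar> = (1 - \<beta>) * \<bar>exp (-2 * \<mu>p * x) - 1\<bar>"
      proof -
        have eq: "dscale_right x - (1 - \<beta>) = (1 - \<beta>) * (exp (-2 * \<mu>p * x) - 1)"
          unfolding dscale_right_def by (simp add: algebra_simps)
        show ?thesis unfolding eq abs_mult using \<beta> by simp
      qed
      ultimately show ?thesis by (simp add: algebra_simps)
    qed
    have e2: "\<bar>dscale_left x - (1 + \<beta>)\<bar> \<le> -2 * \<mu>m * \<bar>x\<bar> * ((1 + \<beta>) * exp (-4 * \<mu>m))"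
    proof -
      have "\<bar>exp (-2 * \<mu>m * x) - 1\<bar> \<le> \<bar>-2 * \<mu>m * x\<bar> * exp \<bar>-2 * \<mu>m * x\<bar>" by (rule abs_exp_minus_1_le)
      also have "\<bar>-2 * \<mu>m * x\<bar> = -2 * \<mu>m * \<bar>x\<bar>" using \<mu> by (simp add: abs_mult)
      also have "-2 * \<mu>m * \<bar>x\<bar> * exp (-2 * \<mu>m * \<bar>x\<bar>) \<le> -2 * \<mu>m * \<bar>x\<bar> * exp (-4 * \<mu>m)"
      proof (intro mult_left_mono)
        show "exp (-2 * \<mu>m * \<bar>x\<bar>) \<le> exp (-4 * \<mu>m)"
          using mult_left_mono[of "\<bar>x\<bar>" 2 "-2 * \<mu>m"] \<mu> x2 by simp
      qed (use \<mu> in \<open>simp add: mult_nonpos_nonneg\<close>)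
      finally have "(1 + \<beta>) * \<bar>exp (-2 * \<mu>m * x) - 1\<bar> \<le> (1 + \<beta>) * (-2 * \<mu>m * \<bar>x\<bar> * exp (-4 * \<mu>m))"
        using \<beta> by (intro mult_left_mono) auto
      moreover have "\<bar>dscale_left x - (1 + \<beta>)\<bar> = (1 + \<beta>) * \<bar>exp (-2 * \<mu>m * x) - 1\<bar>"
      proof -
        have eq: "dscale_left x - (1 + \<beta>) = (1 + \<beta>) * (exp (-2 * \<mu>m * x) - 1)"
          unfolding dscale_left_def by (simp add: algebra_simps)
        show ?thesis unfolding eq abs_mult using \<beta> by simp
      qed
      ultimately show ?thesis by (simp add: algebra_simps)
    qed
    have "\<bar>2 * R\<bar> \<le> 2 * \<mu>p * \<bar>x\<bar> * ((1 - \<beta>) * exp (4 * \<mu>p)) + -2 * \<mu>m * \<bar>x\<bar> * ((1 + \<beta>) * exp (-4 * \<mu>m))"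
    proof -
      have "2 * R = (dscale_right x - (1 - \<beta>)) - (dscale_left x - (1 + \<beta>))" unfolding R_def by (simp add: field_simps)
      then show ?thesis using e1 e2 by linarith
    qed
    also have "\<dots> \<le> 2 * \<mu>p * \<bar>x\<bar> * slope_bound + -2 * \<mu>m * \<bar>x\<bar> * slope_bound"
      unfolding slope_bound_def using \<mu> \<beta> by (intro add_mono mult_left_mono) (auto simp: mult_nonpos_nonneg)
    also have "\<dots> = 2 * (A * \<bar>x\<bar>)" unfolding A_def by (simp add: algebra_simps)
    also have "\<dots> \<le> 2 * (A * outer_width n)"
      using True \<mu> slope_bound_pos unfolding A_def by (intro mult_left_mono) auto
    finally have "\<bar>R\<bar> \<le> A * outer_width n" by simp
    then have "\<bar>kernel n x * R\<bar> \<le> A * outer_width n * kernel n x"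
      unfolding abs_mult using k(1) mult_left_mono[of "\<bar>R\<bar>" "A * outer_width n" "kernel n x"] by (simp add: mult.commute)
    then have "\<bar>T + kernel n x * R\<bar> \<le> A + A * outer_width n * kernel n x" using T by linarith
    then show ?thesis unfolding G using True by (simp add: A_def abs_le_iff)
  next
    case False
    then have i0: "indicator {-outer_width n..outer_width n} x = (0 :: real)" by (auto simp: indicator_def)
    then have "kernel n x = 0" using k by simp
    moreover have "T = 0"
      using False s(1)[of x] s(2)[of x] w unfolding T_def P_def Q_def by auto
    ultimately show ?thesis unfolding G i0 by simp
  qed
qed

lemma bounded_smooth_generator: "\<exists>K. \<forall>x. \<bar>smooth_generator n x\<bar> \<le> K"
proof -
  obtain K where K: "\<And>x. \<bar>ddsmooth n x\<bar> \<le> K" using bounded_ddsmooth by blast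
  have "\<bar>smooth_generator n x\<bar> \<le> slope_bound * (\<bar>\<mu>p\<bar> + \<bar>\<mu>m\<bar>) + K" for x
  proof -
    have "\<bar>dsmooth n x * refracted_drift \<mu>p \<mu>m x\<bar> \<le> slope_bound * (\<bar>\<mu>p\<bar> + \<bar>\<mu>m\<bar>)"
      unfolding abs_mult using abs_dsmooth_le abs_refracted_drift_le slope_bound_pos by (intro mult_mono) auto
    then show ?thesis unfolding smooth_generator_def using K[of x] by linarith
  qed
  then show ?thesis by blast
qed

lemma smooth_generator_measurable [measurable]: "smooth_generator n \<in> borel_measurable borel"
proof -
  have "continuous_on UNIV (dsmooth n)"
    using has_real_derivative_dsmooth by (meson DERIV_continuous_on has_field_derivative_at_within)
  then have [measurable]: "dsmooth n \<in> borel_measurable borel" "ddsmooth n \<in> borel_measurable borel"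
    using continuous_ddsmooth by (auto intro!: borel_measurable_continuous_onI)
  show ?thesis unfolding smooth_generator_def[abs_def] by measurable
qed

text \<open>
  In \<open>smooth_generator_bound\<close> the first error term integrates to a vanishing occupation time and the
  second one to a vanishing multiple of a convergent integral.
\<close>

lemma integral_smooth_generator_tendsto:
  fixes y :: "real \<Rightarrow> real"
  assumes y: "continuous_on {0..} y" and L: "has_symmetric_local_time y t 0 l"
  shows "(\<lambda>n. integral {0..t} (\<lambda>s. smooth_generator n (y s))) \<longlonglongrightarrow> - \<beta> * l"
proof -
  define A where "A = (\<mu>p - \<mu>m) * slope_bound"
  note lim = integral_trapezoid_tendsto_local_time[OF y L]
  have yt: "continuous_on {0..t} y" by (rule continuous_on_subset[OF y]) auto
  have ik: "(\<lambda>s. kernel n (y s)) integrable_on {0..t}" for n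
    by (intro integrable_continuous_real continuous_on_compose2[OF continuous_trapezoid yt]) auto
  have ii: "(\<lambda>s. indicator {-\<epsilon>..\<epsilon>} (y s) :: real) integrable_on {0..t}" for \<epsilon>
    by (rule bounded_compose_integrable_on(1)[where C=1]) (auto simp: indicator_def yt)
  have ig: "(\<lambda>s. smooth_generator n (y s)) integrable_on {0..t}" for n
    using bounded_smooth_generator[of n] bounded_compose_integrable_on(1)[OF smooth_generator_measurable _ yt] by blast
  let ?K = "\<lambda>n. integral {0..t} (\<lambda>s. kernel n (y s))"
  let ?I = "\<lambda>n. integral {0..t} (\<lambda>s. indicator {-outer_width n..outer_width n} (y s)) :: real"
  let ?G = "\<lambda>n. integral {0..t} (\<lambda>s. smooth_generator n (y s))"
  have "norm (?G n + \<beta> * ?K n) \<le> A * ?I n + A * outer_width n * ?K n" for n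
  proof -
    have i1: "(\<lambda>s. smooth_generator n (y s) + \<beta> * kernel n (y s)) integrable_on {0..t}"
      by (rule integrable_add[OF ig integrable_on_mult_right[OF ik]])
    have i2: "(\<lambda>s. A * indicator {-outer_width n..outer_width n} (y s)) integrable_on {0..t}"
      by (rule integrable_on_mult_right[OF ii])
    have i3: "(\<lambda>s. A * outer_width n * kernel n (y s)) integrable_on {0..t}"
      by (rule integrable_on_mult_right[OF ik])
    have i4: "(\<lambda>s. A * indicator {-outer_width n..outer_width n} (y s) + A * outer_width n * kernel n (y s)) integrable_on {0..t}"
      by (rule integrable_add[OF i2 i3])
    have pt: "norm (smooth_generator n (y s) + \<beta> * kernel n (y s))
        \<le> A * indicator {-outer_width n..outer_width n} (y s) + A * outer_width n * kernel n (y s)" for s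
      unfolding A_def real_norm_def by (rule smooth_generator_bound)
    have eq: "?G n + \<beta> * ?K n = integral {0..t} (\<lambda>s. smooth_generator n (y s) + \<beta> * kernel n (y s))"
      by (subst integral_add[OF ig integrable_on_mult_right[OF ik]]) simp
    have "norm (?G n + \<beta> * ?K n) \<le> integral {0..t} (\<lambda>s. A * indicator {-outer_width n..outer_width n} (y s) + A * outer_width n * kernel n (y s))"
      unfolding eq by (rule integral_norm_bound_integral[OF i1 i4 pt])
    also have "\<dots> = integral {0..t} (\<lambda>s. A * indicator {-outer_width n..outer_width n} (y s))
        + integral {0..t} (\<lambda>s. A * outer_width n * kernel n (y s))"
      by (rule integral_add[OF i2 i3])
    also have "\<dots> = A * ?I n + A * outer_width n * ?K n"
      unfolding integral_mult_right by (rule refl)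
    finally show ?thesis .
  qed
  moreover have "(\<lambda>n. A * ?I n + A * outer_width n * ?K n) \<longlonglongrightarrow> A * 0 + A * 0 * l"
    by (intro tendsto_intros lim width_limits)
  ultimately have "(\<lambda>n. ?G n + \<beta> * ?K n) \<longlonglongrightarrow> 0"
    by (intro Lim_null_comparison[of "\<lambda>n. ?G n + \<beta> * ?K n" "\<lambda>n. A * ?I n + A * outer_width n * ?K n"]) auto
  from tendsto_diff[OF this tendsto_mult[OF tendsto_const[of \<beta>] lim(1)]]
  show ?thesis by simp
qed

text \<open>
  The slope of \<open>smooth n\<close> at \<open>0\<close> is the mean \<open>1\<close> of the two branches, so the skew term is \<open>\<beta>\<close> times the
  local time, which cancels the limit of the integrated generators.
\<close>

lemma smooth_ito_limit:
  fixes y :: "real \<Rightarrow> real"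
  assumes y: "continuous_on {0..} y" and rt: "0 \<le> r" "r \<le> t"
    and L: "has_symmetric_local_time y r 0 l" "has_symmetric_local_time y t 0 l'"
  shows "(\<lambda>n. smooth n (y t) - smooth n (y r)
      - integral {r..t} (\<lambda>s. dsmooth n (y s) * refracted_drift \<mu>p \<mu>m (y s) + ddsmooth n (y s) / 2)
      - \<beta> * dsmooth n 0 * (l' - l)) \<longlonglongrightarrow> scale_function (y t) - scale_function (y r)"
proof -
  have ig: "(\<lambda>s. smooth_generator n (y s)) integrable_on {0..t}" for n
    using bounded_smooth_generator[of n]
      bounded_compose_integrable_on(1)[OF smooth_generator_measurable _ continuous_on_subset[OF y], of n _ 0 t] by auto
  have sub: "integral {r..t} (\<lambda>s. smooth_generator n (y s)) =
    integral {0..t} (\<lambda>s. smooth_generator n (y s)) - integral {0..r} (\<lambda>s. smooth_generator n (y s))" for n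
    using Henstock_Kurzweil_Integration.integral_combine[OF rt ig, of n] by linarith
  have d0: "dsmooth n 0 = 1" for n
    using smooth_step_values(3)[OF width_bounds(1,2)[of n]] by (simp add: dsmooth_def dscale_left_def dscale_right_def field_simps)
  have "(\<lambda>n. smooth n (y t) - smooth n (y r)
      - (integral {0..t} (\<lambda>s. smooth_generator n (y s)) - integral {0..r} (\<lambda>s. smooth_generator n (y s)))
      - \<beta> * (l' - l)) \<longlonglongrightarrow> scale_function (y t) - scale_function (y r) - (- \<beta> * l' - - \<beta> * l) - \<beta> * (l' - l)"
    by (intro tendsto_intros smooth_tendsto_scale integral_smooth_generator_tendsto[OF y] L)
  moreover have "scale_function (y t) - scale_function (y r) - (- \<beta> * l' - - \<beta> * l) - \<beta> * (l' - l) = scale_function (y t) - scale_function (y r)"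
    by (simp add: algebra_simps)
  ultimately show ?thesis unfolding d0 sub[symmetric] mult_1_right unfolding smooth_generator_def by metis
qed

end

section \<open>The scale function of the process is a martingale\<close>

lemma bm_increment_moments:
  assumes bm: "standard_brownian_motion M B" and st: "0 \<le> s" "s < t"
  shows "integrable M (\<lambda>\<omega>. (B t \<omega> - B s \<omega>) ^ k)"
    and "(\<integral>\<omega>. B t \<omega> - B s \<omega> \<partial>M) = 0"
    and "(\<integral>\<omega>. (B t \<omega> - B s \<omega>)\<^sup>2 \<partial>M) = t - s"
    and "(\<integral>\<omega>. (B t \<omega> - B s \<omega>) ^ 4 \<partial>M) = 3 * (t - s)\<^sup>2"
proof -
  have D: "distributed M lborel (\<lambda>\<omega>. B t \<omega> - B s \<omega>) (normal_density 0 (sqrt (t - s)))"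
    using bm st by (simp add: standard_brownian_motion_def)
  have pos: "0 < sqrt (t - s)" using st by simp
  have int: "integrable M (\<lambda>\<omega>. (B t \<omega> - B s \<omega>) ^ k)" for k
    using distributed_integrable[OF D, of "\<lambda>x. x ^ k"] integrable_normal_moment[OF pos, of 0 k] by simp
  then show "integrable M (\<lambda>\<omega>. (B t \<omega> - B s \<omega>) ^ k)" .
  have mom: "(\<integral>\<omega>. (B t \<omega> - B s \<omega>) ^ k \<partial>M) = (\<integral>x. normal_density 0 (sqrt (t - s)) x * x ^ k \<partial>lborel)" for k
    using distributed_integral[OF D, of "\<lambda>x. x ^ k"] by simp
  have 1: "(\<integral>x. normal_density 0 (sqrt (t - s)) x * x ^ 1 \<partial>lborel) = 0"
    using integral_normal_moment_odd[OF pos, of 0 0] by simp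
  have 2: "(\<integral>x. normal_density 0 (sqrt (t - s)) x * x ^ 2 \<partial>lborel) = t - s"
    using integral_normal_moment_even[OF pos, of 0 1] st by (simp add: fact_numeral)
  have 4: "(\<integral>x. normal_density 0 (sqrt (t - s)) x * x ^ 4 \<partial>lborel) = 3 * (t - s)\<^sup>2"
    using integral_normal_moment_even[OF pos, of 0 2] st by (simp add: fact_numeral power2_eq_square)
  show "(\<integral>\<omega>. B t \<omega> - B s \<omega> \<partial>M) = 0" using mom[of 1] 1 by simp
  show "(\<integral>\<omega>. (B t \<omega> - B s \<omega>)\<^sup>2 \<partial>M) = t - s" using mom[of 2] 2 by simp
  show "(\<integral>\<omega>. (B t \<omega> - B s \<omega>) ^ 4 \<partial>M) = 3 * (t - s)\<^sup>2" using mom[of 4] 4 by simp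
qed

locale refracted_skew_bm = refracted_skew \<beta> \<mu>p \<mu>m + prob_space M
  for \<beta> \<mu>p \<mu>m :: real and M :: "'a measure" +
  fixes B X :: "real \<Rightarrow> 'a \<Rightarrow> real" and x :: real
  assumes solution: "refracted_skew_brownian_motion M B \<beta> \<mu>p \<mu>m 0 x X"
begin

abbreviation \<F> :: "real \<Rightarrow> 'a measure" where "\<F> \<equiv> augmented_filtration M B"

lemma bm: "standard_brownian_motion M B"
  using solution by (simp add: refracted_skew_brownian_motion_def)

lemma sets_\<F>: "sets (\<F> t) \<subseteq> events"
  by (rule sets_augmented_filtration_subset[OF bm])

lemma X_adapted: "0 \<le> t \<Longrightarrow> X t \<in> borel_measurable (\<F> t)"
  using solution by (simp add: refracted_skew_brownian_motion_def)

lemma \<F>_measurable: "f \<in> borel_measurable (\<F> t) \<Longrightarrow> f \<in> borel_measurable M"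
  by (rule measurable_augmented_filtration_imp[OF bm])

lemma X_measurable: "0 \<le> t \<Longrightarrow> X t \<in> borel_measurable M"
  by (rule \<F>_measurable[OF X_adapted])

lemma X_continuous: "\<omega> \<in> space M \<Longrightarrow> continuous_on {0..} (\<lambda>t. X t \<omega>)"
  using solution by (simp add: refracted_skew_brownian_motion_def continuous_process_def)

lemma B_continuous: "\<omega> \<in> space M \<Longrightarrow> continuous_on {0..} (\<lambda>t. B t \<omega>)"
  using bm by (simp add: standard_brownian_motion_def continuous_process_def)

definition local_time :: "'a \<Rightarrow> real \<Rightarrow> real" where
  "local_time \<omega> t = (THE l. has_symmetric_local_time (\<lambda>s. X s \<omega>) t 0 l)"

lemma local_time_eq:
  assumes "has_symmetric_local_time (\<lambda>s. X s \<omega>) t 0 l"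
  shows "local_time \<omega> t = l"
  unfolding local_time_def
proof (rule the_equality)
  show "has_symmetric_local_time (\<lambda>s. X s \<omega>) t 0 l" by (rule assms)
  fix l' assume "has_symmetric_local_time (\<lambda>s. X s \<omega>) t 0 l'"
  with assms show "l' = l" unfolding has_symmetric_local_time_def
    by (intro tendsto_unique[OF trivial_limit_at_right_real])
qed

lemma drift_integral:
  fixes y :: "real \<Rightarrow> real"
  assumes y: "continuous_on {0..} y"
  shows "\<mu>p * (LBINT s:{0..t}. indicator {0<..} (y s)) + \<mu>m * (LBINT s:{0..t}. indicator {..<0} (y s))
    = integral {0..t} (\<lambda>s. refracted_drift \<mu>p \<mu>m (y s))"
proof -
  have yt: "continuous_on {0..t} y" by (rule continuous_on_subset[OF y]) auto
  have si: "set_integrable lborel {0..t} (\<lambda>s. indicator A (y s) :: real)" if "A \<in> sets borel" for A :: "real set"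
  proof (rule bounded_compose_integrable_on(2)[where G="indicator A" and y=y and C=1])
    show "(indicator A :: real \<Rightarrow> real) \<in> borel_measurable borel" using that by simp
    show "\<bar>indicator A z :: real\<bar> \<le> 1" for z by (simp add: indicator_def)
  qed (rule yt)
  have ii: "(\<lambda>s. indicator A (y s) :: real) integrable_on {0..t}" if "A \<in> sets borel" for A :: "real set"
    using set_borel_integral_eq_integral(1)[OF si[OF that]] .
  have d: "refracted_drift \<mu>p \<mu>m z = \<mu>p * indicator {0<..} z + \<mu>m * indicator {..<0} z" for z
    by (auto simp: refracted_drift_def)
  have "integral {0..t} (\<lambda>s. refracted_drift \<mu>p \<mu>m (y s)) =
     \<mu>p * integral {0..t} (\<lambda>s. indicator {0<..} (y s)) + \<mu>m * integral {0..t} (\<lambda>s. indicator {..<0} (y s))"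
    unfolding d by (subst integral_add[OF integrable_on_mult_right[OF ii] integrable_on_mult_right[OF ii]]) auto
  then show ?thesis using set_borel_integral_eq_integral(2)[OF si] by simp
qed

text \<open>
  The almost sure properties of a single path from which all pathwise arguments start.
\<close>

definition good_path :: "'a \<Rightarrow> bool" where
  "good_path \<omega> \<longleftrightarrow> \<omega> \<in> space M \<and> X 0 \<omega> = x \<and> (\<forall>t\<ge>0. has_symmetric_local_time (\<lambda>s. X s \<omega>) t 0 (local_time \<omega> t) \<and>
     X t \<omega> = X 0 \<omega> + B t \<omega> + \<beta> * local_time \<omega> t + integral {0..t} (\<lambda>s. refracted_drift \<mu>p \<mu>m (X s \<omega>)))"

lemma AE_good_path: "AE \<omega> in M. good_path \<omega>"
proof -
  have "AE \<omega> in M. \<forall>t\<ge>0. \<exists>l. has_symmetric_local_time (\<lambda>s. X s \<omega>) t 0 l \<and>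
        X t \<omega> = X 0 \<omega> + B t \<omega> + \<beta> * l
          + \<mu>p * (LBINT s:{0..t}. indicator {0<..} (X s \<omega>))
          + \<mu>m * (LBINT s:{0..t}. indicator {..<0} (X s \<omega>))"
    "AE \<omega> in M. X 0 \<omega> = x"
    using solution by (simp_all add: refracted_skew_brownian_motion_def)
  with AE_space show ?thesis
  proof eventually_elim
    case (elim \<omega>)
    show ?case unfolding good_path_def
    proof (intro conjI allI impI)
      fix t :: real assume t: "0 \<le> t"
      from elim(2) t obtain l where l: "has_symmetric_local_time (\<lambda>s. X s \<omega>) t 0 l"
        and e: "X t \<omega> = X 0 \<omega> + B t \<omega> + \<beta> * l
          + \<mu>p * (LBINT s:{0..t}. indicator {0<..} (X s \<omega>))
          + \<mu>m * (LBINT s:{0..t}. indicator {..<0} (X s \<omega>))" by blast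
      show "has_symmetric_local_time (\<lambda>s. X s \<omega>) t 0 (local_time \<omega> t)" using l local_time_eq[OF l] by simp
      show "X t \<omega> = X 0 \<omega> + B t \<omega> + \<beta> * local_time \<omega> t + integral {0..t} (\<lambda>s. refracted_drift \<mu>p \<mu>m (X s \<omega>))"
        using e drift_integral[OF X_continuous[OF elim(1)], of t] local_time_eq[OF l] by simp
    qed (use elim in auto)
  qed
qed

lemma good_path_properties:
  assumes g: "good_path \<omega>" and uv: "0 \<le> u" "u \<le> v"
  shows "X v \<omega> - X u \<omega> = (B v \<omega> - B u \<omega>) + \<beta> * (local_time \<omega> v - local_time \<omega> u)
      + integral {u..v} (\<lambda>s. refracted_drift \<mu>p \<mu>m (X s \<omega>))"
    and "local_time \<omega> u \<le> local_time \<omega> v"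
    and "(\<And>s. s \<in> {u..v} \<Longrightarrow> X s \<omega> \<noteq> 0) \<Longrightarrow> local_time \<omega> u = local_time \<omega> v"
proof -
  have c: "continuous_on {0..} (\<lambda>s. X s \<omega>)" using g X_continuous by (simp add: good_path_def)
  have L: "has_symmetric_local_time (\<lambda>s. X s \<omega>) u 0 (local_time \<omega> u)"
    "has_symmetric_local_time (\<lambda>s. X s \<omega>) v 0 (local_time \<omega> v)"
    using g uv by (auto simp: good_path_def)
  show "local_time \<omega> u \<le> local_time \<omega> v" by (rule local_time_mono[OF c uv(2) L])
  show "local_time \<omega> u = local_time \<omega> v" if "\<And>s. s \<in> {u..v} \<Longrightarrow> X s \<omega> \<noteq> 0"
    by (rule local_time_constant_off_level[OF c uv L that])
  have "(\<lambda>s. refracted_drift \<mu>p \<mu>m (X s \<omega>)) integrable_on {0..v}"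
    by (rule bounded_compose_integrable_on(1)[OF refracted_drift_measurable abs_refracted_drift_le])
       (rule continuous_on_subset[OF c], auto)
  from Henstock_Kurzweil_Integration.integral_combine[OF uv this]
  have "integral {u..v} (\<lambda>s. refracted_drift \<mu>p \<mu>m (X s \<omega>)) =
    integral {0..v} (\<lambda>s. refracted_drift \<mu>p \<mu>m (X s \<omega>)) - integral {0..u} (\<lambda>s. refracted_drift \<mu>p \<mu>m (X s \<omega>))" by linarith
  moreover have "X u \<omega> = X 0 \<omega> + B u \<omega> + \<beta> * local_time \<omega> u + integral {0..u} (\<lambda>s. refracted_drift \<mu>p \<mu>m (X s \<omega>))"
    "X v \<omega> = X 0 \<omega> + B v \<omega> + \<beta> * local_time \<omega> v + integral {0..v} (\<lambda>s. refracted_drift \<mu>p \<mu>m (X s \<omega>))"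
    using g uv unfolding good_path_def by (blast intro: order_trans)+
  ultimately show "X v \<omega> - X u \<omega> = (B v \<omega> - B u \<omega>) + \<beta> * (local_time \<omega> v - local_time \<omega> u)
      + integral {u..v} (\<lambda>s. refracted_drift \<mu>p \<mu>m (X s \<omega>))" by (simp add: algebra_simps)
qed

definition grid :: "real \<Rightarrow> real \<Rightarrow> nat \<Rightarrow> nat \<Rightarrow> real" where
  "grid r t n i = r + real i * ((t - r) / 2 ^ n)"

definition increment :: "real \<Rightarrow> real \<Rightarrow> nat \<Rightarrow> nat \<Rightarrow> 'a \<Rightarrow> real" where
  "increment r t n i \<omega> = B (grid r t n (Suc i)) \<omega> - B (grid r t n i) \<omega>"

lemma grid_properties:
  assumes "0 \<le> r" "r < t"
  shows "0 \<le> grid r t n i" "grid r t n i < grid r t n (Suc i)"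
    "grid r t n (Suc i) - grid r t n i = (t - r) / 2 ^ n" "grid r t n 0 = r"
proof -
  have h: "0 < (t - r) / 2 ^ n" using assms by simp
  show "0 \<le> grid r t n i" unfolding grid_def using assms h by (intro add_nonneg_nonneg mult_nonneg_nonneg) auto
  have "r + real (Suc i) * h - (r + real i * h) = h" for h by (simp add: algebra_simps)
  then show d: "grid r t n (Suc i) - grid r t n i = (t - r) / 2 ^ n" unfolding grid_def .
  then show "grid r t n i < grid r t n (Suc i)" using h by linarith
qed (simp add: grid_def)

text \<open>
  \<open>S\<close> is a discrete stochastic integral with an \<open>L\<^sup>2\<close> bound independent of the grid. \<open>Q\<close> collects the
  centred squared increments, whose variances are \<open>2 h\<^sup>2\<close> for mesh \<open>h\<close> by the fourth moment of the
  normal law; their sum is of order \<open>h\<close>, hence summable along dyadic grids.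
\<close>

lemma increment_transforms:
  fixes Z :: "nat \<Rightarrow> 'a \<Rightarrow> real"
  assumes rt: "0 \<le> r" "r < t"
    and Zm: "\<And>i. Z i \<in> borel_measurable (\<F> (grid r t n i))" and Zb: "\<And>i \<omega>. \<bar>Z i \<omega>\<bar> \<le> C"
  defines "S \<equiv> \<lambda>\<omega>. \<Sum>i<2^n. Z i \<omega> * increment r t n i \<omega>"
    and "Q \<equiv> \<lambda>\<omega>. \<Sum>i<2^n. Z i \<omega> * ((increment r t n i \<omega>)\<^sup>2 - (t - r) / 2 ^ n)"
  shows "S \<in> borel_measurable M" "integrable M (\<lambda>\<omega>. (S \<omega>)\<^sup>2)" "expectation (\<lambda>\<omega>. (S \<omega>)\<^sup>2) \<le> C\<^sup>2 * (t - r)"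
    "\<And>W c. W \<in> borel_measurable (\<F> r) \<Longrightarrow> (\<And>\<omega>. \<bar>W \<omega>\<bar> \<le> c) \<Longrightarrow> expectation (\<lambda>\<omega>. W \<omega> * S \<omega>) = 0"
    "Q \<in> borel_measurable M" "integrable M (\<lambda>\<omega>. (Q \<omega>)\<^sup>2)"
    "expectation (\<lambda>\<omega>. (Q \<omega>)\<^sup>2) \<le> 2 * C\<^sup>2 * (t - r)\<^sup>2 * (1 / 2) ^ n"
proof -
  let ?h = "(t - r) / 2 ^ n" and ?F = "\<lambda>i. \<F> (grid r t n i)" and ?d = "increment r t n"
  note g = grid_properties[OF rt, of n]
  have inc: "sets (?F i) \<subseteq> sets (?F (Suc i))" for i
    by (rule sets_augmented_filtration_mono) (use g(2)[of i] in simp)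
  have dm: "?d i \<in> borel_measurable (?F (Suc i))" for i
    unfolding increment_def[abs_def] using g(1,2)[of i] g(1)[of "Suc i"]
    by (intro borel_measurable_diff bm_measurable_augmented_filtration) auto
  have di: "indep_var borel Y borel (?d i)" if "Y \<in> borel_measurable (?F i)" for Y i
    unfolding increment_def[abs_def] by (rule bm_increment_indep[OF bm g(1,2) that])
  note mom = bm_increment_moments[OF bm g(1,2), unfolded g(3), folded increment_def]
  note T1 = martingale_transform[where F="?F" and \<xi>="?d" and Z=Z and v="?h" and C=C and n="2 ^ n",
      OF _ sets_\<F> inc dm di mom(1) mom(2) _ Zm Zb]
  have E1: "expectation (\<lambda>\<omega>. (?d i \<omega>)\<^sup>2) \<le> ?h" for i using mom(3)[of i] by simp
  have eq: "real (2 ^ n) * (C\<^sup>2 * ?h) = C\<^sup>2 * (t - r)" by simp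
  show "S \<in> borel_measurable M" unfolding S_def
    by (rule \<F>_measurable[OF T1(1)]) (use E1 in auto)
  show "integrable M (\<lambda>\<omega>. (S \<omega>)\<^sup>2)" unfolding S_def by (rule T1(2)) (use E1 in auto)
  show "expectation (\<lambda>\<omega>. (S \<omega>)\<^sup>2) \<le> C\<^sup>2 * (t - r)"
    unfolding S_def eq[symmetric] by (rule T1(3)) (use E1 in auto)
  show "expectation (\<lambda>\<omega>. W \<omega> * S \<omega>) = 0" if "W \<in> borel_measurable (\<F> r)" "\<And>\<omega>. \<bar>W \<omega>\<bar> \<le> c" for W c
    unfolding S_def by (rule T1(4)) (use E1 that g(4) in auto)
  let ?q = "\<lambda>i \<omega>. (?d i \<omega>)\<^sup>2 - ?h"
  have qm: "?q i \<in> borel_measurable (?F (Suc i))" for i using dm[of i] by simp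
  have qi: "indep_var borel Y borel (?q i)" if "Y \<in> borel_measurable (?F i)" for Y i
  proof -
    have "indep_var borel (id \<circ> Y) borel ((\<lambda>z. z\<^sup>2 - ?h) \<circ> ?d i)"
      by (rule indep_var_compose[OF di[OF that]]) auto
    then show ?thesis by (simp add: comp_def)
  qed
  have q2: "(?q i \<omega>)\<^sup>2 = (?d i \<omega>) ^ 4 - 2 * ?h * (?d i \<omega>)\<^sup>2 + ?h\<^sup>2" for i \<omega>
  proof -
    have "(z\<^sup>2 - h)\<^sup>2 = z ^ 4 - 2 * h * z\<^sup>2 + h\<^sup>2" for z h :: real by algebra
    then show ?thesis .
  qed
  have qint: "integrable M (\<lambda>\<omega>. (?q i \<omega>)\<^sup>2)" for i unfolding q2 using mom(1) by auto
  have qmean: "expectation (?q i) = 0" for i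
    using mom(1)[of i 2] mom(3)[of i] by (simp add: prob_space)
  have qvar: "expectation (\<lambda>\<omega>. (?q i \<omega>)\<^sup>2) \<le> 2 * ?h\<^sup>2" for i
  proof -
    have "expectation (\<lambda>\<omega>. (?q i \<omega>)\<^sup>2) = expectation (\<lambda>\<omega>. (?d i \<omega>) ^ 4) - 2 * ?h * expectation (\<lambda>\<omega>. (?d i \<omega>)\<^sup>2) + ?h\<^sup>2"
      unfolding q2 using mom(1)[of i 4] mom(1)[of i 2] by (simp add: prob_space)
    also have "\<dots> = 2 * ?h\<^sup>2"
    proof -
      have "3 * h\<^sup>2 - 2 * h * h + h\<^sup>2 = 2 * h\<^sup>2" for h :: real by (simp add: power2_eq_square)
      then show ?thesis unfolding mom(3,4) .
    qed
    finally show ?thesis by simp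
  qed
  note T2 = martingale_transform[where F="?F" and \<xi>="?q" and Z=Z and v="2 * ?h\<^sup>2" and C=C and n="2 ^ n",
      OF _ sets_\<F> inc qm qi qint qmean qvar Zm Zb]
  have eq2: "real (2 ^ n) * (C\<^sup>2 * (2 * ?h\<^sup>2)) = 2 * C\<^sup>2 * (t - r)\<^sup>2 * (1 / 2) ^ n"
    by (simp add: power2_eq_square power_one_over field_simps)
  show "Q \<in> borel_measurable M" unfolding Q_def by (rule \<F>_measurable[OF T2(1)]) auto
  show "integrable M (\<lambda>\<omega>. (Q \<omega>)\<^sup>2)" unfolding Q_def by (rule T2(2)) auto
  show "expectation (\<lambda>\<omega>. (Q \<omega>)\<^sup>2) \<le> 2 * C\<^sup>2 * (t - r)\<^sup>2 * (1 / 2) ^ n"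
    unfolding Q_def eq2[symmetric] by (rule T2(3)) auto
qed

lemma increment_squares_AE_tendsto_zero:
  fixes Z :: "nat \<Rightarrow> nat \<Rightarrow> 'a \<Rightarrow> real"
  assumes rt: "0 \<le> r" "r < t"
    and Zm: "\<And>n i. Z n i \<in> borel_measurable (\<F> (grid r t n i))" and Zb: "\<And>n i \<omega>. \<bar>Z n i \<omega>\<bar> \<le> C"
  shows "AE \<omega> in M. (\<lambda>n. \<Sum>i<2^n. Z n i \<omega> * ((increment r t n i \<omega>)\<^sup>2 - (t - r) / 2 ^ n)) \<longlonglongrightarrow> 0"
  by (rule summable_second_moments_AE_tendsto_zero[OF increment_transforms(5-7)[OF rt Zm Zb]])
     (intro summable_mult summable_geometric, simp)

text \<open>
  The increment of \<open>f(X)\<close> minus its finite variation part: what the Ito integral of \<open>f'(X)\<close> would be.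
\<close>

definition ito_remainder :: "(real \<Rightarrow> real) \<Rightarrow> (real \<Rightarrow> real) \<Rightarrow> (real \<Rightarrow> real) \<Rightarrow> real \<Rightarrow> real \<Rightarrow> 'a \<Rightarrow> real" where
  "ito_remainder f f' f'' r t \<omega> = f (X t \<omega>) - f (X r \<omega>)
      - integral {r..t} (\<lambda>s. f' (X s \<omega>) * refracted_drift \<mu>p \<mu>m (X s \<omega>) + f'' (X s \<omega>) / 2)
      - \<beta> * f' 0 * (local_time \<omega> t - local_time \<omega> r)"

text \<open>
  The part of the martingale property after time \<open>r\<close> that is stable under almost sure limits:
  orthogonality to bounded functionals of the past, together with an \<open>L\<^sup>2\<close> bound.
\<close>

definition martingale_increment :: "real \<Rightarrow> real \<Rightarrow> ('a \<Rightarrow> real) \<Rightarrow> bool" where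
  "martingale_increment r V N \<longleftrightarrow> N \<in> borel_measurable M \<and>
      integrable M (\<lambda>\<omega>. (N \<omega>)\<^sup>2) \<and> expectation (\<lambda>\<omega>. (N \<omega>)\<^sup>2) \<le> V \<and>
      (\<forall>W c. W \<in> borel_measurable (\<F> r) \<longrightarrow> (\<forall>\<omega>. \<bar>W \<omega>\<bar> \<le> c) \<longrightarrow> expectation (\<lambda>\<omega>. W \<omega> * N \<omega>) = 0)"

lemma martingale_increment_AE_limit:
  assumes N: "\<And>n. martingale_increment r V (N n)" and L: "L \<in> borel_measurable M"
    and lim: "AE \<omega> in M. (\<lambda>n. N n \<omega>) \<longlonglongrightarrow> L \<omega>"
  shows "martingale_increment r V L"
proof -
  have 1: "N n \<in> borel_measurable M" "integrable M (\<lambda>\<omega>. (N n \<omega>)\<^sup>2)" "expectation (\<lambda>\<omega>. (N n \<omega>)\<^sup>2) \<le> V" for n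
    using N[of n] by (auto simp: martingale_increment_def)
  note R = L2_bounded_AE_limit[OF 1(1) L lim 1(2,3)]
  show ?thesis unfolding martingale_increment_def
  proof (intro conjI allI impI L R(1,2))
    fix W :: "'a \<Rightarrow> real" and c assume W: "W \<in> borel_measurable (\<F> r)" "\<forall>\<omega>. \<bar>W \<omega>\<bar> \<le> c"
    show "expectation (\<lambda>\<omega>. W \<omega> * L \<omega>) = 0"
    proof (rule R(3)[OF \<F>_measurable[OF W(1)] W(2)[rule_format]])
      show "expectation (\<lambda>\<omega>. W \<omega> * N n \<omega>) = 0" for n
        using N[of n] W unfolding martingale_increment_def by blast
    qed
  qed
qed

text \<open>
  The discrete integrals converge to the remainder because the centred squared increments, with weights
  \<open>f''(X)/2\<close>, disappear almost surely; with weights \<open>1\<close> they bound the quadratic variation, as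
  \<open>ito_pathwise\<close> requires. The remainder itself need not be measurable when \<open>M\<close> is not complete, so
  a measurable version of it is produced.
\<close>

lemma ito_martingale_increment:
  assumes d1: "\<And>x. (f has_real_derivative f' x) (at x)" and d2: "\<And>x. (f' has_real_derivative f'' x) (at x)"
    and f2c: "continuous_on UNIV f''"
    and H: "\<And>x. \<bar>f' x\<bar> \<le> H" and K: "\<And>x. \<bar>f'' x\<bar> \<le> K"
    and rt: "0 \<le> r" "r < t"
  shows "\<exists>N. martingale_increment r (H\<^sup>2 * (t - r)) N \<and> (AE \<omega> in M. N \<omega> = ito_remainder f f' f'' r t \<omega>)"
proof -
  note g = grid_properties[OF rt]
  have "continuous_on UNIV f'" using d2 by (meson DERIV_continuous_on has_field_derivative_at_within)
  then have f1m: "f' \<in> borel_measurable borel" by (rule borel_measurable_continuous_onI)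
  have f2m: "f'' \<in> borel_measurable borel" by (rule borel_measurable_continuous_onI[OF f2c])
  define Z1 where "Z1 n i \<omega> = f' (X (grid r t n i) \<omega>)" for n i \<omega>
  define Z2 where "Z2 n i \<omega> = f'' (X (grid r t n i) \<omega>) / 2" for n i \<omega>
  have Z1m: "Z1 n i \<in> borel_measurable (\<F> (grid r t n i))" for n i
    unfolding Z1_def[abs_def] by (rule measurable_compose[OF X_adapted[OF g(1)] f1m])
  have Z2m: "Z2 n i \<in> borel_measurable (\<F> (grid r t n i))" for n i
    unfolding Z2_def[abs_def] by (intro borel_measurable_divide measurable_compose[OF X_adapted[OF g(1)] f2m]) simp
  define S where "S n \<omega> = (\<Sum>i<2^n. Z1 n i \<omega> * increment r t n i \<omega>)" for n \<omega>
  define Q where "Q n \<omega> = (\<Sum>i<2^n. Z2 n i \<omega> * ((increment r t n i \<omega>)\<^sup>2 - (t - r) / 2 ^ n))" for n \<omega>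
  have Z1b: "\<bar>Z1 n i \<omega>\<bar> \<le> H" for n i \<omega> unfolding Z1_def by (rule H)
  have Z2b: "\<bar>Z2 n i \<omega>\<bar> \<le> K / 2" for n i \<omega> unfolding Z2_def using K[of "X (grid r t n i) \<omega>"] by simp
  note S = increment_transforms(1-4)[where Z="Z1 n" for n, OF rt Z1m Z1b, folded S_def]
  have Q0: "AE \<omega> in M. (\<lambda>n. Q n \<omega>) \<longlonglongrightarrow> 0"
    unfolding Q_def by (rule increment_squares_AE_tendsto_zero[OF rt Z2m Z2b])
  have V0: "AE \<omega> in M. (\<lambda>n. \<Sum>i<2^n. 1 * ((increment r t n i \<omega>)\<^sup>2 - (t - r) / 2 ^ n)) \<longlonglongrightarrow> 0"
    by (rule increment_squares_AE_tendsto_zero[where C=1, OF rt]) auto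
  have conv: "AE \<omega> in M. (\<lambda>n. S n \<omega>) \<longlonglongrightarrow> ito_remainder f f' f'' r t \<omega>"
    using AE_good_path Q0 V0
  proof eventually_elim
    case (elim \<omega>)
    have sp: "\<omega> \<in> space M" using elim(1) by (simp add: good_path_def)
    have sum1: "(\<Sum>i<(2::nat)^n. (t - r) / 2 ^ n) = t - r" for n by simp
    have "(\<lambda>n. (\<Sum>i<(2::nat)^n. 1 * ((increment r t n i \<omega>)\<^sup>2 - (t - r) / 2 ^ n)) + (t - r)) \<longlonglongrightarrow> 0 + (t - r)"
      by (intro tendsto_intros elim(3))
    then have "convergent (\<lambda>n. \<Sum>i<(2::nat)^n. (increment r t n i \<omega>)\<^sup>2)"
      unfolding mult_1 sum_subtractf sum1 by (auto simp: convergent_def)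
    then have "Bseq (\<lambda>n. \<Sum>i<(2::nat)^n. (increment r t n i \<omega>)\<^sup>2)" by (rule convergent_imp_Bseq)
    then obtain V where V: "\<forall>n. norm (\<Sum>i<(2::nat)^n. (increment r t n i \<omega>)\<^sup>2) \<le> V" by (rule BseqE)
    have "(\<lambda>n. \<Sum>i<2^n. f' (X (grid r t n i) \<omega>) * (B (grid r t n (Suc i)) \<omega> - B (grid r t n i) \<omega>)
      + f'' (X (grid r t n i) \<omega>) / 2 * ((B (grid r t n (Suc i)) \<omega> - B (grid r t n i) \<omega>)\<^sup>2 - (t - r) / 2 ^ n))
      \<longlonglongrightarrow> ito_remainder f f' f'' r t \<omega>"
      unfolding ito_remainder_def
    proof (rule ito_pathwise[where f=f and f'=f' and f''=f'' and K="max H K" and y="\<lambda>s. X s \<omega>" and W="\<lambda>s. B s \<omega>" and L="local_time \<omega>"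
          and p="grid r t" and Q=V, OF d1 d2 f2c])
      show "\<bar>f' z\<bar> \<le> max H K" "\<bar>f'' z\<bar> \<le> max H K" for z using H[of z] K[of z] by auto
      show "continuous_on {r..t} (\<lambda>s. X s \<omega>)" "continuous_on {r..t} (\<lambda>s. B s \<omega>)"
        using rt by (auto intro: continuous_on_subset[OF X_continuous[OF sp]] continuous_on_subset[OF B_continuous[OF sp]])
      show "(\<Sum>i<2 ^ n. (B (grid r t n (Suc i)) \<omega> - B (grid r t n i) \<omega>)\<^sup>2) \<le> V" for n
        using V[rule_format, of n] unfolding increment_def by simp
    next
      fix u v assume "r \<le> u" "u \<le> v" "v \<le> t"
      then have uv: "0 \<le> u" "u \<le> v" using rt by auto
      note p = good_path_properties[OF elim(1) uv]
      show "X v \<omega> - X u \<omega> = (B v \<omega> - B u \<omega>) + \<beta> * (local_time \<omega> v - local_time \<omega> u)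
          + integral {u..v} (\<lambda>s. refracted_drift \<mu>p \<mu>m (X s \<omega>))" by (rule p(1))
      show "local_time \<omega> u \<le> local_time \<omega> v" by (rule p(2))
      show "local_time \<omega> u = local_time \<omega> v" if "\<And>s. s \<in> {u..v} \<Longrightarrow> X s \<omega> \<noteq> 0" using that by (rule p(3))
    qed (use rt \<beta> in \<open>auto simp: grid_def\<close>)
    then have "(\<lambda>n. S n \<omega> + Q n \<omega>) \<longlonglongrightarrow> ito_remainder f f' f'' r t \<omega>"
      unfolding S_def Q_def Z1_def Z2_def increment_def sum.distrib .
    from tendsto_diff[OF this elim(2)] show ?case by simp
  qed
  \<comment> \<open>\<open>lim\<close> is measurable everywhere, whatever its value where the sums diverge.\<close>
  define N where "N \<omega> = lim (\<lambda>n. S n \<omega>)" for \<omega>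
  have Nm: "N \<in> borel_measurable M" unfolding N_def[abs_def] by (rule borel_measurable_lim_metric[OF S(1)])
  have NJ: "AE \<omega> in M. N \<omega> = ito_remainder f f' f'' r t \<omega>"
    using conv by eventually_elim (simp add: N_def limI)
  have Nlim: "AE \<omega> in M. (\<lambda>n. S n \<omega>) \<longlonglongrightarrow> N \<omega>"
    using conv NJ by eventually_elim simp
  have "martingale_increment r (H\<^sup>2 * (t - r)) (S n)" for n
    unfolding martingale_increment_def using S(1-3)[of n] S(4)[of _ _ n] by blast
  from martingale_increment_AE_limit[OF this Nm Nlim] NJ show ?thesis by blast
qed

lemma scale_measurable: "scale_function \<in> borel_measurable borel"
  unfolding scale_function_def[abs_def] scale_right_def scale_left_def by measurable

text \<open>
  The bound on the slopes of \<open>smooth n\<close> is uniform, so the martingale increments belonging to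
  \<open>smooth n\<close> share one \<open>L\<^sup>2\<close> bound, and their almost sure limit is a martingale increment.
\<close>

lemma scale_martingale_increment:
  assumes rt: "0 \<le> r" "r < t"
  shows "martingale_increment r (slope_bound\<^sup>2 * (t - r)) (\<lambda>\<omega>. scale_function (X t \<omega>) - scale_function (X r \<omega>))"
proof -
  let ?P = "\<lambda>n N. martingale_increment r (slope_bound\<^sup>2 * (t - r)) N \<and>
    (AE \<omega> in M. N \<omega> = ito_remainder (smooth n) (dsmooth n) (ddsmooth n) r t \<omega>)"
  have "\<forall>n. \<exists>N. ?P n N"
  proof
    fix n
    obtain K where "\<And>x. \<bar>ddsmooth n x\<bar> \<le> K" using bounded_ddsmooth by blast
    from ito_martingale_increment[OF has_real_derivative_smooth has_real_derivative_dsmooth continuous_ddsmooth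
        abs_dsmooth_le this rt]
    show "\<exists>N. ?P n N" .
  qed
  then obtain N where N: "\<forall>n. ?P n (N n)" by (rule choice[THEN exE])
  have "AE \<omega> in M. \<forall>n. N n \<omega> = ito_remainder (smooth n) (dsmooth n) (ddsmooth n) r t \<omega>"
    unfolding AE_all_countable using N by blast
  with AE_good_path have lim: "AE \<omega> in M. (\<lambda>n. N n \<omega>) \<longlonglongrightarrow> scale_function (X t \<omega>) - scale_function (X r \<omega>)"
  proof eventually_elim
    case (elim \<omega>)
    have "(\<lambda>n. ito_remainder (smooth n) (dsmooth n) (ddsmooth n) r t \<omega>) \<longlonglongrightarrow> scale_function (X t \<omega>) - scale_function (X r \<omega>)"
      unfolding ito_remainder_def
      by (rule smooth_ito_limit[OF X_continuous]) (use elim(1) rt in \<open>auto simp: good_path_def\<close>)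
    then show ?case using elim(2) by simp
  qed
  have m: "(\<lambda>\<omega>. scale_function (X t \<omega>) - scale_function (X r \<omega>)) \<in> borel_measurable M"
    using rt by (intro borel_measurable_diff measurable_compose[OF X_measurable scale_measurable]) auto
  show ?thesis
    by (rule martingale_increment_AE_limit[OF _ m lim]) (use N in blast)
qed

lemma scale_martingale:
  fixes W :: "'a \<Rightarrow> real"
  assumes rt: "0 \<le> r" "r \<le> t" and W: "W \<in> borel_measurable (\<F> r)" and Wb: "\<And>\<omega>. \<bar>W \<omega>\<bar> \<le> c"
  shows "expectation (\<lambda>\<omega>. W \<omega> * (scale_function (X t \<omega>) - scale_function (X r \<omega>))) = 0"
proof (cases "r = t")
  case False
  then have "r < t" using rt by simp
  from scale_martingale_increment[OF rt(1) this] W Wb show ?thesis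
    unfolding martingale_increment_def by blast
qed simp

end

section \<open>Finite occupation of bounded sets\<close>

context refracted_skew
begin

text \<open>
  The test function \<open>-1 / (1 + (\<kappa> z)\<^sup>2)\<close> is bounded, and its critical point at \<open>0\<close> keeps the local time
  out of Ito's formula. It is concave away from the origin, but there the outward drift compensates
  once \<open>\<kappa>\<close> is small compared with both drift rates. \<open>occ_rate\<close> is a positive lower bound of its
  generator.
\<close>

definition \<kappa> :: real where "\<kappa> = 2 / 3 * min \<mu>p (- \<mu>m)"
definition occ_fun :: "real \<Rightarrow> real" where "occ_fun z = - 1 / (1 + (\<kappa> * z)\<^sup>2)"
definition docc_fun :: "real \<Rightarrow> real" where "docc_fun z = 2 * \<kappa>\<^sup>2 * z / (1 + (\<kappa> * z)\<^sup>2)\<^sup>2"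
definition ddocc_fun :: "real \<Rightarrow> real" where
  "ddocc_fun z = (2 * \<kappa>\<^sup>2 - 6 * \<kappa>\<^sup>2 * (\<kappa> * z)\<^sup>2) / (1 + (\<kappa> * z)\<^sup>2) ^ 3"
definition occ_rate :: "real \<Rightarrow> real" where "occ_rate z = \<kappa>\<^sup>2 / (1 + (\<kappa> * z)\<^sup>2) ^ 3"

lemma \<kappa>_pos: "0 < \<kappa>" using \<mu> by (simp add: \<kappa>_def)

lemma one_plus_square_pos: "0 < 1 + (\<kappa> * z)\<^sup>2"
  by (rule add_pos_nonneg) auto

lemma has_real_derivative_occ_fun: "(occ_fun has_real_derivative docc_fun z) (at z)"
proof -
  have nz: "1 + (\<kappa> * z)\<^sup>2 \<noteq> 0" using one_plus_square_pos[of z] by simp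
  have "((\<lambda>z. - 1 / (1 + (\<kappa> * z)\<^sup>2)) has_real_derivative
    (0 * (1 + (\<kappa> * z)\<^sup>2) - - 1 * (0 + 2 * (\<kappa> * z) * \<kappa>)) / ((1 + (\<kappa> * z)\<^sup>2) * (1 + (\<kappa> * z)\<^sup>2))) (at z)"
    using nz by (intro DERIV_divide derivative_eq_intros | simp)+
  then show ?thesis unfolding occ_fun_def[abs_def] docc_fun_def
    by (simp add: power2_eq_square algebra_simps)
qed

lemma has_real_derivative_docc_fun: "(docc_fun has_real_derivative ddocc_fun z) (at z)"
proof -
  let ?w = "1 + (\<kappa> * z)\<^sup>2"
  have nz: "?w \<noteq> 0" using one_plus_square_pos[of z] by simp
  have "((\<lambda>z. 2 * \<kappa>\<^sup>2 * z / (1 + (\<kappa> * z)\<^sup>2)\<^sup>2) has_real_derivative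
    (2 * \<kappa>\<^sup>2 * ?w\<^sup>2 - 2 * \<kappa>\<^sup>2 * z * (2 * ?w * (2 * (\<kappa> * z) * \<kappa>))) / (?w\<^sup>2 * ?w\<^sup>2)) (at z)"
  proof (rule DERIV_divide)
    show "((\<lambda>z. 2 * \<kappa>\<^sup>2 * z) has_real_derivative 2 * \<kappa>\<^sup>2) (at z)" by (auto intro!: derivative_eq_intros)
    show "((\<lambda>z. (1 + (\<kappa> * z)\<^sup>2)\<^sup>2) has_real_derivative 2 * ?w * (2 * (\<kappa> * z) * \<kappa>)) (at z)"
      by (auto intro!: derivative_eq_intros)
  qed (use nz in simp)
  moreover have "(2 * \<kappa>\<^sup>2 * ?w\<^sup>2 - 2 * \<kappa>\<^sup>2 * z * (2 * ?w * (2 * (\<kappa> * z) * \<kappa>))) / (?w\<^sup>2 * ?w\<^sup>2) = ddocc_fun z"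
  proof -
    have "2 * \<kappa>\<^sup>2 * ?w\<^sup>2 - 2 * \<kappa>\<^sup>2 * z * (2 * ?w * (2 * (\<kappa> * z) * \<kappa>)) = ?w * (2 * \<kappa>\<^sup>2 - 6 * \<kappa>\<^sup>2 * (\<kappa> * z)\<^sup>2)"
      by algebra
    moreover have "?w\<^sup>2 * ?w\<^sup>2 = ?w * ?w ^ 3" by algebra
    ultimately show ?thesis unfolding ddocc_fun_def using nz by simp
  qed
  ultimately show ?thesis unfolding docc_fun_def[abs_def] by simp
qed

lemma continuous_ddocc_fun: "continuous_on UNIV ddocc_fun"
  unfolding ddocc_fun_def[abs_def]
  by (intro continuous_intros) (use one_plus_square_pos in \<open>auto simp: less_imp_neq[symmetric]\<close>)

lemma continuous_occ_rate: "continuous_on UNIV occ_rate"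
  unfolding occ_rate_def[abs_def]
  by (intro continuous_intros) (use one_plus_square_pos in \<open>auto simp: less_imp_neq[symmetric]\<close>)

lemma occ_rate_bounds: "0 < occ_rate z" "occ_rate z \<le> \<kappa>\<^sup>2"
proof -
  have "1 \<le> (1 + (\<kappa> * z)\<^sup>2) ^ 3" by (rule one_le_power) simp
  moreover have "0 < (1 + (\<kappa> * z)\<^sup>2) ^ 3" by (rule zero_less_power[OF one_plus_square_pos])
  ultimately show "0 < occ_rate z" "occ_rate z \<le> \<kappa>\<^sup>2"
    unfolding occ_rate_def using \<kappa>_pos mult_left_mono[of 1 "(1 + (\<kappa> * z)\<^sup>2) ^ 3" "\<kappa>\<^sup>2"]
    by (simp_all add: pos_divide_le_eq)
qed

lemma occ_rate_nonneg: "0 \<le> occ_rate z"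
  using occ_rate_bounds(1)[of z] by simp

lemma abs_docc_fun_le: "\<bar>docc_fun z\<bar> \<le> \<kappa>"
proof -
  let ?w = "1 + (\<kappa> * z)\<^sup>2"
  have w1: "1 \<le> ?w" by simp
  have "2 * \<bar>\<kappa> * z\<bar> \<le> ?w" using zero_le_power2[of "1 - \<bar>\<kappa> * z\<bar>"] by (simp add: power2_diff)
  also have "?w * 1 \<le> ?w * ?w" using w1 by (intro mult_left_mono) auto
  finally have "\<kappa> * (2 * \<bar>\<kappa> * z\<bar>) \<le> \<kappa> * ?w\<^sup>2" using \<kappa>_pos by (simp add: power2_eq_square)
  moreover have "\<bar>docc_fun z\<bar> = \<kappa> * (2 * \<bar>\<kappa> * z\<bar>) / ?w\<^sup>2"
    unfolding docc_fun_def using \<kappa>_pos by (simp add: abs_mult power2_eq_square)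
  moreover have "0 < ?w\<^sup>2" using w1 by (intro zero_less_power) linarith
  ultimately show ?thesis by (simp add: divide_le_eq)
qed

lemma abs_ddocc_fun_le: "\<bar>ddocc_fun z\<bar> \<le> 6 * \<kappa>\<^sup>2"
proof -
  let ?q = "(\<kappa> * z)\<^sup>2"
  have q: "0 \<le> ?q" by simp
  have "\<bar>2 * \<kappa>\<^sup>2 - 6 * \<kappa>\<^sup>2 * ?q\<bar> \<le> 6 * \<kappa>\<^sup>2 * (1 + ?q)"
    using q by (simp add: abs_le_iff algebra_simps)
  also have "\<dots> \<le> 6 * \<kappa>\<^sup>2 * (1 + ?q) ^ 3"
    using power_increasing[of 1 3 "1 + ?q"] q by (intro mult_left_mono) auto
  finally have *: "\<bar>2 * \<kappa>\<^sup>2 - 6 * \<kappa>\<^sup>2 * ?q\<bar> \<le> 6 * \<kappa>\<^sup>2 * (1 + ?q) ^ 3" .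
  have pos: "0 < (1 + ?q) ^ 3" using q by (intro zero_less_power) linarith
  have "\<bar>ddocc_fun z\<bar> = \<bar>2 * \<kappa>\<^sup>2 - 6 * \<kappa>\<^sup>2 * ?q\<bar> / (1 + ?q) ^ 3"
    unfolding ddocc_fun_def abs_divide using pos by simp
  then show ?thesis using * pos by (simp only: divide_le_eq if_True)
qed

lemma occ_fun_bounds: "- 1 \<le> occ_fun z" "occ_fun z \<le> 0"
  using one_plus_square_pos[of z] by (auto simp: occ_fun_def divide_le_eq le_divide_eq)

text \<open>
  With \<open>a = \<bar>\<kappa> z\<bar>\<close>, the choice of \<open>\<kappa>\<close> makes the drift term at least \<open>3 \<kappa>\<^sup>2 a (1 + a\<^sup>2)\<close> over the common
  denominator, and the claim reduces to \<open>a + a\<^sup>3 \<ge> a\<^sup>2\<close>, that is to \<open>a (1 - a + a\<^sup>2) \<ge> 0\<close>.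
\<close>

lemma occ_rate_le_generator:
  "occ_rate z \<le> docc_fun z * refracted_drift \<mu>p \<mu>m z + ddocc_fun z / 2"
proof -
  let ?w = "1 + (\<kappa> * z)\<^sup>2" and ?a = "\<bar>\<kappa> * z\<bar>" and ?d = "refracted_drift \<mu>p \<mu>m z"
  have wpos: "0 < ?w" by (rule one_plus_square_pos)
  have "3 / 2 * \<kappa> * \<bar>z\<bar> \<le> z * ?d"
  proof -
    have "3 / 2 * \<kappa> \<le> \<mu>p" "3 / 2 * \<kappa> \<le> - \<mu>m" by (auto simp: \<kappa>_def)
    then show ?thesis
      using mult_right_mono[of "3 / 2 * \<kappa>" \<mu>p z] mult_right_mono[of "3 / 2 * \<kappa>" "- \<mu>m" "- z"]
      by (auto simp: refracted_drift_def abs_if algebra_simps)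
  qed
  then have "2 * \<kappa>\<^sup>2 * (3 / 2 * \<kappa> * \<bar>z\<bar>) \<le> 2 * \<kappa>\<^sup>2 * (z * ?d)" by (intro mult_left_mono) auto
  moreover have "2 * \<kappa>\<^sup>2 * (3 / 2 * \<kappa> * \<bar>z\<bar>) = 3 * \<kappa>\<^sup>2 * ?a"
  proof -
    have "?a = \<kappa> * \<bar>z\<bar>" using \<kappa>_pos by (simp add: abs_mult)
    then show ?thesis by simp
  qed
  ultimately have "3 * \<kappa>\<^sup>2 * ?a \<le> 2 * \<kappa>\<^sup>2 * (z * ?d)" by (simp only:)
  then have "3 * \<kappa>\<^sup>2 * ?a * ?w \<le> 2 * \<kappa>\<^sup>2 * (z * ?d) * ?w"
    using wpos by (intro mult_right_mono) auto
  moreover have "\<kappa>\<^sup>2 * 1 \<le> \<kappa>\<^sup>2 * (3 * ?a * ?w + 1 - 3 * ?a\<^sup>2)"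
  proof (rule mult_left_mono)
    have "0 \<le> ?a * (1 - ?a + ?a\<^sup>2)"
    proof (rule mult_nonneg_nonneg)
      have "(?a - 1 / 2)\<^sup>2 + 3 / 4 = 1 - ?a + ?a\<^sup>2" by (simp add: power2_eq_square algebra_simps)
      then show "0 \<le> 1 - ?a + ?a\<^sup>2" using zero_le_power2[of "?a - 1 / 2"] by linarith
    qed simp
    then show "1 \<le> 3 * ?a * ?w + 1 - 3 * ?a\<^sup>2" by (simp add: power2_eq_square algebra_simps)
  qed simp
  ultimately have "\<kappa>\<^sup>2 \<le> 2 * \<kappa>\<^sup>2 * (z * ?d) * ?w + \<kappa>\<^sup>2 - 3 * \<kappa>\<^sup>2 * ?a\<^sup>2"
    by (simp add: algebra_simps)
  then have "\<kappa>\<^sup>2 / ?w ^ 3 \<le> (2 * \<kappa>\<^sup>2 * (z * ?d) * ?w + \<kappa>\<^sup>2 - 3 * \<kappa>\<^sup>2 * ?a\<^sup>2) / ?w ^ 3"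
    using wpos by (intro divide_right_mono) auto
  also have "\<dots> = docc_fun z * ?d + ddocc_fun z / 2"
  proof -
    have "docc_fun z * ?d = 2 * \<kappa>\<^sup>2 * (z * ?d) * ?w / ?w ^ 3"
      unfolding docc_fun_def using wpos by (simp add: power2_eq_square power3_eq_cube)
    moreover have "ddocc_fun z / 2 = (\<kappa>\<^sup>2 - 3 * \<kappa>\<^sup>2 * ?a\<^sup>2) / ?w ^ 3"
    proof -
      have eq: "2 * \<kappa>\<^sup>2 - 6 * \<kappa>\<^sup>2 * (\<kappa> * z)\<^sup>2 = 2 * (\<kappa>\<^sup>2 - 3 * \<kappa>\<^sup>2 * ?a\<^sup>2)" by simp
      have "2 * p / q / 2 = p / q" for p q :: real by simp
      then show ?thesis unfolding ddocc_fun_def eq .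
    qed
    ultimately show ?thesis by (simp only: add_divide_distrib[symmetric] add_diff_eq)
  qed
  finally show ?thesis by (simp add: occ_rate_def)
qed

end

context refracted_skew_bm
begin

text \<open>
  By Ito's formula the integral of the generator up to time \<open>n\<close> equals the increment of a function with
  values in \<open>[-1, 0]\<close> minus a martingale increment, so its expectation is at most \<open>1\<close> for every \<open>n\<close>.
  Fatou's lemma gives an almost surely finite lower limit, and the occupation integrals are increasing.
\<close>

lemma AE_occupation_bounded:
  "AE \<omega> in M. \<exists>C. \<forall>n::nat. integral {0..real n} (\<lambda>s. occ_rate (X s \<omega>)) \<le> C"
proof -
  let ?P = "\<lambda>n N. martingale_increment 0 (\<kappa>\<^sup>2 * (real (Suc n) - 0)) N \<and>
    (AE \<omega> in M. N \<omega> = ito_remainder occ_fun docc_fun ddocc_fun 0 (real (Suc n)) \<omega>)"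
  have "\<forall>n. \<exists>N. ?P n N"
    by (intro allI ito_martingale_increment[OF has_real_derivative_occ_fun has_real_derivative_docc_fun
        continuous_ddocc_fun abs_docc_fun_le abs_ddocc_fun_le]) auto
  then obtain N where N: "\<forall>n. ?P n (N n)" by (rule choice[THEN exE])
  have Nm [measurable]: "N n \<in> borel_measurable M" for n
    using N by (auto simp: martingale_increment_def)
  have NE: "expectation (N n) = 0" for n
  proof -
    have "(\<lambda>\<omega>. 1 :: real) \<in> borel_measurable (\<F> 0)" "\<forall>\<omega>::'a. \<bar>1::real\<bar> \<le> 1" by auto
    then have "expectation (\<lambda>\<omega>. 1 * N n \<omega>) = 0"
      using N unfolding martingale_increment_def by blast
    then show ?thesis by simp
  qed
  have Ni: "integrable M (N n)" for n
    by (rule square_integrable_imp_integrable[OF Nm]) (use N in \<open>auto simp: martingale_increment_def\<close>)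
  have occm: "occ_fun \<in> borel_measurable borel" unfolding occ_fun_def[abs_def] by measurable
  \<comment> \<open>A measurable version of the integral of the generator up to time \<open>n + 1\<close>.\<close>
  define V where "V n \<omega> = occ_fun (X (real (Suc n)) \<omega>) - occ_fun (X 0 \<omega>) - N n \<omega>" for n \<omega>
  have gm [measurable]: "(\<lambda>\<omega>. occ_fun (X t \<omega>)) \<in> borel_measurable M" if "0 \<le> t" for t
    by (rule measurable_compose[OF X_measurable[OF that] occm])
  have gi: "integrable M (\<lambda>\<omega>. occ_fun (X t \<omega>))" if "0 \<le> t" for t
    by (rule integrable_const_bound[where B=1, OF _ gm[OF that]])
       (use occ_fun_bounds in \<open>auto simp: abs_le_iff intro: order_trans\<close>)
  have Vm [measurable]: "V n \<in> borel_measurable M" for n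
    unfolding V_def[abs_def] by (intro borel_measurable_diff gm Nm) auto
  have Vi: "integrable M (V n)" for n
    unfolding V_def[abs_def] by (intro Bochner_Integration.integrable_diff gi Ni) auto
  have VE: "expectation (V n) \<le> 1" for n
  proof -
    have "expectation (V n) = expectation (\<lambda>\<omega>. occ_fun (X (real (Suc n)) \<omega>) - occ_fun (X 0 \<omega>)) - expectation (N n)"
      unfolding V_def[abs_def]
      by (rule Bochner_Integration.integral_diff[OF Bochner_Integration.integrable_diff[OF gi gi] Ni]) auto
    also have "\<dots> \<le> expectation (\<lambda>\<omega>. 1)"
      unfolding NE diff_0_right
    proof (rule integral_mono[OF Bochner_Integration.integrable_diff[OF gi gi]])
      show "occ_fun (X (real (Suc n)) \<omega>) - occ_fun (X 0 \<omega>) \<le> 1" for \<omega>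
        using occ_fun_bounds(2)[of "X (real (Suc n)) \<omega>"] occ_fun_bounds(1)[of "X 0 \<omega>"] by linarith
    qed auto
    finally show ?thesis by (simp add: prob_space)
  qed
  define I where "I n \<omega> = integral {0..real n} (\<lambda>s. occ_rate (X s \<omega>))" for n \<omega>
  have ir: "(\<lambda>s. occ_rate (X s \<omega>)) integrable_on {0..t}" if "\<omega> \<in> space M" for \<omega> t
    by (intro integrable_continuous_real continuous_on_compose2[OF continuous_occ_rate]
        continuous_on_subset[OF X_continuous[OF that]]) auto
  have Imono: "I m \<omega> \<le> I n \<omega>" if "\<omega> \<in> space M" "m \<le> n" for \<omega> m n
    unfolding I_def by (rule integral_subset_le) (use that ir occ_rate_nonneg in auto)
  have VI: "AE \<omega> in M. \<forall>n. I (Suc n) \<omega> \<le> V n \<omega>"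
    unfolding AE_all_countable
  proof
    fix n
    have "AE \<omega> in M. N n \<omega> = ito_remainder occ_fun docc_fun ddocc_fun 0 (real (Suc n)) \<omega>" using N by blast
    then show "AE \<omega> in M. I (Suc n) \<omega> \<le> V n \<omega>"
      using AE_space
    proof eventually_elim
      case (elim \<omega>)
      let ?t = "real (Suc n)"
      have yt: "continuous_on {0..?t} (\<lambda>s. X s \<omega>)"
        by (rule continuous_on_subset[OF X_continuous[OF elim(2)]]) auto
      have "docc_fun 0 = 0" by (simp add: docc_fun_def)
      then have "V n \<omega> = integral {0..?t} (\<lambda>s. docc_fun (X s \<omega>) * refracted_drift \<mu>p \<mu>m (X s \<omega>) + ddocc_fun (X s \<omega>) / 2)"
        unfolding V_def elim(1) ito_remainder_def by simp
      moreover have "I (Suc n) \<omega> \<le> integral {0..?t} (\<lambda>s. docc_fun (X s \<omega>) * refracted_drift \<mu>p \<mu>m (X s \<omega>) + ddocc_fun (X s \<omega>) / 2)"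
        unfolding I_def
      proof (rule integral_le[OF ir[OF elim(2)] _ occ_rate_le_generator])
        have m: "(\<lambda>z. docc_fun z * refracted_drift \<mu>p \<mu>m z + ddocc_fun z / 2) \<in> borel_measurable borel"
          unfolding docc_fun_def[abs_def] ddocc_fun_def[abs_def] by measurable
        have b: "\<bar>docc_fun z * refracted_drift \<mu>p \<mu>m z + ddocc_fun z / 2\<bar> \<le> \<kappa> * (\<bar>\<mu>p\<bar> + \<bar>\<mu>m\<bar>) + 3 * \<kappa>\<^sup>2" for z
        proof -
          have "\<bar>docc_fun z * refracted_drift \<mu>p \<mu>m z\<bar> \<le> \<kappa> * (\<bar>\<mu>p\<bar> + \<bar>\<mu>m\<bar>)"
            unfolding abs_mult using abs_docc_fun_le abs_refracted_drift_le \<kappa>_pos by (intro mult_mono) auto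
          then show ?thesis using abs_ddocc_fun_le[of z] by linarith
        qed
        show "(\<lambda>s. docc_fun (X s \<omega>) * refracted_drift \<mu>p \<mu>m (X s \<omega>) + ddocc_fun (X s \<omega>) / 2) integrable_on {0..?t}"
          by (rule bounded_compose_integrable_on(1)[OF m b yt])
      qed
      ultimately show ?case by simp
    qed
  qed
  have I0: "0 \<le> I n \<omega>" if "\<omega> \<in> space M" for n \<omega>
    unfolding I_def by (rule integral_nonneg[OF ir[OF that]]) (use occ_rate_nonneg in auto)
  have V0: "AE \<omega> in M. 0 \<le> V n \<omega>" for n
    using VI AE_space by eventually_elim (use I0 order_trans in blast)
  have "(\<integral>\<^sup>+\<omega>. liminf (\<lambda>n. ennreal (V n \<omega>)) \<partial>M) \<le> liminf (\<lambda>n. \<integral>\<^sup>+\<omega>. ennreal (V n \<omega>) \<partial>M)"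
    by (rule nn_integral_liminf) measurable
  also have "\<dots> \<le> liminf (\<lambda>n. 1)"
  proof (rule Liminf_mono, rule always_eventually, rule allI)
    fix n
    have "(\<integral>\<^sup>+\<omega>. ennreal (V n \<omega>) \<partial>M) = ennreal (expectation (V n))"
      by (rule nn_integral_eq_integral[OF Vi V0])
    also have "\<dots> \<le> 1" using VE[of n] ennreal_leI by fastforce
    finally show "(\<integral>\<^sup>+\<omega>. ennreal (V n \<omega>) \<partial>M) \<le> 1" .
  qed
  also have "\<dots> = 1" by (simp add: Liminf_const)
  finally have "(\<integral>\<^sup>+\<omega>. liminf (\<lambda>n. ennreal (V n \<omega>)) \<partial>M) \<noteq> \<infinity>" by (auto simp: top_unique)
  then have "AE \<omega> in M. liminf (\<lambda>n. ennreal (V n \<omega>)) \<noteq> \<infinity>"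
    by (intro nn_integral_PInf_AE) measurable
  then show ?thesis
    using VI AE_space
  proof eventually_elim
    case (elim \<omega>)
    have "\<exists>C. \<forall>n. I n \<omega> \<le> C"
    proof (rule ccontr)
      assume "\<not> ?thesis"
      then have unb: "\<exists>n. C < I n \<omega>" for C by (meson not_le)
      have "ennreal (real k) \<le> liminf (\<lambda>n. ennreal (V n \<omega>))" for k
      proof (rule Liminf_bounded)
        obtain m where m: "real k < I m \<omega>" using unb by blast
        show "\<forall>\<^sub>F n in sequentially. ennreal (real k) \<le> ennreal (V n \<omega>)"
        proof (rule eventually_sequentiallyI)
          fix n assume "m \<le> n"
          then have "I m \<omega> \<le> V n \<omega>" using Imono[OF elim(3), of m "Suc n"] elim(2) by (meson le_SucI order_trans)
          then show "ennreal (real k) \<le> ennreal (V n \<omega>)" using m by (intro ennreal_leI) simp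
        qed
      qed
      then have "liminf (\<lambda>n. ennreal (V n \<omega>)) = \<infinity>"
        by (metis ennreal_of_nat_eq_real_of_nat ennreal_Ex_less_of_nat infinity_ennreal_def leD less_top)
      with elim(1) show False by simp
    qed
    then show ?case unfolding I_def .
  qed
qed

end

section \<open>Almost sure escape and its probabilities\<close>

text \<open>
  Continuity of the paths reduces the limit to rational times.
\<close>

lemma measurable_filterlim_at_top:
  assumes "continuous_process M Y"
  shows "{\<omega> \<in> space M. filterlim (\<lambda>t. Y t \<omega>) at_top at_top} \<in> sets M"
proof -
  have "filterlim (\<lambda>t. Y t \<omega>) at_top at_top \<longleftrightarrow>
      (\<forall>k::nat. \<exists>n::nat. \<forall>q::rat. real n \<le> real_of_rat q \<longrightarrow> real k \<le> Y (real_of_rat q) \<omega>)"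
    if \<omega>: "\<omega> \<in> space M" for \<omega>
  proof
    assume L: "filterlim (\<lambda>t. Y t \<omega>) at_top at_top"
    show "\<forall>k::nat. \<exists>n::nat. \<forall>q::rat. real n \<le> real_of_rat q \<longrightarrow> real k \<le> Y (real_of_rat q) \<omega>"
    proof
      fix k :: nat
      have "\<forall>\<^sub>F t in at_top. real k \<le> Y t \<omega>" using L by (simp add: filterlim_at_top)
      then obtain T where T: "\<And>t. T \<le> t \<Longrightarrow> real k \<le> Y t \<omega>" by (auto simp: eventually_at_top_linorder)
      obtain n :: nat where "T \<le> real n" using real_arch_simple by blast
      then show "\<exists>n::nat. \<forall>q::rat. real n \<le> real_of_rat q \<longrightarrow> real k \<le> Y (real_of_rat q) \<omega>"
        using T by (meson order_trans)
    qed
  next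
    assume R: "\<forall>k::nat. \<exists>n::nat. \<forall>q::rat. real n \<le> real_of_rat q \<longrightarrow> real k \<le> Y (real_of_rat q) \<omega>"
    show "filterlim (\<lambda>t. Y t \<omega>) at_top at_top"
      unfolding filterlim_at_top
    proof
      fix Z :: real
      obtain k :: nat where k: "Z < real k" using reals_Archimedean2 by blast
      obtain n :: nat where n: "\<And>q. real n \<le> real_of_rat q \<Longrightarrow> real k \<le> Y (real_of_rat q) \<omega>" using R by blast
      have "Z \<le> Y t \<omega>" if t: "real n \<le> t" for t
      proof (rule ccontr)
        assume "\<not> Z \<le> Y t \<omega>"
        then have lt: "0 < real k - Y t \<omega>" using k by simp
        have "continuous_on {0..} (\<lambda>t. Y t \<omega>)" using assms \<omega> by (simp add: continuous_process_def)
        moreover have "t \<in> {0..}" using t by auto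
        ultimately obtain d where d: "d > 0" "\<And>u. u \<in> {0..} \<Longrightarrow> dist u t < d \<Longrightarrow> dist (Y u \<omega>) (Y t \<omega>) < real k - Y t \<omega>"
          using lt unfolding continuous_on_iff by metis
        obtain q where q: "t < real_of_rat q" "real_of_rat q < t + d" using of_rat_dense[of t "t + d"] d(1) by auto
        have "0 \<le> real_of_rat q" using q(1) t of_nat_0_le_iff[of n] by linarith
        then have "dist (Y (real_of_rat q) \<omega>) (Y t \<omega>) < real k - Y t \<omega>"
          using q by (intro d(2)) (auto simp: dist_real_def)
        moreover have "real k \<le> Y (real_of_rat q) \<omega>" using n q t by simp
        ultimately show False by (simp add: dist_real_def)
      qed
      then show "\<forall>\<^sub>F t in at_top. Z \<le> Y t \<omega>" by (auto simp: eventually_at_top_linorder)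
    qed
  qed
  then have eq: "{\<omega> \<in> space M. filterlim (\<lambda>t. Y t \<omega>) at_top at_top} =
    {\<omega> \<in> space M. \<forall>k::nat. \<exists>n::nat. \<forall>q::rat. real n \<le> real_of_rat q \<longrightarrow> real k \<le> Y (real_of_rat q) \<omega>}" by blast
  show ?thesis unfolding eq
  proof (intro sets.sets_Collect_countable_All sets.sets_Collect_countable_Ex)
    fix k n :: nat and q :: rat
    show "{\<omega> \<in> space M. real n \<le> real_of_rat q \<longrightarrow> real k \<le> Y (real_of_rat q) \<omega>} \<in> sets M"
    proof (cases "real n \<le> real_of_rat q")
      case True
      then have [measurable]: "Y (real_of_rat q) \<in> borel_measurable M"
        using assms order_trans[of 0 "real n" "real_of_rat q"] by (simp add: continuous_process_def)
      have "{\<omega> \<in> space M. real k \<le> Y (real_of_rat q) \<omega>} \<in> sets M" by measurable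
      then show ?thesis using True by simp
    qed simp
  qed
qed

lemma measurable_filterlim_at_bot:
  assumes "continuous_process M Y"
  shows "{\<omega> \<in> space M. filterlim (\<lambda>t. Y t \<omega>) at_bot at_top} \<in> sets M"
proof -
  have "continuous_process M (\<lambda>t \<omega>. - Y t \<omega>)"
    using assms unfolding continuous_process_def by (auto intro: continuous_intros)
  from measurable_filterlim_at_top[OF this] show ?thesis
    by (simp add: filterlim_uminus_at_bot)
qed

lemma tendsto_at_top_of_small_tail_oscillation:
  fixes h :: "real \<Rightarrow> real"
  assumes "\<And>j::nat. \<exists>T::nat. \<forall>u\<ge>real T. \<bar>h u - h (real T)\<bar> \<le> 1 / real (Suc j)"
  shows "\<exists>c. (h \<longlongrightarrow> c) at_top"
proof -
  have osc: "\<exists>T. \<forall>u\<ge>T. \<forall>v\<ge>T. \<bar>h u - h v\<bar> < e" if "e > 0" for e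
  proof -
    have "0 < e / 2" using that by simp
    then obtain j where j: "1 / real (Suc j) < e / 2" by (rule nat_approx_posE)
    obtain T :: nat where T: "\<And>u. real T \<le> u \<Longrightarrow> \<bar>h u - h (real T)\<bar> \<le> 1 / real (Suc j)" using assms by blast
    have "\<bar>h u - h v\<bar> < e" if "real T \<le> u" "real T \<le> v" for u v
      using T[OF that(1)] T[OF that(2)] j by linarith
    then show ?thesis by blast
  qed
  have "Cauchy (\<lambda>n. h (real n))"
  proof (rule metric_CauchyI)
    fix e :: real assume "0 < e"
    then obtain T where T: "\<And>u v. T \<le> u \<Longrightarrow> T \<le> v \<Longrightarrow> \<bar>h u - h v\<bar> < e" using osc by blast
    obtain N :: nat where N: "T \<le> real N" using real_arch_simple by blast
    show "\<exists>N. \<forall>m\<ge>N. \<forall>n\<ge>N. dist (h (real m)) (h (real n)) < e"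
    proof (intro exI[of _ N] allI impI)
      fix m n assume "N \<le> m" "N \<le> n"
      then have "T \<le> real m" "T \<le> real n" using N by (auto intro: order_trans)
      then show "dist (h (real m)) (h (real n)) < e" unfolding dist_real_def by (rule T)
    qed
  qed
  then obtain c where c: "(\<lambda>n. h (real n)) \<longlonglongrightarrow> c" using Cauchy_convergent_iff convergent_def by blast
  have "(h \<longlongrightarrow> c) at_top"
  proof (rule tendstoI)
    fix e :: real assume e: "0 < e"
    then obtain T where T: "\<And>u v. T \<le> u \<Longrightarrow> T \<le> v \<Longrightarrow> \<bar>h u - h v\<bar> < e / 2" using osc[of "e / 2"] by auto
    have "\<forall>\<^sub>F n in sequentially. dist (h (real n)) c < e / 2" using c e by (intro tendstoD) auto
    then obtain N where N: "\<And>n. N \<le> n \<Longrightarrow> dist (h (real n)) c < e / 2" by (auto simp: eventually_sequentially)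
    obtain m :: nat where m: "T \<le> real m" using real_arch_simple by blast
    define n where "n = max N m"
    have n: "N \<le> n" "T \<le> real n" using m by (auto simp: n_def)
    have "dist (h u) c < e" if "T \<le> u" for u
      using T[OF that n(2)] N[OF n(1)] unfolding dist_real_def by linarith
    then show "\<forall>\<^sub>F u in at_top. dist (h u) c < e" by (auto simp: eventually_at_top_linorder)
  qed
  then show ?thesis by blast
qed

context refracted_skew
begin

definition scale_sup :: real where "scale_sup = (1 - \<beta>) / (2 * \<mu>p)"
definition scale_inf :: real where "scale_inf = (1 + \<beta>) / (2 * \<mu>m)"

lemma strict_mono_scale: "strict_mono scale_function"
proof (rule strict_monoI)
  fix u v :: real assume uv: "u < v"
  have R: "scale_right a < scale_right b" if "a < b" for a b
    using that \<beta> \<mu> by (auto simp: scale_right_def intro!: divide_strict_right_mono mult_strict_left_mono)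
  have L: "scale_left a < scale_left b" if "a < b" for a b
    using that \<beta> \<mu> by (auto simp: scale_left_def intro!: divide_strict_right_mono_neg mult_strict_left_mono)
  have 0: "scale_left 0 = 0" "scale_right 0 = 0" by (auto simp: scale_left_def scale_right_def)
  show "scale_function u < scale_function v"
    using uv R[of u v] L[of u v] L[of u 0] R[of 0 v] 0
    by (cases "v = 0") (auto simp: scale_function_def)
qed

lemma scale_bounds: "scale_inf < scale_function z" "scale_function z < scale_sup"
proof -
  have p: "0 < scale_sup" and n: "scale_inf < 0"
    using \<beta> \<mu> by (auto simp: scale_sup_def scale_inf_def divide_pos_neg)
  have r: "scale_right z < scale_sup"
  proof -
    have "(1 - \<beta>) * (1 - exp (-2 * \<mu>p * z)) < (1 - \<beta>) * 1" using \<beta> by (intro mult_strict_left_mono) auto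
    then show ?thesis using \<mu> unfolding scale_right_def scale_sup_def by (intro divide_strict_right_mono) auto
  qed
  have l: "scale_inf < scale_left z"
  proof -
    have "(1 + \<beta>) * (1 - exp (-2 * \<mu>m * z)) < (1 + \<beta>) * 1" using \<beta> by (intro mult_strict_left_mono) auto
    then show ?thesis using \<mu> unfolding scale_left_def scale_inf_def by (intro divide_strict_right_mono_neg) auto
  qed
  have "scale_function 0 = 0" by (simp add: scale_function_def scale_right_def)
  then have "0 \<le> z \<Longrightarrow> 0 \<le> scale_function z" "z < 0 \<Longrightarrow> scale_function z < 0"
    using strict_mono_scale by (metis strict_mono_less_eq, metis strict_mono_less)
  then show "scale_inf < scale_function z" "scale_function z < scale_sup"
    using r l p n by (cases "0 \<le> z"; fastforce simp: scale_function_def)+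
qed

lemma exp_at_top_limit: "0 < c \<Longrightarrow> ((\<lambda>z::real. exp (- c * z)) \<longlongrightarrow> 0) at_top" for c :: real
proof -
  assume c: "0 < c"
  have "filterlim (\<lambda>z. c * z) at_top at_top"
    by (rule filterlim_tendsto_pos_mult_at_top[OF tendsto_const c filterlim_ident])
  then have "filterlim (\<lambda>z. - (c * z)) at_bot at_top" by (simp add: filterlim_uminus_at_bot)
  from filterlim_compose[OF exp_at_bot this] show ?thesis by simp
qed

lemma scale_tendsto_at_top: "(scale_function \<longlongrightarrow> scale_sup) at_top"
proof -
  have "((\<lambda>z. (1 - \<beta>) * (1 - exp (- (2 * \<mu>p) * z)) / (2 * \<mu>p)) \<longlongrightarrow> (1 - \<beta>) * (1 - 0) / (2 * \<mu>p)) at_top"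
    using \<mu> by (intro tendsto_intros exp_at_top_limit) auto
  moreover have "\<forall>\<^sub>F z in at_top. (1 - \<beta>) * (1 - exp (- (2 * \<mu>p) * z)) / (2 * \<mu>p) = scale_function z"
    using eventually_ge_at_top[of 0] by eventually_elim (simp add: scale_function_def scale_right_def)
  ultimately show ?thesis unfolding scale_sup_def by (simp add: tendsto_cong)
qed

lemma scale_tendsto_at_bot: "(scale_function \<longlongrightarrow> scale_inf) at_bot"
proof -
  have "((\<lambda>z. (1 + \<beta>) * (1 - exp (- (- 2 * \<mu>m) * z)) / (2 * \<mu>m)) \<longlongrightarrow> (1 + \<beta>) * (1 - 0) / (2 * \<mu>m)) at_top"
    using \<mu> by (intro tendsto_intros exp_at_top_limit) auto
  moreover have "\<forall>\<^sub>F z in at_top. (1 + \<beta>) * (1 - exp (- (- 2 * \<mu>m) * z)) / (2 * \<mu>m) = scale_function (- z)"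
    using eventually_gt_at_top[of 0] by eventually_elim (simp add: scale_function_def scale_left_def)
  ultimately have "((\<lambda>z. scale_function (- z)) \<longlongrightarrow> scale_inf) at_top" unfolding scale_inf_def by (simp add: tendsto_cong)
  then show ?thesis by (simp add: filterlim_at_bot_mirror)
qed

text \<open>
  A limit at or beyond an end value of the scale function forces the path past every level; a limit
  strictly inside lies between two values of the scale function and traps the path between the
  corresponding levels.
\<close>

lemma scale_limit_trichotomy:
  assumes lim: "((\<lambda>t. scale_function (y t)) \<longlongrightarrow> c) (at_top :: real filter)"
  shows "filterlim y at_top at_top \<or> filterlim y at_bot at_top \<or> (\<exists>m. \<forall>\<^sub>F t in at_top. \<bar>y t\<bar> \<le> m)"
proof -
  have less: "scale_function u < scale_function v \<longleftrightarrow> u < v" for u v by (rule strict_mono_less[OF strict_mono_scale])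
  have above: "\<forall>\<^sub>F t in at_top. z < y t" if "scale_function z < c" for z
    using order_tendstoD(1)[OF lim that] by eventually_elim (simp add: less)
  have below: "\<forall>\<^sub>F t in at_top. y t < z" if "c < scale_function z" for z
    using order_tendstoD(2)[OF lim that] by eventually_elim (simp add: less)
  consider "scale_sup \<le> c" | "c \<le> scale_inf" | "scale_inf < c" "c < scale_sup" by linarith
  then show ?thesis
  proof cases
    case 1
    then have "filterlim y at_top at_top"
      unfolding filterlim_at_top_dense using above scale_bounds(2) less_le_trans by blast
    then show ?thesis by blast
  next
    case 2
    then have "filterlim y at_bot at_top"
      unfolding filterlim_at_bot_dense using below scale_bounds(1) le_less_trans by blast
    then show ?thesis by blast
  next
    case 3
    have "\<exists>z. scale_function z < c"
      using order_tendstoD(2)[OF scale_tendsto_at_bot 3(1)] by (auto simp: eventually_at_bot_linorder)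
    moreover have "\<exists>z. c < scale_function z"
      using order_tendstoD(1)[OF scale_tendsto_at_top 3(2)] by (auto simp: eventually_at_top_linorder)
    ultimately obtain z z' where "scale_function z < c" "c < scale_function z'" by blast
    then have "\<forall>\<^sub>F t in at_top. z < y t" "\<forall>\<^sub>F t in at_top. y t < z'" using above below by auto
    then have "\<forall>\<^sub>F t in at_top. \<bar>y t\<bar> \<le> max \<bar>z\<bar> \<bar>z'\<bar>" by eventually_elim auto
    then show ?thesis by blast
  qed
qed

end

context refracted_skew_bm
begin

lemma scale_X_measurable: "0 \<le> t \<Longrightarrow> (\<lambda>\<omega>. scale_function (X t \<omega>)) \<in> borel_measurable (\<F> t)"
  by (rule measurable_compose[OF X_adapted scale_measurable])

lemma scale_X_measurable_M: "0 \<le> t \<Longrightarrow> (\<lambda>\<omega>. scale_function (X t \<omega>)) \<in> borel_measurable M"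
  by (rule \<F>_measurable[OF scale_X_measurable])

definition scale_bound :: real where "scale_bound = max \<bar>scale_sup\<bar> \<bar>scale_inf\<bar>"

lemma abs_scale_le: "\<bar>scale_function z\<bar> \<le> scale_bound"
  using scale_bounds[of z] unfolding scale_bound_def by linarith

definition energy :: "real \<Rightarrow> real" where "energy t = expectation (\<lambda>\<omega>. (scale_function (X t \<omega>))\<^sup>2)"

lemma scale_X_sq: "0 \<le> t \<Longrightarrow> integrable M (\<lambda>\<omega>. (scale_function (X t \<omega>))\<^sup>2)" "energy t \<le> scale_bound\<^sup>2"
proof -
  have b: "(scale_function z)\<^sup>2 \<le> scale_bound\<^sup>2" for z
    using abs_scale_le[of z] by (metis abs_ge_zero power2_abs power_mono)
  show i: "integrable M (\<lambda>\<omega>. (scale_function (X t \<omega>))\<^sup>2)" if "0 \<le> t" for t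
    by (rule integrable_const_bound[where B="scale_bound\<^sup>2"])
       (use b scale_X_measurable_M[OF that] in auto)
  show "energy t \<le> scale_bound\<^sup>2"
  proof (cases "integrable M (\<lambda>\<omega>. (scale_function (X t \<omega>))\<^sup>2)")
    case True
    have "energy t \<le> expectation (\<lambda>\<omega>. scale_bound\<^sup>2)"
      unfolding energy_def by (rule integral_mono[OF True]) (use b in auto)
    then show ?thesis by (simp add: prob_space)
  next
    case False
    then show ?thesis unfolding energy_def by (simp add: not_integrable_integral_eq)
  qed
qed

text \<open>
  Orthogonality of martingale increments; in particular the energy is increasing.
\<close>

lemma energy_increment:
  assumes rt: "0 \<le> r" "r \<le> t"
  shows "expectation (\<lambda>\<omega>. (scale_function (X t \<omega>) - scale_function (X r \<omega>))\<^sup>2) = energy t - energy r"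
proof -
  let ?s = "\<lambda>t \<omega>. scale_function (X t \<omega>)"
  have t: "0 \<le> t" using rt by simp
  have i: "integrable M (\<lambda>\<omega>. ?s r \<omega> * (?s t \<omega> - ?s r \<omega>))"
  proof (rule integrable_const_bound[where B="scale_bound * (2 * scale_bound)"])
    have "\<bar>scale_function u * (scale_function v - scale_function u)\<bar> \<le> scale_bound * (2 * scale_bound)" for u v
      unfolding abs_mult using abs_scale_le[of u] abs_scale_le[of v] by (intro mult_mono) auto
    then show "AE \<omega> in M. norm (?s r \<omega> * (?s t \<omega> - ?s r \<omega>)) \<le> scale_bound * (2 * scale_bound)" by simp
  qed (intro borel_measurable_times borel_measurable_diff scale_X_measurable_M rt t)
  have "(?s t \<omega> - ?s r \<omega>)\<^sup>2 = (?s t \<omega>)\<^sup>2 - (?s r \<omega>)\<^sup>2 - 2 * (?s r \<omega> * (?s t \<omega> - ?s r \<omega>))" for \<omega>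
    by (simp add: power2_eq_square algebra_simps)
  then have "expectation (\<lambda>\<omega>. (?s t \<omega> - ?s r \<omega>)\<^sup>2)
    = expectation (\<lambda>\<omega>. (?s t \<omega>)\<^sup>2 - (?s r \<omega>)\<^sup>2 - 2 * (?s r \<omega> * (?s t \<omega> - ?s r \<omega>)))" by simp
  also have "\<dots> = energy t - energy r - 2 * expectation (\<lambda>\<omega>. ?s r \<omega> * (?s t \<omega> - ?s r \<omega>))"
    unfolding energy_def using i scale_X_sq(1)[OF t] scale_X_sq(1)[OF rt(1)] by simp
  also have "expectation (\<lambda>\<omega>. ?s r \<omega> * (?s t \<omega> - ?s r \<omega>)) = 0"
    by (rule scale_martingale[OF rt scale_X_measurable[OF rt(1)] abs_scale_le])
  finally show ?thesis by simp
qed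

text \<open>
  Only grid times in \<open>[T, T + k]\<close> with mesh \<open>2 ^ -k\<close> are inspected. As \<open>k\<close> grows the grids are nested
  and exhaust the dyadic times after \<open>T\<close>.
\<close>

definition tail_oscillation :: "nat \<Rightarrow> real \<Rightarrow> nat \<Rightarrow> 'a set" where
  "tail_oscillation T lam k = {\<omega> \<in> space M. \<exists>i\<le>k * 2 ^ k.
     lam \<le> \<bar>scale_function (X (real T + real i / 2 ^ k) \<omega>) - scale_function (X (real T) \<omega>)\<bar>}"

lemma tail_oscillation_prob:
  assumes l: "0 < lam"
  shows "prob (tail_oscillation T lam k) \<le> (energy (real T + real k) - energy (real T)) / lam\<^sup>2"
proof -
  let ?u = "\<lambda>i::nat. real T + real i / 2 ^ k"
  let ?N = "\<lambda>i \<omega>. scale_function (X (?u i) \<omega>) - scale_function (X (real T) \<omega>)"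
  have u0: "0 \<le> ?u i" "real T \<le> ?u i" for i by auto
  have umono: "?u i \<le> ?u j" if "i \<le> j" for i j using that by (simp add: divide_right_mono)
  have un: "?u (k * 2 ^ k) = real T + real k" by simp
  have "prob {\<omega> \<in> space M. \<exists>i\<le>k * 2 ^ k. lam \<le> \<bar>?N i \<omega>\<bar>} \<le> expectation (\<lambda>\<omega>. (?N (k * 2 ^ k) \<omega>)\<^sup>2) / lam\<^sup>2"
  proof (rule L2_maximal_inequality[where F="\<lambda>i. \<F> (?u i)" and K="2 * scale_bound"])
    show "sets (\<F> (?u i)) \<subseteq> sets (\<F> (?u (Suc i)))" for i
      by (rule sets_augmented_filtration_mono[OF umono]) simp
    show "?N i \<in> borel_measurable (\<F> (?u i))" for i
      by (intro borel_measurable_diff scale_X_measurable u0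
          measurable_augmented_filtration_mono[OF scale_X_measurable u0(2)]) simp
    show "\<bar>?N i \<omega>\<bar> \<le> 2 * scale_bound" for i \<omega>
      using abs_scale_le[of "X (?u i) \<omega>"] abs_scale_le[of "X (real T) \<omega>"] by linarith
    show "expectation (\<lambda>\<omega>. W \<omega> * (?N (k * 2 ^ k) \<omega> - ?N i \<omega>)) = 0"
      if "i \<le> k * 2 ^ k" "W \<in> borel_measurable (\<F> (?u i))" "\<And>\<omega>. \<bar>W \<omega>\<bar> \<le> c" for i W c
      using scale_martingale[OF u0(1) umono[OF that(1)] that(2,3)] by simp
  qed (use l sets_\<F> in auto)
  then show ?thesis
    unfolding tail_oscillation_def un using energy_increment[of "real T" "real T + real k"] by simp
qed

lemma tail_oscillation_sets: "tail_oscillation T lam k \<in> events"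
proof -
  let ?P = "\<lambda>i \<omega>. lam \<le> \<bar>scale_function (X (real T + real i / 2 ^ k) \<omega>) - scale_function (X (real T) \<omega>)\<bar>"
  have "{\<omega> \<in> space M. ?P i \<omega>} \<in> events" for i :: nat
    by (intro borel_measurable_le borel_measurable_const borel_measurable_abs borel_measurable_diff
        scale_X_measurable_M) auto
  then have "{\<omega> \<in> space M. \<exists>i\<in>{..k * 2 ^ k}. ?P i \<omega>} \<in> events"
    by (rule sets.sets_Collect_finite_Ex) (rule finite_atMost)
  moreover have "tail_oscillation T lam k = {\<omega> \<in> space M. \<exists>i\<in>{..k * 2 ^ k}. ?P i \<omega>}"
    unfolding tail_oscillation_def Bex_def atMost_iff ..
  ultimately show ?thesis by (simp only:)
qed

lemma tail_oscillation_incseq: "incseq (tail_oscillation T lam)"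
proof (rule incseq_SucI, rule subsetI)
  fix k \<omega> assume "\<omega> \<in> tail_oscillation T lam k"
  then obtain i where i: "\<omega> \<in> space M" "i \<le> k * 2 ^ k"
    "lam \<le> \<bar>scale_function (X (real T + real i / 2 ^ k) \<omega>) - scale_function (X (real T) \<omega>)\<bar>"
    by (auto simp: tail_oscillation_def)
  have "real (2 * i) / 2 ^ Suc k = real i / 2 ^ k" by simp
  moreover have "2 * i \<le> Suc k * 2 ^ Suc k" using i(2) by (simp add: algebra_simps)
  ultimately show "\<omega> \<in> tail_oscillation T lam (Suc k)"
    unfolding tail_oscillation_def using i by (auto intro!: exI[of _ "2 * i"])
qed

lemma continuous_scale_function: "continuous_on UNIV scale_function"
proof -
  have R: "continuous_on UNIV scale_right" and L: "continuous_on UNIV scale_left"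
    using has_real_derivative_scale_parts(1,2) by (meson DERIV_continuous_on has_field_derivative_at_within)+
  have "continuous_on ({0..} \<union> {..0}) (\<lambda>x. if 0 \<le> x then scale_right x else scale_left x)"
  proof (rule continuous_on_If)
    show "continuous_on {0..} scale_right" "continuous_on {..0} scale_left"
      by (rule continuous_on_subset[OF R subset_UNIV], rule continuous_on_subset[OF L subset_UNIV])
  qed (auto simp: scale_right_def scale_left_def)
  moreover have "{0..} \<union> {..0} = (UNIV :: real set)" by auto
  ultimately show ?thesis unfolding scale_function_def[abs_def] by simp
qed

text \<open>
  Dyadic approximation from below, and continuity of the path.
\<close>

lemma not_tail_oscillation:
  assumes \<omega>: "\<omega> \<in> space M" and no: "\<And>k. \<omega> \<notin> tail_oscillation T lam k" and u: "real T \<le> u"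
  shows "\<bar>scale_function (X u \<omega>) - scale_function (X (real T) \<omega>)\<bar> \<le> lam"
proof -
  define v where "v k = real T + real (nat \<lfloor>(u - real T) * 2 ^ k\<rfloor>) / 2 ^ k" for k
  have near: "\<bar>v k - u\<bar> \<le> (1 / 2) ^ k" for k
  proof -
    let ?w = "(u - real T) * 2 ^ k"
    have w0: "0 \<le> ?w" using u by simp
    then have "real (nat \<lfloor>?w\<rfloor>) = of_int \<lfloor>?w\<rfloor>" by simp
    then have "\<bar>real (nat \<lfloor>?w\<rfloor>) - ?w\<bar> \<le> 1" by linarith
    moreover have "v k - u = (real (nat \<lfloor>?w\<rfloor>) - ?w) / 2 ^ k" by (simp add: v_def field_simps)
    ultimately show ?thesis by (simp add: power_one_over divide_right_mono)
  qed
  have "(\<lambda>k. v k - u) \<longlonglongrightarrow> 0"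
    by (rule Lim_null_comparison[of _ "\<lambda>k. (1 / 2) ^ k"]) (use near in \<open>auto intro!: LIMSEQ_power_zero\<close>)
  then have v: "v \<longlonglongrightarrow> u" by (simp add: LIM_zero_iff)
  have c: "continuous_on {0..} (\<lambda>s. scale_function (X s \<omega>))"
    by (rule continuous_on_compose2[OF continuous_scale_function X_continuous[OF \<omega>]]) simp
  have "(\<lambda>k. scale_function (X (v k) \<omega>)) \<longlonglongrightarrow> scale_function (X u \<omega>)"
    by (rule continuous_on_tendsto_compose[OF c v]) (use u in \<open>auto simp: v_def\<close>)
  then have "(\<lambda>k. \<bar>scale_function (X (v k) \<omega>) - scale_function (X (real T) \<omega>)\<bar>)
      \<longlonglongrightarrow> \<bar>scale_function (X u \<omega>) - scale_function (X (real T) \<omega>)\<bar>"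
    by (intro tendsto_intros)
  moreover obtain k0 :: nat where k0: "u - real T \<le> real k0" using real_arch_simple by blast
  have "\<bar>scale_function (X (v k) \<omega>) - scale_function (X (real T) \<omega>)\<bar> \<le> lam" if k: "k0 \<le> k" for k
  proof -
    have "(u - real T) * 2 ^ k \<le> real k * 2 ^ k" using k0 k by (intro mult_right_mono) auto
    then have "real_of_int \<lfloor>(u - real T) * 2 ^ k\<rfloor> \<le> real k * 2 ^ k"
      by (rule order_trans[OF of_int_floor_le])
    also have "real k * 2 ^ k = real_of_int (int (k * 2 ^ k))" by simp
    finally have "\<lfloor>(u - real T) * 2 ^ k\<rfloor> \<le> int (k * 2 ^ k)" by (simp only: of_int_le_iff)
    then have "nat \<lfloor>(u - real T) * 2 ^ k\<rfloor> \<le> k * 2 ^ k" by linarith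
    moreover have "\<forall>i\<le>k * 2 ^ k. \<not> lam \<le> \<bar>scale_function (X (real T + real i / 2 ^ k) \<omega>) - scale_function (X (real T) \<omega>)\<bar>"
      using no[of k] \<omega> unfolding tail_oscillation_def by blast
    ultimately have "\<not> lam \<le> \<bar>scale_function (X (v k) \<omega>) - scale_function (X (real T) \<omega>)\<bar>"
      unfolding v_def by blast
    then show ?thesis by linarith
  qed
  ultimately show ?thesis by (intro LIMSEQ_le_const2) auto
qed

text \<open>
  By the maximal inequality the probability of an oscillation after time \<open>T\<close> is at most the remaining
  gain of energy over \<open>lam\<^sup>2\<close>, which tends to \<open>0\<close> as \<open>T\<close> grows because the energy is bounded.
\<close>

lemma AE_small_tail_oscillation:
  assumes l: "0 < lam"
  shows "AE \<omega> in M. \<exists>T. \<forall>k. \<omega> \<notin> tail_oscillation T lam k"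
proof -
  define D where "D T = (\<Union>k. tail_oscillation T lam k)" for T
  have Ds: "D T \<in> events" for T unfolding D_def using tail_oscillation_sets by blast
  define a where "a = Sup (range (\<lambda>n::nat. energy (real n)))"
  have bdd: "bdd_above (range (\<lambda>n::nat. energy (real n)))" using scale_X_sq(2) by (intro bdd_aboveI) auto
  have le_a: "energy (real n) \<le> a" for n :: nat unfolding a_def by (rule cSup_upper[OF _ bdd]) simp
  have pD: "prob (D T) \<le> (a - energy (real T)) / lam\<^sup>2" for T
  proof (rule LIMSEQ_le_const2)
    show "(\<lambda>k. prob (tail_oscillation T lam k)) \<longlonglongrightarrow> prob (D T)"
      unfolding D_def using tail_oscillation_sets tail_oscillation_incseq
      by (intro finite_Lim_measure_incseq) auto
    have "prob (tail_oscillation T lam k) \<le> (a - energy (real T)) / lam\<^sup>2" for k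
    proof (rule order_trans[OF tail_oscillation_prob[OF l]])
      show "(energy (real T + real k) - energy (real T)) / lam\<^sup>2 \<le> (a - energy (real T)) / lam\<^sup>2"
        using le_a[of "T + k"] by (intro divide_right_mono) auto
    qed
    then show "\<exists>N. \<forall>k\<ge>N. prob (tail_oscillation T lam k) \<le> (a - energy (real T)) / lam\<^sup>2" by blast
  qed
  have "prob (\<Inter>T. D T) \<le> 0 + e" if e: "0 < e" for e
  proof -
    have "a - e * lam\<^sup>2 < a" using e l by simp
    then obtain n :: nat where n: "a - e * lam\<^sup>2 < energy (real n)"
      using less_cSup_iff[OF _ bdd] unfolding a_def by auto
    have "prob (\<Inter>T. D T) \<le> prob (D n)" by (rule finite_measure_mono) (use Ds in auto)
    also have "\<dots> \<le> (a - energy (real n)) / lam\<^sup>2" by (rule pD)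
    also have "\<dots> \<le> e" using n l by (simp add: divide_le_eq)
    finally show ?thesis by simp
  qed
  then have "prob (\<Inter>T. D T) \<le> 0" by (rule field_le_epsilon)
  then have "prob (\<Inter>T. D T) = 0" by (simp add: measure_le_0_iff)
  moreover have "(\<Inter>T. D T) \<in> events" using Ds by blast
  ultimately have "(\<Inter>T. D T) \<in> null_sets M" by (simp add: null_sets_def emeasure_eq_measure)
  from AE_not_in[OF this] show ?thesis by eventually_elim (auto simp: D_def)
qed

lemma AE_scale_converges: "AE \<omega> in M. \<exists>c. ((\<lambda>t. scale_function (X t \<omega>)) \<longlongrightarrow> c) at_top"
proof -
  have "AE \<omega> in M. \<forall>j::nat. \<exists>T. \<forall>k. \<omega> \<notin> tail_oscillation T (1 / real (Suc j)) k"
    unfolding AE_all_countable by (intro allI AE_small_tail_oscillation) simp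
  then show ?thesis using AE_space
  proof eventually_elim
    case (elim \<omega>)
    show ?case
    proof (rule tendsto_at_top_of_small_tail_oscillation)
      fix j :: nat
      obtain T where T: "\<And>k. \<omega> \<notin> tail_oscillation T (1 / real (Suc j)) k" using elim(1) by blast
      show "\<exists>T::nat. \<forall>u\<ge>real T. \<bar>scale_function (X u \<omega>) - scale_function (X (real T) \<omega>)\<bar> \<le> 1 / real (Suc j)"
        using not_tail_oscillation[OF elim(2) T] by blast
    qed
  qed
qed

text \<open>
  A path that stays in \<open>[-m, m]\<close> after some time accumulates occupation at a rate of at least
  \<open>occ_rate m\<close>, which contradicts \<open>AE_occupation_bounded\<close>.
\<close>

lemma AE_transient:
  "AE \<omega> in M. filterlim (\<lambda>t. X t \<omega>) at_top at_top \<or> filterlim (\<lambda>t. X t \<omega>) at_bot at_top"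
  using AE_scale_converges AE_occupation_bounded AE_space
proof eventually_elim
  case (elim \<omega>)
  obtain C where C: "\<And>n::nat. integral {0..real n} (\<lambda>s. occ_rate (X s \<omega>)) \<le> C" using elim(2) by blast
  have "\<not> (\<exists>m. \<forall>\<^sub>F t in at_top. \<bar>X t \<omega>\<bar> \<le> m)"
  proof
    assume "\<exists>m. \<forall>\<^sub>F t in at_top. \<bar>X t \<omega>\<bar> \<le> m"
    then obtain m T where mT: "\<And>t. T \<le> t \<Longrightarrow> \<bar>X t \<omega>\<bar> \<le> m" by (auto simp: eventually_at_top_linorder)
    obtain N :: nat where N: "T \<le> real N" using real_arch_simple by blast
    have m0: "0 \<le> m" using mT[OF N] by linarith
    have low: "occ_rate m \<le> occ_rate (X t \<omega>)" if "real N \<le> t" for t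
    proof -
      have "\<bar>X t \<omega>\<bar> \<le> \<bar>m\<bar>" using mT[of t] that N m0 by simp
      then have "(\<kappa> * X t \<omega>)\<^sup>2 \<le> (\<kappa> * m)\<^sup>2"
        unfolding power_mult_distrib by (intro mult_left_mono) (auto simp: abs_le_square_iff)
      then have "(1 + (\<kappa> * X t \<omega>)\<^sup>2) ^ 3 \<le> (1 + (\<kappa> * m)\<^sup>2) ^ 3" by (intro power_mono) auto
      moreover have "0 < (1 + (\<kappa> * X t \<omega>)\<^sup>2) ^ 3" by (rule zero_less_power[OF one_plus_square_pos])
      ultimately show ?thesis unfolding occ_rate_def by (intro divide_left_mono) auto
    qed
    have ir: "(\<lambda>s. occ_rate (X s \<omega>)) integrable_on {u..t}" if "0 \<le> u" for u t
      by (intro integrable_continuous_real continuous_on_compose2[OF continuous_occ_rate]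
          continuous_on_subset[OF X_continuous[OF elim(3)]]) (use that in auto)
    have "real k * occ_rate m \<le> C" for k :: nat
    proof -
      have "real k * occ_rate m = integral {real N..real (N + k)} (\<lambda>s. occ_rate m)" by simp
      also have "\<dots> \<le> integral {real N..real (N + k)} (\<lambda>s. occ_rate (X s \<omega>))"
        by (rule integral_le[OF integrable_const_ivl ir]) (use low in auto)
      also have "\<dots> \<le> integral {0..real (N + k)} (\<lambda>s. occ_rate (X s \<omega>))"
        by (rule integral_subset_le) (use ir occ_rate_nonneg in auto)
      also have "\<dots> \<le> C" by (rule C)
      finally show ?thesis .
    qed
    moreover obtain k :: nat where "C < real k * occ_rate m"
      using reals_Archimedean3[OF occ_rate_bounds(1)[of m]] by blast
    ultimately show False by (meson not_le)
  qed
  moreover obtain c where "((\<lambda>t. scale_function (X t \<omega>)) \<longlongrightarrow> c) at_top" using elim(1) by blast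
  from scale_limit_trichotomy[OF this] have "filterlim (\<lambda>t. X t \<omega>) at_top at_top \<or> filterlim (\<lambda>t. X t \<omega>) at_bot at_top \<or>
     (\<exists>m. \<forall>\<^sub>F t in at_top. \<bar>X t \<omega>\<bar> \<le> m)" .
  ultimately show ?case by blast
qed

definition to_top :: "'a set" where "to_top = {\<omega> \<in> space M. filterlim (\<lambda>t. X t \<omega>) at_top at_top}"
definition to_bot :: "'a set" where "to_bot = {\<omega> \<in> space M. filterlim (\<lambda>t. X t \<omega>) at_bot at_top}"

lemma X_continuous_process: "continuous_process M X"
  using solution by (simp add: refracted_skew_brownian_motion_def)

lemma to_sets [measurable]: "to_top \<in> events" "to_bot \<in> events"
  unfolding to_top_def to_bot_def
  using measurable_filterlim_at_top measurable_filterlim_at_bot X_continuous_process by blast+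

lemma to_disjoint: "to_top \<inter> to_bot = {}"
proof -
  have False if "filterlim (\<lambda>t. X t \<omega>) at_top at_top" "filterlim (\<lambda>t. X t \<omega>) at_bot at_top" for \<omega>
  proof -
    have "\<forall>\<^sub>F t in at_top. 0 < X t \<omega>" "\<forall>\<^sub>F t in at_top. X t \<omega> < 0"
      using that by (auto simp: filterlim_at_top_dense filterlim_at_bot_dense)
    then have "\<forall>\<^sub>F t::real in at_top. False" by eventually_elim simp
    then show False by simp
  qed
  then show ?thesis unfolding to_top_def to_bot_def by blast
qed

lemma prob_sum: "prob to_top + prob to_bot = 1"
proof -
  have "prob to_top + prob to_bot = prob (to_top \<union> to_bot)"
    by (rule finite_measure_Union[symmetric]) (use to_sets to_disjoint in auto)
  also have "\<dots> = 1"
  proof (rule prob_eq_1[THEN iffD2])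
    show "to_top \<union> to_bot \<in> events" using to_sets by blast
    show "AE \<omega> in M. \<omega> \<in> to_top \<union> to_bot"
      using AE_transient AE_space by eventually_elim (auto simp: to_top_def to_bot_def)
  qed
  finally show ?thesis .
qed

text \<open>
  Dominated convergence in \<open>E s(X\<^sub>n) = s(x)\<close>.
\<close>

lemma expectation_limit: "prob to_top * scale_sup + prob to_bot * scale_inf = scale_function x"
proof -
  let ?s = "\<lambda>n \<omega>. scale_function (X (real n) \<omega>)"
  let ?l = "\<lambda>\<omega>. indicator to_top \<omega> * scale_sup + indicator to_bot \<omega> * scale_inf"
  have const: "expectation (?s n) = scale_function x" for n
  proof -
    have i: "integrable M (\<lambda>\<omega>. scale_function (X t \<omega>))" if "0 \<le> t" for t
      by (rule integrable_const_bound[where B=scale_bound]) (use abs_scale_le scale_X_measurable_M[OF that] in auto)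
    have "expectation (\<lambda>\<omega>. 1 * (?s n \<omega> - scale_function (X 0 \<omega>))) = 0"
      by (rule scale_martingale[where c=1]) auto
    then have "expectation (?s n) = expectation (\<lambda>\<omega>. scale_function (X 0 \<omega>))" using i by simp
    also have "\<dots> = expectation (\<lambda>\<omega>. scale_function x)"
    proof (rule integral_cong_AE)
      show "AE \<omega> in M. scale_function (X 0 \<omega>) = scale_function x"
        using AE_good_path by eventually_elim (simp add: good_path_def)
    qed (use scale_X_measurable_M in auto)
    finally show ?thesis by (simp add: prob_space)
  qed
  have "(\<lambda>n. expectation (?s n)) \<longlonglongrightarrow> expectation ?l"
  proof (rule integral_dominated_convergence[where w="\<lambda>_. scale_bound"])
    show "AE \<omega> in M. (\<lambda>n. ?s n \<omega>) \<longlonglongrightarrow> ?l \<omega>"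
      using AE_transient AE_space
    proof eventually_elim
      case (elim \<omega>)
      from elim(1) show ?case
      proof
        assume L: "filterlim (\<lambda>t. X t \<omega>) at_top at_top"
        then have "?l \<omega> = scale_sup" using elim(2) to_disjoint by (auto simp: to_top_def indicator_def)
        moreover have "(\<lambda>n. ?s n \<omega>) \<longlonglongrightarrow> scale_sup"
          by (rule filterlim_compose[OF filterlim_compose[OF scale_tendsto_at_top L] filterlim_real_sequentially])
        ultimately show ?thesis by simp
      next
        assume L: "filterlim (\<lambda>t. X t \<omega>) at_bot at_top"
        then have "?l \<omega> = scale_inf" using elim(2) to_disjoint by (auto simp: to_bot_def indicator_def)
        moreover have "(\<lambda>n. ?s n \<omega>) \<longlonglongrightarrow> scale_inf"
          by (rule filterlim_compose[OF filterlim_compose[OF scale_tendsto_at_bot L] filterlim_real_sequentially])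
        ultimately show ?thesis by simp
      qed
    qed
    show "?s n \<in> borel_measurable M" for n by (rule scale_X_measurable_M) simp
    show "AE \<omega> in M. norm (?s n \<omega>) \<le> scale_bound" for n using abs_scale_le by simp
  qed auto
  moreover have "expectation ?l = prob to_top * scale_sup + prob to_bot * scale_inf"
    by (subst Bochner_Integration.integral_add) (auto intro!: integrable_mult_left integrable_real_indicator simp: emeasure_eq_measure)
  ultimately show ?thesis unfolding const by (simp add: LIMSEQ_const_iff)
qed

lemma prob_to_top: "prob to_top = (scale_function x - scale_inf) / (scale_sup - scale_inf)"
proof -
  have "scale_inf < scale_sup" using scale_bounds[of 0] by simp
  moreover have b: "prob to_bot = 1 - prob to_top" using prob_sum by linarith
  have "prob to_top * (scale_sup - scale_inf) = scale_function x - scale_inf"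
    using expectation_limit unfolding b by (simp add: algebra_simps)
  ultimately show ?thesis by (simp add: field_simps)
qed

lemma prob_to_top_neg:
  assumes "x < 0"
  shows "prob to_top = (1 + \<beta>) * \<mu>p * exp (- 2 * \<mu>m * x) / ((1 + \<beta>) * \<mu>p - (1 - \<beta>) * \<mu>m)"
proof -
  have d: "0 < (1 + \<beta>) * \<mu>p - (1 - \<beta>) * \<mu>m"
  proof -
    have "0 < (1 + \<beta>) * \<mu>p" "(1 - \<beta>) * \<mu>m < 0" using \<beta> \<mu> by (auto simp: mult_pos_neg)
    then show ?thesis by linarith
  qed
  have D: "scale_sup - scale_inf = - ((1 + \<beta>) * \<mu>p - (1 - \<beta>) * \<mu>m) / (2 * \<mu>p * \<mu>m)"
    unfolding scale_sup_def scale_inf_def using \<mu> by (simp add: field_simps)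
  have N: "scale_function x - scale_inf = - ((1 + \<beta>) * \<mu>p * exp (- 2 * \<mu>m * x)) / (2 * \<mu>p * \<mu>m)"
    unfolding scale_function_def scale_left_def scale_inf_def using assms \<mu> by (simp add: field_simps)
  have "(- p / e) / (- q / e) = p / q" if "e \<noteq> 0" for p q e :: real using that by simp
  moreover have "2 * \<mu>p * \<mu>m \<noteq> 0" using \<mu> by simp
  ultimately show ?thesis unfolding prob_to_top D N by blast
qed

lemma prob_to_top_pos:
  assumes "x > 0"
  shows "prob to_top = 1 + (1 - \<beta>) * \<mu>m * exp (- 2 * \<mu>p * x) / ((1 + \<beta>) * \<mu>p - (1 - \<beta>) * \<mu>m)"
proof -
  have d: "0 < (1 + \<beta>) * \<mu>p - (1 - \<beta>) * \<mu>m"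
  proof -
    have "0 < (1 + \<beta>) * \<mu>p" "(1 - \<beta>) * \<mu>m < 0" using \<beta> \<mu> by (auto simp: mult_pos_neg)
    then show ?thesis by linarith
  qed
  have D: "scale_sup - scale_inf = - ((1 + \<beta>) * \<mu>p - (1 - \<beta>) * \<mu>m) / (2 * \<mu>p * \<mu>m)"
    unfolding scale_sup_def scale_inf_def using \<mu> by (simp add: field_simps)
  have N: "scale_function x - scale_inf = (scale_sup - scale_inf) + - ((1 - \<beta>) * \<mu>m * exp (- 2 * \<mu>p * x)) / (2 * \<mu>p * \<mu>m)"
    unfolding scale_function_def scale_right_def scale_sup_def using assms \<mu> by (simp add: field_simps)
  have "(- q / e + - p / e) / (- q / e) = 1 + p / q" if "e \<noteq> 0" "q \<noteq> 0" for p q e :: real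
    using that by (simp add: field_simps)
  moreover have "2 * \<mu>p * \<mu>m \<noteq> 0" "(1 + \<beta>) * \<mu>p - (1 - \<beta>) * \<mu>m \<noteq> 0" using \<mu> d by simp_all
  ultimately show ?thesis unfolding prob_to_top N unfolding D by blast
qed

end

theorem proposition7:
  fixes M :: "'a measure"
    and B X :: "real \<Rightarrow> 'a \<Rightarrow> real"
    and \<beta> \<mu>p \<mu>m x :: real
  assumes "-1 < \<beta>" and "\<beta> < 1"
    and "\<mu>p > 0" and "\<mu>m < 0"
    and "refracted_skew_brownian_motion M B \<beta> \<mu>p \<mu>m 0 x X"
  shows
    "(x < 0 \<longrightarrow>
        measure M {\<omega> \<in> space M. filterlim (\<lambda>t. X t \<omega>) at_top at_top}
          = (1 + \<beta>) * \<mu>p * exp (- 2 * \<mu>m * x) / ((1 + \<beta>) * \<mu>p - (1 - \<beta>) * \<mu>m)) \<and>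
     (x > 0 \<longrightarrow>
        measure M {\<omega> \<in> space M. filterlim (\<lambda>t. X t \<omega>) at_top at_top}
          = 1 + (1 - \<beta>) * \<mu>m * exp (- 2 * \<mu>p * x) / ((1 + \<beta>) * \<mu>p - (1 - \<beta>) * \<mu>m)) \<and>
     (x < 0 \<longrightarrow>
        measure M {\<omega> \<in> space M. filterlim (\<lambda>t. X t \<omega>) at_bot at_top}
          = 1 - (1 + \<beta>) * \<mu>p * exp (- 2 * \<mu>m * x) / ((1 + \<beta>) * \<mu>p - (1 - \<beta>) * \<mu>m)) \<and>
     (x > 0 \<longrightarrow>
        measure M {\<omega> \<in> space M. filterlim (\<lambda>t. X t \<omega>) at_bot at_top}
          = - (1 - \<beta>) * \<mu>m * exp (- 2 * \<mu>p * x) / ((1 + \<beta>) * \<mu>p - (1 - \<beta>) * \<mu>m))"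
proof -
  interpret prob_space M
    using assms(5) by (simp add: refracted_skew_brownian_motion_def standard_brownian_motion_def)
  interpret refracted_skew_bm \<beta> \<mu>p \<mu>m M B X x
    by unfold_locales (use assms in auto)
  have b: "prob to_bot = 1 - prob to_top" using prob_sum by linarith
  have eq: "- (1 - \<beta>) * \<mu>m * e / d = 1 - (1 + (1 - \<beta>) * \<mu>m * e / d)" for e d :: real
    by (simp add: minus_divide_left algebra_simps)
  show ?thesis unfolding to_top_def[symmetric] to_bot_def[symmetric] b eq
    using prob_to_top_neg prob_to_top_pos by simp
qed

end
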